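(* Identify colorings $x : T \to \{0,1\}$ with points of the Cantor space $\{0,1\}^{\mathbb{N}}$ via a fixed computable enumeration of $T$. The set $\mathcal{W}\subseteq\{0,1\}^T$ of colorings that are winning for black is $\mathbf{\Sigma}^0_4$-hard with respect to Wadge reductions in the boldface hierarchy, and $\Sigma^0_4$-hard with respect to Turing reductions in the lightface hierarchy. That is, for every (boldface) $\mathbf{\Sigma}^0_4$ set $A\subseteq\{0,1\}^{\mathbb{N}}$ there is a continuous $f$ with $f^{-1}(\mathcal{W})=A$, and for every lightface $\Sigma^0_4$ set $A$ there is a computable such $f$.
   Context: Fix a regular hexagonal tiling of $\mathbb{R}^2$ in which some tile edges are horizontal, and let $T$ be its set of tiles. Two tiles are adjacent if they share an edge. A coloring is a map $x : T \to \{0,1\}$; tiles with $x(t)=1$ are black. A path is a sequence of tiles $(t_i)_{i\in I}$, $I\subseteq\mathbb{Z}$ an interval, with consecutive tiles adjacent; it is black if all its tiles are black. Fix tiles $(d_n)_{n\in\mathbb{Z}}$ with each $d_n$ the northeast neighbour of $d_{n-1}$. $Q^+_n$ is the set of tiles obtained from $d_n$ by translations by vectors in $[0,\infty)^2$, and $Q^-_n$ the set of tiles obtained from $d_n$ by translations by vectors in $(-\infty,0]^2$. For $*\in\{+,-\}$, a one-way infinite path $(t_i)_{i\in\mathbb{N}}$ reaches to $*$ if for every $n$ there is $i$ with $t_j\in Q^*_n$ for all $j\ge i$. A coloring is winning for black if there are black paths $(t_i)_{i\in\mathbb{N}}$, $(s_i)_{i\in\mathbb{N}}$ with $t_0=s_0$,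 $(t_i)$ reaching to $+$ and $(s_i)$ reaching to $-$. A Wadge reduction of $A$ to $B$ is a continuous $f$ with $f^{-1}(B)=A$; a Turing reduction is a computable one (computed by an oracle Turing machine). *)

theory Defs
  imports "HOL-Analysis.Analysis" "HOL-Library.Nat_Bijection"
begin

section \<open>The hexagonal tiling\<close>

type_synonym tile = "(real \<times> real) set"

text \<open>The regular hexagon with centre \<open>c\<close> and side length \<open>r\<close>. Its vertices have the directions
  \<open>k * pi / 3\<close>, so two of its edges are horizontal.\<close>

definition hexagon :: "real \<Rightarrow> real \<times> real \<Rightarrow> tile" where
  "hexagon r c =
     convex hull ((\<lambda>k. c + (r * cos (real k * pi / 3), r * sin (real k * pi / 3))) ` {..<6})"

text \<open>The centres form the lattice spanned by the steps to the northeast neighbour,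
  \<open>(3/2 * r, sqrt 3 / 2 * r)\<close>, and to the north neighbour, \<open>(0, sqrt 3 * r)\<close>.\<close>

definition hex_tile :: "real \<Rightarrow> real \<times> real \<Rightarrow> int \<times> int \<Rightarrow> tile" where
  "hex_tile r p = (\<lambda>(a, b). hexagon r
     (p + of_int a *\<^sub>R (3 / 2 * r, sqrt 3 / 2 * r) + of_int b *\<^sub>R (0, sqrt 3 * r)))"

definition hex_tiling :: "real \<Rightarrow> real \<times> real \<Rightarrow> tile set" where
  "hex_tiling r p = range (hex_tile r p)"

definition adjacent :: "tile \<Rightarrow> tile \<Rightarrow> bool" where
  "adjacent s t \<longleftrightarrow> s \<noteq> t \<and> (\<exists>F. F edge_of s \<and> F edge_of t)"

definition northeast_neighbour :: "tile \<Rightarrow> tile \<Rightarrow> bool" where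
  "northeast_neighbour s t \<longleftrightarrow> adjacent s t \<and> (\<exists>u > 0. \<exists>v > 0. t = (+) (u, v) ` s)"

section \<open>Winning colorings\<close>

text \<open>A coloring is a function on tiles whose value is \<open>True\<close> at the black tiles; only its values
  on the tiling \<open>T\<close> are ever used.\<close>

definition black_path :: "tile set \<Rightarrow> (tile \<Rightarrow> bool) \<Rightarrow> (nat \<Rightarrow> tile) \<Rightarrow> bool" where
  "black_path T x t \<longleftrightarrow> (\<forall>i. t i \<in> T \<and> x (t i) \<and> adjacent (t i) (t (Suc i)))"

definition Q_plus :: "tile set \<Rightarrow> (int \<Rightarrow> tile) \<Rightarrow> int \<Rightarrow> tile set" where
  "Q_plus T d n = {t \<in> T. \<exists>u \<ge> 0. \<exists>v \<ge> 0. t = (+) (u, v) ` d n}"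

definition Q_minus :: "tile set \<Rightarrow> (int \<Rightarrow> tile) \<Rightarrow> int \<Rightarrow> tile set" where
  "Q_minus T d n = {t \<in> T. \<exists>u \<le> 0. \<exists>v \<le> 0. t = (+) (u, v) ` d n}"

definition reaches :: "(int \<Rightarrow> tile set) \<Rightarrow> (nat \<Rightarrow> tile) \<Rightarrow> bool" where
  "reaches Q t \<longleftrightarrow> (\<forall>n. \<exists>i. \<forall>j \<ge> i. t j \<in> Q n)"

definition winning_for_black :: "tile set \<Rightarrow> (int \<Rightarrow> tile) \<Rightarrow> (tile \<Rightarrow> bool) \<Rightarrow> bool" where
  "winning_for_black T d x \<longleftrightarrow>
     (\<exists>t s. black_path T x t \<and> black_path T x s \<and> t 0 = s 0 \<and>
            reaches (Q_plus T d) t \<and> reaches (Q_minus T d) s)"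

section \<open>Oracle Turing machines\<close>

text \<open>A machine has a two-way infinite read-only oracle tape, carrying the oracle on the
  nonnegative cells and blanks on the negative ones, and finitely many two-way infinite work tapes.
  Work tape symbols are natural numbers; \<open>0\<close> is the blank and \<open>1\<close> the stroke. The initial state is
  \<open>0\<close>, and the machine halts where its transition function is \<open>None\<close>. The conditions in \<open>valid_otm\<close>
  ensure that only finitely many arguments of the transition function matter, so a valid machine is
  a finite object.\<close>

datatype head_move = Move_Left | Stay | Move_Right

fun move_head :: "head_move \<Rightarrow> int \<Rightarrow> int" where
  "move_head Move_Left i = i - 1"
| "move_head Stay i = i"
| "move_head Move_Right i = i + 1"

record otm =
  num_states :: nat
  num_symbols :: nat
  num_tapes :: nat
  trans :: "nat \<Rightarrow> bool option \<Rightarrow> nat list \<Rightarrow> (nat \<times> head_move \<times> (nat \<times> head_move) list) option"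

definition valid_otm :: "otm \<Rightarrow> bool" where
  "valid_otm M \<longleftrightarrow> num_states M \<ge> 1 \<and> num_symbols M \<ge> 2 \<and> num_tapes M \<ge> 1 \<and>
     (\<forall>q < num_states M. \<forall>b as q' m acts.
        length as = num_tapes M \<and> (\<forall>a \<in> set as. a < num_symbols M) \<and>
        trans M q b as = Some (q', m, acts) \<longrightarrow>
        q' < num_states M \<and> length acts = num_tapes M \<and> (\<forall>(a, _) \<in> set acts. a < num_symbols M))"

text \<open>A configuration consists of the state, the position of the oracle head, and for each work tape
  the position of its head and its contents.\<close>

type_synonym config = "nat \<times> int \<times> (int \<times> (int \<Rightarrow> nat)) list"

definition oracle_cell :: "(nat \<Rightarrow> bool) \<Rightarrow> int \<Rightarrow> bool option" where
  "oracle_cell x i = (if i < 0 then None else Some (x (nat i)))"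

fun otm_step :: "otm \<Rightarrow> (nat \<Rightarrow> bool) \<Rightarrow> config \<Rightarrow> config option" where
  "otm_step M x (q, h, ws) =
     (case trans M q (oracle_cell x h) (map (\<lambda>(i, w). w i) ws) of
        None \<Rightarrow> None
      | Some (q', m, acts) \<Rightarrow>
          Some (q', move_head m h, map2 (\<lambda>(a, m') (i, w). (move_head m' i, w(i := a))) acts ws))"

text \<open>The argument \<open>a\<close> is written as \<open>a + 1\<close> strokes; successive arguments are separated by a
  blank.\<close>

definition input_tape :: "nat list \<Rightarrow> int \<Rightarrow> nat" where
  "input_tape as i =
     (let l = concat (map (\<lambda>a. replicate (a + 1) 1 @ [0]) as)
      in if 0 \<le> i \<and> nat i < length l then l ! nat i else 0)"

definition otm_init :: "otm \<Rightarrow> nat list \<Rightarrow> config" where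
  "otm_init M as = (0, 0, (0, input_tape as) # replicate (num_tapes M - 1) (0, \<lambda>_. 0))"

text \<open>The output is the total number of strokes on the first work tape, which also held the input.\<close>

fun otm_output :: "config \<Rightarrow> nat" where
  "otm_output (q, h, ws) = card {i. snd (hd ws) i = 1}"

definition otm_yields :: "otm \<Rightarrow> (nat \<Rightarrow> bool) \<Rightarrow> nat list \<Rightarrow> nat \<Rightarrow> bool" where
  "otm_yields M x as m \<longleftrightarrow>
     (\<exists>c. (\<lambda>c c'. otm_step M x c = Some c')\<^sup>*\<^sup>* (otm_init M as) c \<and>
          otm_step M x c = None \<and> otm_output c = m)"

definition computable_fun :: "(nat \<Rightarrow> nat) \<Rightarrow> bool" where
  "computable_fun g \<longleftrightarrow> (\<exists>M. valid_otm M \<and> (\<forall>n. otm_yields M (\<lambda>_. False) [n] (g n)))"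

definition computable_rel :: "nat \<Rightarrow> ((nat \<Rightarrow> bool) \<Rightarrow> nat list \<Rightarrow> bool) \<Rightarrow> bool" where
  "computable_rel k R \<longleftrightarrow>
     (\<exists>M. valid_otm M \<and> (\<forall>x as. length as = k \<longrightarrow> otm_yields M x as (of_bool (R x as))))"

definition computable_functional :: "((nat \<Rightarrow> bool) \<Rightarrow> (nat \<Rightarrow> bool)) \<Rightarrow> bool" where
  "computable_functional f \<longleftrightarrow>
     (\<exists>M. valid_otm M \<and> (\<forall>x n. otm_yields M x [n] (of_bool (f x n))))"

section \<open>Borel and arithmetical hierarchies\<close>

text \<open>Only the levels from \<open>1\<close> on are meaningful.\<close>

fun boldface_Sigma :: "nat \<Rightarrow> 'a::topological_space set set" where
  "boldface_Sigma 0 = {}"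
| "boldface_Sigma (Suc 0) = {A. open A}"
| "boldface_Sigma (Suc (Suc n)) =
     {\<Union>i::nat. - B i | B. \<forall>i. B i \<in> boldface_Sigma (Suc n)}"

text \<open>\<open>exists_prefix n P\<close> is the formula with \<open>n\<close> alternating number quantifiers, starting with an
  existential one, in front of \<open>P [a\<^sub>1, \<dots>, a\<^sub>n]\<close>.\<close>

fun exists_prefix :: "nat \<Rightarrow> (nat list \<Rightarrow> bool) \<Rightarrow> bool"
  and forall_prefix :: "nat \<Rightarrow> (nat list \<Rightarrow> bool) \<Rightarrow> bool" where
  "exists_prefix 0 P = P []"
| "exists_prefix (Suc n) P = (\<exists>a. forall_prefix n (\<lambda>as. P (a # as)))"
| "forall_prefix 0 P = P []"
| "forall_prefix (Suc n) P = (\<forall>a. exists_prefix n (\<lambda>as. P (a # as)))"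

definition lightface_Sigma :: "nat \<Rightarrow> (nat \<Rightarrow> bool) set set" where
  "lightface_Sigma n = {{x. exists_prefix n (R x)} | R. computable_rel n R}"

section \<open>Colorings as points of the Cantor space\<close>

text \<open>Computability of an enumeration refers to the lattice coordinates of the tiles.\<close>

definition computable_enumeration :: "real \<Rightarrow> real \<times> real \<Rightarrow> (nat \<Rightarrow> tile) \<Rightarrow> bool" where
  "computable_enumeration r p e \<longleftrightarrow> bij_betw e UNIV (hex_tiling r p) \<and>
     (\<exists>g. computable_fun g \<and>
          (\<forall>n. e n = hex_tile r p (map_prod int_decode int_decode (prod_decode (g n)))))"

definition coloring_of :: "(nat \<Rightarrow> tile) \<Rightarrow> (nat \<Rightarrow> bool) \<Rightarrow> tile \<Rightarrow> bool" where
  "coloring_of e y t = y (the_inv e t)"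

definition winning_set :: "tile set \<Rightarrow> (int \<Rightarrow> tile) \<Rightarrow> (nat \<Rightarrow> tile) \<Rightarrow> (nat \<Rightarrow> bool) set" where
  "winning_set T d e = {y. winning_for_black T d (coloring_of e y)}"

end

theory Submission
  imports Defs
begin

text \<open>Write membership in a \<open>\<Sigma>\<^sup>0\<^sub>4\<close> set as \<open>\<exists>k. \<forall>m. \<exists>i. \<forall>j. R k m i j\<close>. In lattice coordinates \<open>(t, b)\<close> the centre of
  a tile has horizontal position proportional to \<open>t\<close> and vertical position proportional to
  \<open>t + 2 * b\<close>. The black tiles form pairwise non-adjacent lanes, one for each \<open>K\<close>, lane \<open>K\<close> below lane
  \<open>K + 1\<close>. To the left every lane runs along a diagonal down to minus infinity, so that a coloring is
  winning iff some lane tends to plus infinity to the right. A lane moves up diagonally, except that it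
  returns to height \<open>2 * h\<close> at \<open>t = 2 * l\<close> for the dips \<open>(h, l)\<close>. Lane \<open>K\<close> has a dip \<open>(h, l)\<close> if for
  some \<open>K'\<close> between \<open>K\<close> and \<open>h\<close> and some \<open>c\<close> stage \<open>l\<close> is the first one at which each \<open>k \<le> K'\<close> is
  seen to have some \<open>m \<le> h\<close> for which no \<open>i \<le> c\<close> works. If some \<open>k \<le> K\<close> is a witness, only finitely
  many \<open>c\<close> can occur for each \<open>h\<close> and lane \<open>K\<close> tends to infinity; otherwise lane \<open>K\<close> has infinitely many
  dips at some height \<open>h\<close>. Letting \<open>K'\<close> vary makes the dips decrease with \<open>K\<close>, which keeps the lanes apart.

  The color of a tile is a bounded arithmetical formula in \<open>R\<close>. This gives continuity; for
  computability, such formulas are compiled to oracle Turing machines that call the machines for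
  \<open>R\<close> and for the enumeration as subroutines.\<close>

section \<open>Structured programs over head-relative tapes\<close>

text \<open>For a fixed lane, tending to infinity is a \<open>\<Pi>\<^sup>0\<^sub>3\<close>
  condition (for every height there is a column from which on the lane stays above it), and the
  choice of the lane supplies the leading existential quantifier. The obstacle is planarity: lanes
  cannot cross, so a lane cannot follow one \<open>k\<close> independently of the lanes around it.
  The statement "some \<open>k \<le> K\<close> is a witness" is monotone in \<open>K\<close>, holds
  for some \<open>K\<close> iff a witness exists, and allows higher lanes to dip less. A failing
  \<open>m\<close> refutes each bound \<open>c\<close> on \<open>i\<close> separately, at a finite
  stage; restarting the search for every \<open>c\<close> turns the failure of all \<open>i\<close>
  into infinitely many dips, whereas a working \<open>i\<close> ends the restarts at
  \<open>c = i\<close>. The bottom of a dip must depend on \<open>h\<close> but not on its stage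
  \<open>l\<close>, and the steepest descent is one row per column; this is why a dip starts at
  column \<open>h + l\<close> and ends at column \<open>2 * l\<close>. The indices at which
  \<open>R\<close> enters the color of a tile are bounded by its column, which gives continuity and
  computability at once.\<close>

type_synonym rel_tapes = "nat \<Rightarrow> int \<Rightarrow> nat"
type_synonym action = "head_move \<times> (nat \<Rightarrow> nat option \<times> head_move)"

text \<open>Programs act on tapes seen from the head, so a tape is known up to translation and cell \<open>0\<close> is
  the scanned one. A counter with value \<open>v\<close> is a tape whose only nonblank cell lies \<open>v\<close> cells to the left
  of the head.\<close>

definition rel_tape :: "int \<times> (int \<Rightarrow> nat) \<Rightarrow> int \<Rightarrow> nat" where
  "rel_tape t = (\<lambda>j. snd t (fst t + j))"

text \<open>Writing a symbol outside the alphabet has no effect. Instructions are arbitrary HOL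
  functions, and this makes every compiled program a valid machine without a side condition on
  them.\<close>

definition written :: "nat \<Rightarrow> nat option \<Rightarrow> nat \<Rightarrow> nat" where
  "written S a s = (case a of None \<Rightarrow> s | Some s' \<Rightarrow> if s' < S then s' else s)"

definition tape_act :: "nat \<Rightarrow> nat option \<times> head_move \<Rightarrow> (int \<Rightarrow> nat) \<Rightarrow> int \<Rightarrow> nat" where
  "tape_act S a w = (\<lambda>j. (w(0 := written S (fst a) (w 0))) (move_head (snd a) j))"

definition apply_act :: "nat \<Rightarrow> nat \<Rightarrow> action \<Rightarrow> int \<times> rel_tapes \<Rightarrow> int \<times> rel_tapes" where
  "apply_act n S a c =
     (move_head (fst a) (fst c), \<lambda>i. if i < n then tape_act S (snd a i) (snd c i) else snd c i)"

definition scanned :: "nat \<Rightarrow> rel_tapes \<Rightarrow> nat \<Rightarrow> nat" where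
  "scanned n T = (\<lambda>i. if i < n then T i 0 else 0)"

datatype prog =
    Act "bool option \<Rightarrow> (nat \<Rightarrow> nat) \<Rightarrow> action"
  | Seq prog prog
  | While "bool option \<Rightarrow> (nat \<Rightarrow> nat) \<Rightarrow> bool" prog

inductive exec :: "nat \<Rightarrow> nat \<Rightarrow> (nat \<Rightarrow> bool) \<Rightarrow> prog \<Rightarrow> int \<times> rel_tapes \<Rightarrow> int \<times> rel_tapes \<Rightarrow> bool"
  for n S x where
  exec_Act: "exec n S x (Act f) (h, T) (apply_act n S (f (oracle_cell x h) (scanned n T)) (h, T))"
| exec_Seq: "exec n S x p c c' \<Longrightarrow> exec n S x q c' c'' \<Longrightarrow> exec n S x (Seq p q) c c''"
| exec_While_False: "\<not> b (oracle_cell x h) (scanned n T) \<Longrightarrow> exec n S x (While b p) (h, T) (h, T)"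
| exec_While_True: "b (oracle_cell x h) (scanned n T) \<Longrightarrow> exec n S x p (h, T) c \<Longrightarrow>
    exec n S x (While b p) c c' \<Longrightarrow> exec n S x (While b p) (h, T) c'"

section \<open>Compilation of structured programs into code with relative jumps\<close>

definition idle :: action where
  "idle = (Stay, \<lambda>_. (None, Stay))"

text \<open>Each instruction yields a jump relative to its own address, so the code of a subprogram
  does not depend on where it is placed. A loop ends with a jump back to its test; a failing test
  jumps past that last instruction.\<close>

fun prog_code :: "prog \<Rightarrow> (bool option \<Rightarrow> (nat \<Rightarrow> nat) \<Rightarrow> int \<times> action) list" where
  "prog_code (Act f) = [\<lambda>b s. (1, f b s)]"
| "prog_code (Seq p q) = prog_code p @ prog_code q"
| "prog_code (While c p) =
     [\<lambda>b s. (if c b s then 1 else int (length (prog_code p)) + 2, idle)] @ prog_code p @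
     [\<lambda>b s. (- int (length (prog_code p)) - 1, idle)]"

text \<open>The address just behind the code is the only halting state. Clipping by
  \<open>nat\<close> and \<open>min\<close> keeps jumps inside the state set whatever an instruction
  says; the jumps of \<open>prog_code\<close> are not affected by it.\<close>

definition compiled :: "nat \<Rightarrow> nat \<Rightarrow> prog \<Rightarrow> otm" where
  "compiled n S p = \<lparr>num_states = Suc (length (prog_code p)), num_symbols = S, num_tapes = n,
     trans = \<lambda>q b as. if q < length (prog_code p) then
         (let (j, m, a) = (prog_code p ! q) b (\<lambda>i. if i < n then as ! i else 0)
          in Some (min (nat (int q + j)) (length (prog_code p)), m,
                   map (\<lambda>i. (written S (fst (a i)) (as ! i), snd (a i))) [0..<n]))
       else None\<rparr>"

lemma valid_compiled: "1 \<le> n \<Longrightarrow> 2 \<le> S \<Longrightarrow> valid_otm (compiled n S p)"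
  by (auto simp: valid_otm_def compiled_def Let_def written_def all_set_conv_all_nth
      split: if_splits prod.splits option.splits)

lemma apply_act_idle: "apply_act n S idle c = c"
  by (auto simp: apply_act_def idle_def tape_act_def written_def prod_eq_iff fun_eq_iff)

definition tapes_rel :: "nat \<Rightarrow> (int \<times> (int \<Rightarrow> nat)) list \<Rightarrow> rel_tapes \<Rightarrow> bool" where
  "tapes_rel n ws T \<longleftrightarrow> length ws = n \<and> (\<forall>i<n. T i = rel_tape (ws ! i))"

lemma rel_tape_step:
  "rel_tape (case t of (i, w) \<Rightarrow> (move_head m i, w(i := a))) =
     (\<lambda>j. ((rel_tape t)(0 := a)) (move_head m j))"
  by (cases m; cases t) (auto simp: rel_tape_def fun_eq_iff algebra_simps)

lemma compiled_step:
  assumes T: "tapes_rel n ws T" and q: "q < length (prog_code p)"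
    and code: "(prog_code p ! q) (oracle_cell x h) (scanned n T) = (j, a)"
    and j: "0 \<le> int q + j" "int q + j \<le> int (length (prog_code p))"
    and app: "apply_act n S a (h, T) = (h', T')"
  obtains ws' where "otm_step (compiled n S p) x (q, h, ws) = Some (nat (int q + j), h', ws')"
    "tapes_rel n ws' T'"
proof -
  let ?as = "map (\<lambda>(i, w). w i) ws"
  have len: "length ws = n" using T by (simp add: tapes_rel_def)
  have as: "?as ! i = T i 0" if "i < n" for i
    using T that by (auto simp: tapes_rel_def rel_tape_def split: prod.splits)
  have sc: "(\<lambda>i. if i < n then ?as ! i else 0) = scanned n T"
    using as by (auto simp: scanned_def fun_eq_iff)
  define acts where "acts = map (\<lambda>i. (written S (fst (snd a i)) (?as ! i), snd (snd a i))) [0..<n]"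
  define ws' where "ws' = map2 (\<lambda>(a, m') (i, w). (move_head m' i, w(i := a))) acts ws"
  have "otm_step (compiled n S p) x (q, h, ws) = Some (nat (int q + j), h', ws')"
    using q code j app unfolding otm_step.simps compiled_def otm.simps sc
    by (cases a) (auto simp: ws'_def acts_def apply_act_def min_def)
  moreover have "tapes_rel n ws' T'"
    unfolding tapes_rel_def
  proof (intro conjI allI impI)
    show "length ws' = n" by (simp add: ws'_def acts_def len)
    fix i assume i: "i < n"
    have "ws' ! i = (case ws ! i of (k, w) \<Rightarrow>
        (move_head (snd (snd a i)) k, w(k := written S (fst (snd a i)) (T i 0))))"
      using i len by (simp add: ws'_def acts_def as[OF i, symmetric] split: prod.splits)
    then have "rel_tape (ws' ! i) = tape_act S (snd a i) (T i)"
      using T i by (simp add: rel_tape_step tape_act_def tapes_rel_def)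
    then show "T' i = rel_tape (ws' ! i)" using app i by (auto simp: apply_act_def)
  qed
  ultimately show ?thesis using that by blast
qed

text \<open>The surrounding code \<open>pre\<close> and \<open>post\<close> is arbitrary because the
  induction meets loop bodies and second halves of sequences at shifted addresses.\<close>

lemma exec_compiled:
  assumes "exec n S x p0 c c'" "prog_code p = pre @ prog_code p0 @ post" "tapes_rel n ws (snd c)"
  shows "\<exists>ws'. (\<lambda>c c'. otm_step (compiled n S p) x c = Some c')\<^sup>*\<^sup>*
      (length pre, fst c, ws) (length pre + length (prog_code p0), fst c', ws') \<and>
      tapes_rel n ws' (snd c')"
  using assms
proof (induction arbitrary: pre post ws rule: exec.induct)
  case (exec_Act f h T)
  obtain h' T' where app: "apply_act n S (f (oracle_cell x h) (scanned n T)) (h, T) = (h', T')"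
    by (cases "apply_act n S (f (oracle_cell x h) (scanned n T)) (h, T)")
  have "tapes_rel n ws T" using exec_Act by simp
  from compiled_step[OF this _ _ _ _ app, of "length pre" p x 1]
  obtain ws' where "otm_step (compiled n S p) x (length pre, h, ws) =
      Some (nat (int (length pre) + 1), h', ws')" "tapes_rel n ws' T'"
    using exec_Act by (auto simp: nth_append)
  then show ?case using app by (intro exI[of _ ws']) (auto simp: nat_add_distrib)
next
  case (exec_Seq p1 c c' q c'')
  from exec_Seq.IH(1)[of pre "prog_code q @ post" ws] exec_Seq.prems
  obtain ws1 where 1: "(\<lambda>c c'. otm_step (compiled n S p) x c = Some c')\<^sup>*\<^sup>*
      (length pre, fst c, ws) (length pre + length (prog_code p1), fst c', ws1)"
      "tapes_rel n ws1 (snd c')" by auto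
  from exec_Seq.IH(2)[of "pre @ prog_code p1" post ws1] exec_Seq.prems 1(2)
  obtain ws2 where "(\<lambda>c c'. otm_step (compiled n S p) x c = Some c')\<^sup>*\<^sup>*
      (length pre + length (prog_code p1), fst c', ws1)
      (length pre + length (prog_code p1) + length (prog_code q), fst c'', ws2)"
      "tapes_rel n ws2 (snd c'')" by auto
  with 1(1) show ?case by (intro exI[of _ ws2]) (auto simp: add.assoc)
next
  case (exec_While_False b h T p1)
  from exec_While_False have T: "tapes_rel n ws T" by simp
  from compiled_step[OF T, of "length pre" p x h "int (length (prog_code p1)) + 2" idle S h T]
  obtain ws' where "otm_step (compiled n S p) x (length pre, h, ws) =
      Some (nat (int (length pre) + (int (length (prog_code p1)) + 2)), h, ws')" "tapes_rel n ws' T"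
    using exec_While_False by (auto simp: nth_append apply_act_idle)
  then show ?case
    by (intro exI[of _ ws']) (auto simp: nat_add_distrib intro!: r_into_rtranclp)
next
  case (exec_While_True b h T p1 c c')
  let ?R = "\<lambda>c c'. otm_step (compiled n S p) x c = Some c'"
  from exec_While_True have T: "tapes_rel n ws T" by simp
  from compiled_step[OF T, of "length pre" p x h 1 idle S h T]
  obtain ws1 where 1: "?R (length pre, h, ws) (nat (int (length pre) + 1), h, ws1)" "tapes_rel n ws1 T"
    using exec_While_True by (auto simp: nth_append apply_act_idle)
  from exec_While_True.IH(1)[of "pre @ [\<lambda>b' s. (if b b' s then 1 else int (length (prog_code p1)) + 2, idle)]"
    "[\<lambda>b s. (- int (length (prog_code p1)) - 1, idle)] @ post" ws1] 1(2) exec_While_True.prems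
  obtain ws2 where 2: "?R\<^sup>*\<^sup>* (Suc (length pre), h, ws1)
     (Suc (length pre + length (prog_code p1)), fst c, ws2)" "tapes_rel n ws2 (snd c)"
    by auto
  from compiled_step[OF 2(2), of "Suc (length pre + length (prog_code p1))" p x "fst c"
      "- int (length (prog_code p1)) - 1" idle S "fst c" "snd c"]
  obtain ws3 where 3: "?R (Suc (length pre + length (prog_code p1)), fst c, ws2) (length pre, fst c, ws3)"
     "tapes_rel n ws3 (snd c)"
    using exec_While_True.prems by (auto simp: nth_append apply_act_idle)
  from exec_While_True.IH(2)[OF exec_While_True.prems(1) 3(2)]
  obtain ws4 where 4: "?R\<^sup>*\<^sup>* (length pre, fst c, ws3)
     (length pre + length (prog_code (While b p1)), fst c', ws4)" "tapes_rel n ws4 (snd c')" by auto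
  have "?R\<^sup>*\<^sup>* (length pre, h, ws) (Suc (length pre), h, ws1)"
    using 1(1) by (auto simp: nat_add_distrib)
  also note 2(1)
  also have "?R\<^sup>*\<^sup>* (Suc (length pre + length (prog_code p1)), fst c, ws2) (length pre, fst c, ws3)"
    using 3(1) by auto
  also note 4(1)
  finally show ?case using 4(2) by auto
qed

lemma compiled_yields:
  assumes ex: "exec n S x p (0, T) (h', T')" and n: "1 \<le> n"
    and T0: "T 0 = input_tape as" and T: "\<And>i. 0 < i \<Longrightarrow> i < n \<Longrightarrow> T i = (\<lambda>_. 0)"
  shows "otm_yields (compiled n S p) x as (card {j. T' 0 j = 1})"
proof -
  let ?ws = "(0, input_tape as) # replicate (n - 1) (0, \<lambda>_. 0)"
  have "tapes_rel n ?ws T"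
    using n T0 T by (auto simp: tapes_rel_def rel_tape_def nth_Cons' fun_eq_iff)
  with exec_compiled[OF ex, of p "[]" "[]" ?ws]
  obtain ws' where r: "(\<lambda>c c'. otm_step (compiled n S p) x c = Some c')\<^sup>*\<^sup>*
      (0, 0, ?ws) (length (prog_code p), h', ws')" and T': "tapes_rel n ws' T'" by auto
  \<comment> \<open>The relative tape is a translate of the absolute one, which preserves the number
    of strokes.\<close>
  have "{j. T' 0 j = 1} = (\<lambda>i. i - fst (hd ws')) ` {i. snd (hd ws') i = 1}"
    using T' n by (cases ws') (auto simp: tapes_rel_def rel_tape_def image_iff intro!: exI[of _ "_ + _"])
  then have "card {j. T' 0 j = 1} = card {i. snd (hd ws') i = 1}"
    by (simp add: card_image inj_on_def)
  then show ?thesis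
    unfolding otm_yields_def using r
    by (intro exI[of _ "(length (prog_code p), h', ws')"])
       (auto simp: otm_init_def compiled_def)
qed

section \<open>Calling an oracle Turing machine as a subroutine\<close>

text \<open>Incrementing and decrementing are head moves without any writing, and the value is zero
  iff the scanned symbol is \<open>2\<close>.\<close>

definition counter :: "nat \<Rightarrow> int \<Rightarrow> nat" where
  "counter v = (\<lambda>j. if j = - int v then 2 else 0)"

definition blank :: "int \<Rightarrow> nat" where
  "blank = (\<lambda>_. 0)"

text \<open>The head stands on the free cell left of the list, so a push writes there and moves
  left.\<close>

definition pushed :: "nat list \<Rightarrow> int \<Rightarrow> nat" where
  "pushed L = (\<lambda>j. if 1 \<le> j \<and> nat (j - 1) < length L then L ! nat (j - 1) else 0)"

definition swept :: "(int \<Rightarrow> nat) \<Rightarrow> int \<Rightarrow> nat" where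
  "swept w = (\<lambda>j. if j = 1 then 0 else w (j - 1))"

definition tape_within :: "int \<Rightarrow> int \<Rightarrow> (int \<Rightarrow> nat) \<Rightarrow> bool" where
  "tape_within a b w \<longleftrightarrow> (\<forall>j. w j \<noteq> 0 \<longrightarrow> a \<le> j \<and> j \<le> b)"

section \<open>Effect of single actions on counters and tapes\<close>

lemma exec_ActI:
  "apply_act n S (f (oracle_cell x h) (scanned n T)) (h, T) = c \<Longrightarrow> exec n S x (Act f) (h, T) c"
  using exec_Act by metis

lemma apply_act_eqI:
  assumes "h' = move_head (fst a) h" "\<And>i. i < n \<Longrightarrow> tape_act S (snd a i) (T i) = T' i"
    "\<And>i. \<not> i < n \<Longrightarrow> T i = T' i"
  shows "apply_act n S a (h, T) = (h', T')"
  using assms by (auto simp: apply_act_def)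

lemma counter_0_eq: "counter v 0 = (if v = 0 then 2 else 0)"
  by (simp add: counter_def)

lemma tape_act_keep: "tape_act S (None, Stay) w = w"
  by (simp add: tape_act_def written_def fun_eq_iff)

lemma tape_act_right: "tape_act S (None, Move_Right) w = (\<lambda>j. w (j + 1))"
  by (simp add: tape_act_def written_def fun_eq_iff)

lemma tape_act_counter_inc: "tape_act S (None, Move_Right) (counter v) = counter (Suc v)"
  by (auto simp: tape_act_def written_def counter_def fun_eq_iff)

lemma tape_act_counter_dec: "tape_act S (None, Move_Left) (counter (Suc v)) = counter v"
  by (auto simp: tape_act_def written_def counter_def fun_eq_iff)

lemma tape_act_push: "a < S \<Longrightarrow> tape_act S (Some a, Move_Left) (pushed L) = pushed (a # L)"
  by (auto simp: tape_act_def written_def pushed_def fun_eq_iff nth_Cons' nat_diff_distrib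
      intro!: arg_cong[where f="(!) L"])

lemma tape_act_sweep: "0 < S \<Longrightarrow> tape_act S (Some 0, Move_Left) w = swept w"
  by (auto simp: tape_act_def written_def swept_def fun_eq_iff)

lemma tape_act_sing: "a < S \<Longrightarrow> tape_act S (Some a, Stay) (blank(0 := q)) = blank(0 := a)"
  by (auto simp: tape_act_def written_def blank_def fun_eq_iff)

lemma pushed_Nil: "pushed [] = blank"
  by (auto simp: pushed_def blank_def)

lemma tape_within_act:
  "tape_within (- int B) (int B) w \<Longrightarrow> tape_within (- int (Suc B)) (int (Suc B)) (tape_act S a w)"
proof -
  assume a: "tape_within (- int B) (int B) w"
  show ?thesis
    unfolding tape_within_def
  proof (intro allI impI)
    fix j assume j: "tape_act S a w j \<noteq> 0"
    show "- int (Suc B) \<le> j \<and> j \<le> int (Suc B)"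
    proof (cases "move_head (snd a) j = 0")
      case True then show ?thesis by (cases "snd a") auto
    next
      case False
      then have "w (move_head (snd a) j) \<noteq> 0" using j by (simp add: tape_act_def)
      then have "- int B \<le> move_head (snd a) j \<and> move_head (snd a) j \<le> int B"
        using a by (auto simp: tape_within_def)
      then show ?thesis by (cases "snd a") auto
    qed
  qed
qed

lemma tape_within_finite: "tape_within a b w \<Longrightarrow> finite {j. w j = Suc 0}"
  by (rule finite_subset[of _ "{a..b}"]) (auto simp: tape_within_def)

text \<open>A register incremented for each stroke that gets erased keeps the sum of its value and
  the number of remaining strokes constant; this is how the output of a call is counted.\<close>

lemma card_swept:
  assumes "tape_within a b w"
  shows "card {j. swept w j = 1} + of_bool (w 0 = 1) = card {j. w j = 1}"
proof -
  have e: "{j. swept w j = 1} = (\<lambda>j. j + 1) ` ({j. w j = 1} - {0})"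
  proof (intro set_eqI iffI)
    fix j assume "j \<in> {j. swept w j = 1}"
    then have "j = (j - 1) + 1" "j - 1 \<in> {j. w j = 1} - {0}" by (auto simp: swept_def split: if_splits)
    then show "j \<in> (\<lambda>j. j + 1) ` ({j. w j = 1} - {0})" by blast
  qed (auto simp: swept_def)
  have "card {j. swept w j = 1} = card ({j. w j = 1} - {0})"
    unfolding e by (rule card_image) (simp add: inj_on_def)
  moreover have "0 < card {j. w j = 1}" if "w 0 = 1"
    using tape_within_finite[OF assms] that by (auto simp: card_gt_0_iff)
  ultimately show ?thesis using tape_within_finite[OF assms]
    by (cases "w 0 = 1") (auto simp: card_Diff_singleton)
qed

lemma tape_within_swept: "tape_within a 0 w \<Longrightarrow> tape_within (a + 1) 0 (swept w)"
  unfolding tape_within_def swept_def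
proof (intro allI impI)
  fix j assume w: "\<forall>j. w j \<noteq> 0 \<longrightarrow> a \<le> j \<and> j \<le> 0" and "(if j = 1 then 0 else w (j - 1)) \<noteq> 0"
  then have "j \<noteq> 1" "w (j - 1) \<noteq> 0" by (auto split: if_splits)
  with w have "a \<le> j - 1 \<and> j - 1 \<le> 0" by blast
  with \<open>j \<noteq> 1\<close> show "a + 1 \<le> j \<and> j \<le> 0" by auto
qed

text \<open>A call writes the arguments from right to left onto the first work tape of the simulated machine,
  so that the head ends at their start. Tapes \<open>1\<close> and \<open>2\<close> count the actions since the beginning of
  the call; they bound the distance of the nonblank cells from the heads, which allows to erase the
  work tapes afterwards while counting the strokes of the output. Tape \<open>u\<close> holds the state \<open>q\<close> of the simulated machine and the
  tapes \<open>u + 1, \<dots>, u + k\<close> its work tapes; all other tapes are those of \<open>U\<close>.\<close>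

definition block :: "nat \<Rightarrow> nat \<Rightarrow> nat \<Rightarrow> nat \<Rightarrow> nat \<Rightarrow> rel_tapes \<Rightarrow> rel_tapes \<Rightarrow> rel_tapes" where
  "block u k B C q V U = (\<lambda>i. if i = 1 then counter B else if i = 2 then counter C
     else if i = u then blank(0 := q) else if u < i \<and> i \<le> u + k then V (i - Suc u) else U i)"

definition push_act :: "nat \<Rightarrow> nat \<Rightarrow> nat option \<Rightarrow> action" where
  "push_act u a r = (Stay, \<lambda>i. if i = 1 \<or> i = 2 then (None, Move_Right)
     else if i = Suc u then (Some a, Move_Left)
     else if r = Some i then (None, Move_Left) else (None, Stay))"

definition write_arg :: "nat \<Rightarrow> nat \<Rightarrow> prog" where
  "write_arg u r = Seq (Act (\<lambda>b s. push_act u 0 None)) (Seq (Act (\<lambda>b s. push_act u 1 None))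
     (While (\<lambda>b s. s r \<noteq> 2) (Act (\<lambda>b s. push_act u 1 (Some r)))))"

fun write_args :: "nat \<Rightarrow> nat \<Rightarrow> nat \<Rightarrow> prog" where
  "write_args u r 0 = Act (\<lambda>b s. idle)"
| "write_args u r (Suc m) = Seq (write_arg u (r + m)) (write_args u r m)"

text \<open>The map \<open>\<phi>\<close> presents another oracle to the simulated machine:
  \<open>id\<close> passes the oracle on, and \<open>map_option (\<lambda>_. False)\<close> turns it
  into the constantly false one while keeping the blanks on the negative cells.\<close>

definition sim_trans ::
    "otm \<Rightarrow> nat \<Rightarrow> (bool option \<Rightarrow> bool option) \<Rightarrow> bool option \<Rightarrow> (nat \<Rightarrow> nat) \<Rightarrow>
      (nat \<times> head_move \<times> (nat \<times> head_move) list) option" where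
  "sim_trans M u \<phi> b s = trans M (s u) (\<phi> b) (map (\<lambda>i. s (Suc u + i)) [0..<num_tapes M])"

definition sim_act ::
    "otm \<Rightarrow> nat \<Rightarrow> (bool option \<Rightarrow> bool option) \<Rightarrow> bool option \<Rightarrow> (nat \<Rightarrow> nat) \<Rightarrow> action" where
  "sim_act M u \<phi> b s = (case sim_trans M u \<phi> b s of
     None \<Rightarrow> idle
   | Some (q, m, acts) \<Rightarrow> (m, \<lambda>i. if i = 1 \<or> i = 2 then (None, Move_Right)
       else if i = u then (Some q, Stay)
       else if u < i \<and> i \<le> u + num_tapes M
         then (Some (fst (acts ! (i - Suc u))), snd (acts ! (i - Suc u)))
       else (None, Stay)))"

definition start_act :: "nat \<Rightarrow> action" where
  "start_act u = (Stay, \<lambda>i. if i = 1 \<or> i = 2 \<or> i = Suc u then (None, Move_Right) else (None, Stay))"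

definition run_sim :: "otm \<Rightarrow> nat \<Rightarrow> (bool option \<Rightarrow> bool option) \<Rightarrow> prog" where
  "run_sim M u \<phi> = While (\<lambda>b s. sim_trans M u \<phi> b s \<noteq> None) (Act (sim_act M u \<phi>))"

definition sweep_act :: "nat \<Rightarrow> nat \<Rightarrow> nat \<Rightarrow> nat option \<Rightarrow> (nat \<Rightarrow> nat) \<Rightarrow> action" where
  "sweep_act u k r c s = (Stay, \<lambda>i. if c = Some i then (None, Move_Left)
     else if u < i \<and> i \<le> u + k then (Some 0, Move_Left)
     else if i = r \<and> s (Suc u) = 1 then (None, Move_Right) else (None, Stay))"

definition right_act :: "nat \<Rightarrow> nat \<Rightarrow> action" where
  "right_act u k = (Stay, \<lambda>i. if i = 1 then (None, Move_Left)
     else if u < i \<and> i \<le> u + k then (None, Move_Right) else (None, Stay))"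

text \<open>The oracle tape cannot be marked, but its negative cells are recognizable as blanks, and
  the border between them and the oracle leads the head back to cell \<open>0\<close> from any
  position.\<close>

definition reset_oracle :: prog where
  "reset_oracle = Seq (While (\<lambda>b s. b = None) (Act (\<lambda>b s. (Move_Right, \<lambda>_. (None, Stay)))))
     (Seq (While (\<lambda>b s. b \<noteq> None) (Act (\<lambda>b s. (Move_Left, \<lambda>_. (None, Stay)))))
       (Act (\<lambda>b s. (Move_Right, \<lambda>_. (None, Stay)))))"

text \<open>In a call the heads have just been moved right by the common value \<open>B\<close> of
  the two counters, so the nonblank cells lie between \<open>- 2 * B\<close> and \<open>0\<close>:
  hence two sweeps per unit of tape \<open>2\<close>. The remaining cell \<open>0\<close> is left to
  the extra sweep in \<open>call_prog\<close>. There are two counters because moving right uses up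
  tape \<open>1\<close>.\<close>

definition sweep_prog :: "nat \<Rightarrow> nat \<Rightarrow> nat \<Rightarrow> prog" where
  "sweep_prog u k r = While (\<lambda>b s. s 2 \<noteq> 2)
     (Seq (Act (\<lambda>b s. sweep_act u k r (Some 2) s)) (Act (\<lambda>b s. sweep_act u k r None s)))"

definition right_prog :: "nat \<Rightarrow> nat \<Rightarrow> prog" where
  "right_prog u k = While (\<lambda>b s. s 1 \<noteq> 2) (Act (\<lambda>b s. right_act u k))"

definition call_prog :: "otm \<Rightarrow> nat \<Rightarrow> (bool option \<Rightarrow> bool option) \<Rightarrow> nat \<Rightarrow> nat \<Rightarrow> prog" where
  "call_prog M u \<phi> r m =
     Seq (write_args u r m) (Seq (Act (\<lambda>b s. start_act u)) (Seq (run_sim M u \<phi>)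
     (Seq (Act (\<lambda>b s. (Stay, \<lambda>i. if i = u then (Some 0, Stay) else (None, Stay))))
     (Seq (right_prog u (num_tapes M))
     (Seq (sweep_prog u (num_tapes M) r)
     (Seq (Act (\<lambda>b s. sweep_act u (num_tapes M) r None s)) reset_oracle))))))"

lemma exec_reset_oracle: "exec n S x reset_oracle (h, T) (0, T)"
proof -
  have stay: "apply_act n S (m, \<lambda>_. (None, Stay)) (h, T) = (move_head m h, T)" for m h
    by (auto simp: apply_act_def tape_act_keep fun_eq_iff)
  have 1: "exec n S x (While (\<lambda>b s. b = None) (Act (\<lambda>b s. (Move_Right, \<lambda>_. (None, Stay)))))
     (h, T) (max 0 h, T)" for h
  proof (induction "nat (- h)" arbitrary: h)
    case 0
    then show ?case by (auto intro!: exec_While_False simp: oracle_cell_def max_def)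
  next
    case (Suc v)
    from Suc(2) have "v = nat (- (h + 1))" "max 0 (h + 1) = max 0 h" "h < 0" by auto
    with Suc(1)[of "h + 1"] show ?case
      by - (rule exec_While_True[where c="(h + 1, T)"],
        auto simp: stay oracle_cell_def intro!: exec_ActI)
  qed
  have 2: "exec n S x (While (\<lambda>b s. b \<noteq> None) (Act (\<lambda>b s. (Move_Left, \<lambda>_. (None, Stay)))))
     (h, T) (-1, T)" if "-1 \<le> h" for h
    using that
  proof (induction "nat (h + 1)" arbitrary: h)
    case 0
    then have "h = -1" by simp
    then show ?case by (auto intro!: exec_While_False simp: oracle_cell_def)
  next
    case (Suc v)
    then show ?case using Suc(1)[of "h - 1"]
      by - (rule exec_While_True[where c="(h - 1, T)"],
        auto simp: stay oracle_cell_def intro!: exec_ActI split: if_splits)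
  qed
  show ?thesis unfolding reset_oracle_def
    by (rule exec_Seq[OF 1 exec_Seq[OF 2]]) (auto intro!: exec_ActI simp: stay)
qed

section \<open>Loading the arguments of a call and erasing its work tapes\<close>

locale sim_block =
  fixes n S u k :: nat
  assumes S: "3 \<le> S" and u: "2 < u" and k: "0 < k" "u + k < n"
begin

lemma apply_push:
  assumes a: "a < S"
  shows "apply_act n S (push_act u a None) (h, block u k B C q ((\<lambda>_. blank)(0 := pushed L)) U) =
    (h, block u k (Suc B) (Suc C) q ((\<lambda>_. blank)(0 := pushed (a # L))) U)"
  using S u k a
  by (intro apply_act_eqI)
     (auto simp: block_def push_act_def tape_act_counter_inc tape_act_push tape_act_keep)

lemma apply_push_dec:
  assumes a: "a < S" and r: "u + k < r" "r < n" and U: "U r = counter (Suc v)"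
  shows "apply_act n S (push_act u a (Some r)) (h, block u k B C q ((\<lambda>_. blank)(0 := pushed L)) U) =
    (h, block u k (Suc B) (Suc C) q ((\<lambda>_. blank)(0 := pushed (a # L))) (U(r := counter v)))"
  using S u k a r U
  by (intro apply_act_eqI)
     (auto simp: block_def push_act_def tape_act_counter_inc tape_act_push tape_act_keep
      tape_act_counter_dec)

lemma exec_write_arg:
  assumes r: "u + k < r" "r < n" and U: "U r = counter v"
  shows "exec n S x (write_arg u r) (h, block u k B B q ((\<lambda>_. blank)(0 := pushed L)) U)
    (h, block u k (B + v + 2) (B + v + 2) q
      ((\<lambda>_. blank)(0 := pushed (replicate (Suc v) 1 @ [0] @ L))) (U(r := counter 0)))"
proof -
  let ?V = "\<lambda>L. ((\<lambda>_. blank)(0 := pushed L))"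
  have loop: "exec n S x (While (\<lambda>b s. s r \<noteq> 2) (Act (\<lambda>b s. push_act u 1 (Some r))))
     (h, block u k B B q (?V L) U)
     (h, block u k (B + v) (B + v) q (?V (replicate v 1 @ L)) (U(r := counter 0)))"
    if "U r = counter v" for B L U v
    using that
  proof (induction v arbitrary: B L U)
    case 0
    then have "U(r := counter 0) = U" by auto
    with 0 show ?case using r u k
      by (auto intro!: exec_While_False simp: scanned_def block_def counter_0_eq)
  next
    case (Suc v)
    show ?case
    proof (rule exec_While_True)
      show "scanned n (block u k B B q (?V L) U) r \<noteq> 2"
        using Suc.prems r u k by (simp add: scanned_def block_def counter_0_eq)
      show "exec n S x (Act (\<lambda>b s. push_act u 1 (Some r))) (h, block u k B B q (?V L) U)
         (h, block u k (Suc B) (Suc B) q (?V (1 # L)) (U(r := counter v)))"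
        using S by (intro exec_ActI apply_push_dec r Suc.prems) simp
      show "exec n S x (While (\<lambda>b s. s r \<noteq> 2) (Act (\<lambda>b s. push_act u 1 (Some r))))
         (h, block u k (Suc B) (Suc B) q (?V (1 # L)) (U(r := counter v)))
         (h, block u k (B + Suc v) (B + Suc v) q (?V (replicate (Suc v) 1 @ L)) (U(r := counter 0)))"
        using Suc.IH[of "U(r := counter v)" "Suc B" "1 # L"] unfolding fun_upd_upd
        by (simp only: replicate_app_Cons_same fun_upd_same replicate_Suc append_Cons add_Suc add_Suc_right
            simp_thms)
    qed
  qed
  have eq1: "replicate v 1 @ 1 # 0 # L = replicate (Suc v) 1 @ [0] @ L" for v and L :: "nat list"
    by (induction v) auto
  have eq2: "Suc (Suc B) + v = B + v + 2" by simp
  show ?thesis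
    unfolding write_arg_def
    apply (rule exec_Seq[where c'="(h, block u k (Suc B) (Suc B) q (?V (0 # L)) U)"])
     apply (rule exec_ActI, rule apply_push)
    using S apply simp
    apply (rule exec_Seq[where c'="(h, block u k (Suc (Suc B)) (Suc (Suc B)) q (?V (1 # 0 # L)) U)"])
     apply (rule exec_ActI, rule apply_push)
    using S apply simp
    using loop[of U v "Suc (Suc B)" "1 # 0 # L", OF U]
    unfolding eq1 eq2 .
qed

definition encoded :: "nat list \<Rightarrow> nat list" where
  "encoded as = concat (map (\<lambda>a. replicate (a + 1) 1 @ [0]) as)"

text \<open>Reverse induction, since the last argument is pushed first and the others end up in
  front of it.\<close>

lemma exec_write_args:
  assumes "u + k < r" "r + length as \<le> n" "\<And>i. i < length as \<Longrightarrow> U (r + i) = counter (as ! i)"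
  shows "exec n S x (write_args u r (length as)) (h, block u k B B q ((\<lambda>_. blank)(0 := pushed L)) U)
    (h, block u k (B + length (encoded as)) (B + length (encoded as)) q
      ((\<lambda>_. blank)(0 := pushed (encoded as @ L)))
      (\<lambda>i. if r \<le> i \<and> i < r + length as then counter 0 else U i))"
  using assms
proof (induction as arbitrary: B L U rule: rev_induct)
  case Nil
  have "(\<lambda>i. if r \<le> i \<and> i < r then counter 0 else U i) = U" by (simp add: fun_eq_iff)
  then show ?case by (auto intro!: exec_ActI simp: apply_act_idle encoded_def)
next
  case (snoc a as)
  let ?U = "U(r + length as := counter 0)"
  have "exec n S x (write_arg u (r + length as)) (h, block u k B B q ((\<lambda>_. blank)(0 := pushed L)) U)
    (h, block u k (B + a + 2) (B + a + 2) q
      ((\<lambda>_. blank)(0 := pushed (replicate (Suc a) 1 @ [0] @ L))) ?U)"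
    using snoc.prems(3)[of "length as"] snoc.prems(1,2) by (intro exec_write_arg) auto
  moreover have "exec n S x (write_args u r (length as))
    (h, block u k (B + a + 2) (B + a + 2) q
      ((\<lambda>_. blank)(0 := pushed (replicate (Suc a) 1 @ [0] @ L))) ?U)
    (h, block u k (B + a + 2 + length (encoded as)) (B + a + 2 + length (encoded as)) q
      ((\<lambda>_. blank)(0 := pushed (encoded as @ replicate (Suc a) 1 @ [0] @ L)))
      (\<lambda>i. if r \<le> i \<and> i < r + length as then counter 0 else ?U i))"
  proof (rule snoc.IH)
    fix i assume "i < length as"
    then show "?U (r + i) = counter (as ! i)" using snoc.prems(3)[of i] by (simp add: nth_append)
  qed (use snoc.prems(1,2) in auto)
  ultimately have "exec n S x (write_args u r (length (as @ [a])))
    (h, block u k B B q ((\<lambda>_. blank)(0 := pushed L)) U)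
    (h, block u k (B + a + 2 + length (encoded as)) (B + a + 2 + length (encoded as)) q
      ((\<lambda>_. blank)(0 := pushed (encoded as @ replicate (Suc a) 1 @ [0] @ L)))
      (\<lambda>i. if r \<le> i \<and> i < r + length as then counter 0 else ?U i))"
    unfolding length_append_singleton write_args.simps by (rule exec_Seq)
  moreover have "(\<lambda>i. if r \<le> i \<and> i < r + length as then counter 0 else ?U i) =
     (\<lambda>i. if r \<le> i \<and> i < r + length (as @ [a]) then counter 0 else U i)"
    by (auto simp: fun_eq_iff)
  moreover have "encoded as @ replicate (Suc a) 1 @ [0] @ L = encoded (as @ [a]) @ L"
    "B + a + 2 + length (encoded as) = B + length (encoded (as @ [a]))"
    by (simp_all add: encoded_def)
  ultimately show ?case by (simp only:)
qed

lemma apply_start: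
  "apply_act n S (start_act u) (h, block u k B B q ((\<lambda>_. blank)(0 := pushed (encoded as))) U) =
    (h, block u k (Suc B) (Suc B) q ((\<lambda>_. blank)(0 := input_tape as)) U)"
proof -
  have "(\<lambda>j. pushed (encoded as) (j + 1)) = input_tape as"
    by (auto simp: pushed_def input_tape_def encoded_def Let_def fun_eq_iff)
  then show ?thesis using S u k
    by (intro apply_act_eqI)
       (auto simp: block_def start_act_def tape_act_counter_inc tape_act_right[of _ "pushed _"] tape_act_keep
        tape_act_right[of _ blank] blank_def)
qed

lemma exec_right:
  "exec n S x (right_prog u k) (h, block u k B C q V U)
    (h, block u k 0 C q (\<lambda>i j. V i (j + int B)) U)"
  unfolding right_prog_def
proof (induction B arbitrary: V)
  case 0
  show ?case using u k by (auto intro!: exec_While_False simp: scanned_def block_def counter_0_eq)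
next
  case (Suc B)
  show ?case
  proof (rule exec_While_True)
    show "scanned n (block u k (Suc B) C q V U) 1 \<noteq> 2"
      using u k by (simp add: scanned_def block_def counter_0_eq)
    show "exec n S x (Act (\<lambda>b s. right_act u k)) (h, block u k (Suc B) C q V U)
        (h, block u k B C q (\<lambda>i j. V i (j + 1)) U)"
      using u k
      by (intro exec_ActI apply_act_eqI) (auto simp: block_def right_act_def tape_act_counter_dec
          tape_act_keep tape_act_right[of _ "V _"])
    show "exec n S x (While (\<lambda>b s. s 1 \<noteq> 2) (Act (\<lambda>b s. right_act u k)))
        (h, block u k B C q (\<lambda>i j. V i (j + 1)) U)
        (h, block u k 0 C q (\<lambda>i j. V i (j + int (Suc B))) U)"
      using Suc.IH[of "\<lambda>i j. V i (j + 1)"] by (simp add: algebra_simps)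
  qed
qed

lemma exec_sweep:
  assumes r: "u + k < r" "r < n" and U: "U r = counter v"
  shows "exec n S x (Act (\<lambda>b s. sweep_act u k r None s)) (h, block u k B C q V U)
    (h, block u k B C q (\<lambda>i. swept (V i)) (U(r := counter (v + of_bool (V 0 0 = 1)))))"
  using S u k r U
  by (intro exec_ActI apply_act_eqI) (auto simp: block_def sweep_act_def scanned_def tape_act_counter_inc
      tape_act_keep tape_act_sweep)

lemma exec_sweep_dec:
  assumes r: "u + k < r" "r < n" and U: "U r = counter v"
  shows "exec n S x (Act (\<lambda>b s. sweep_act u k r (Some 2) s)) (h, block u k B (Suc C) q V U)
    (h, block u k B C q (\<lambda>i. swept (V i)) (U(r := counter (v + of_bool (V 0 0 = 1)))))"
  using S u k r U
  by (intro exec_ActI apply_act_eqI) (auto simp: block_def sweep_act_def scanned_def tape_act_counter_inc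
      tape_act_counter_dec tape_act_keep tape_act_sweep)

text \<open>Two invariants replace a description of the tapes: the distance bound shrinks by two per
  round, and the register plus the number of remaining strokes stays constant.\<close>

lemma exec_sweep_prog:
  assumes r: "u + k < r" "r < n" and U: "U r = counter v"
    and V: "\<And>i. i < k \<Longrightarrow> tape_within (- int (2 * C)) 0 (V i)"
  shows "\<exists>V' v'. exec n S x (sweep_prog u k r) (h, block u k B C q V U)
     (h, block u k B 0 q V' (U(r := counter v'))) \<and>
     (\<forall>i<k. tape_within 0 0 (V' i)) \<and> v' + card {j. V' 0 j = 1} = v + card {j. V 0 j = 1}"
  using U V unfolding sweep_prog_def
proof (induction C arbitrary: V U v)
  case 0
  then have "U(r := counter v) = U" by auto
  moreover have "exec n S x (While (\<lambda>b s. s 2 \<noteq> 2)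
     (Seq (Act (\<lambda>b s. sweep_act u k r (Some 2) s)) (Act (\<lambda>b s. sweep_act u k r None s))))
     (h, block u k B 0 q V U) (h, block u k B 0 q V U)"
    using u k by (auto intro!: exec_While_False simp: scanned_def block_def counter_0_eq)
  ultimately show ?case using 0 by (intro exI[of _ V] exI[of _ v]) auto
next
  case (Suc C)
  let ?V1 = "\<lambda>i. swept (V i)" and ?V2 = "\<lambda>i. swept (swept (V i))"
  let ?v1 = "v + of_bool (V 0 0 = 1)"
  let ?v2 = "?v1 + of_bool (?V1 0 0 = 1)"
  have w1: "tape_within (- int (2 * Suc C) + 1) 0 (?V1 i)" if "i < k" for i
    by (rule tape_within_swept[OF Suc.prems(2)[OF that]])
  have w2: "tape_within (- int (2 * Suc C) + 1 + 1) 0 (?V2 i)" if "i < k" for i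
    by (rule tape_within_swept[OF w1[OF that]])
  have c: "card {j. ?V2 0 j = 1} + of_bool (?V1 0 0 = 1) + of_bool (V 0 0 = 1) = card {j. V 0 j = 1}"
    using card_swept[OF w1[OF k(1)]] card_swept[OF Suc.prems(2)[OF k(1)]] by simp
  obtain V' v' where IH: "exec n S x (While (\<lambda>b s. s 2 \<noteq> 2)
     (Seq (Act (\<lambda>b s. sweep_act u k r (Some 2) s)) (Act (\<lambda>b s. sweep_act u k r None s))))
      (h, block u k B C q ?V2 (U(r := counter ?v2)))
     (h, block u k B 0 q V' (U(r := counter v')))" "\<forall>i<k. tape_within 0 0 (V' i)"
     "v' + card {j. V' 0 j = 1} = ?v2 + card {j. ?V2 0 j = 1}"
  proof -
    have w: "tape_within (- int (2 * C)) 0 (?V2 i)" if "i < k" for i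
      using w2[OF that] by (simp add: algebra_simps)
    show thesis using Suc.IH[of "U(r := counter ?v2)" ?v2 ?V2, OF fun_upd_same w] that
      unfolding fun_upd_upd by blast
  qed
  have "exec n S x (Seq (Act (\<lambda>b s. sweep_act u k r (Some 2) s)) (Act (\<lambda>b s. sweep_act u k r None s)))
     (h, block u k B (Suc C) q V U) (h, block u k B C q ?V2 (U(r := counter ?v2)))"
    using exec_sweep_dec[OF r, of U v x h B C q V] exec_sweep[OF r, of "U(r := counter ?v1)" ?v1 x h B C q ?V1]
      Suc.prems(1) by (auto intro: exec_Seq)
  with IH(1) have "exec n S x (While (\<lambda>b s. s 2 \<noteq> 2)
     (Seq (Act (\<lambda>b s. sweep_act u k r (Some 2) s)) (Act (\<lambda>b s. sweep_act u k r None s))))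
      (h, block u k B (Suc C) q V U)
     (h, block u k B 0 q V' (U(r := counter v')))"
    using u k \<open>exec n S x (Seq _ _) _ _\<close> by - (rule exec_While_True, auto simp: scanned_def block_def counter_0_eq)
  moreover have "v' + card {j. V' 0 j = 1} = v + card {j. V 0 j = 1}" using IH(3) c by linarith
  ultimately show ?case using IH(2) by blast
qed

end

section \<open>Stepwise simulation of the called machine\<close>

locale sim_machine = sim_block n S u "num_tapes M" for n S u :: nat and M :: otm +
  fixes \<phi> :: "bool option \<Rightarrow> bool option"
  assumes M: "valid_otm M" "num_states M \<le> S" "num_symbols M \<le> S"
begin

abbreviation "K \<equiv> num_tapes M"

text \<open>The invariants on states and symbols are those under which \<open>valid_otm\<close>
  restricts \<open>trans\<close>; they guarantee that the new state and the written symbols belong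
  to the alphabet. Both counters grow with each step because a step enlarges the distance of
  nonblank cells from the heads by at most one.\<close>

lemma exec_sim_step:
  assumes \<phi>: "\<And>h. oracle_cell y h = \<phi> (oracle_cell x h)"
    and step: "otm_step M y (q, h, ws) = Some (q', h', ws')"
    and q: "q < num_states M" and ws: "length ws = K"
    and sym: "\<And>i j. i < K \<Longrightarrow> snd (ws ! i) j < num_symbols M"
    and B: "\<And>i. i < K \<Longrightarrow> tape_within (- int B) (int B) (rel_tape (ws ! i))"
  shows "sim_trans M u \<phi> (oracle_cell x h) (scanned n (block u K B B q (\<lambda>i. rel_tape (ws ! i)) U)) \<noteq> None"
    and "exec n S x (Act (sim_act M u \<phi>)) (h, block u K B B q (\<lambda>i. rel_tape (ws ! i)) U)
     (h', block u K (Suc B) (Suc B) q' (\<lambda>i. rel_tape (ws' ! i)) U)"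
    and "q' < num_states M" and "length ws' = K"
    and "\<And>i j. i < K \<Longrightarrow> snd (ws' ! i) j < num_symbols M"
    and "\<And>i. i < K \<Longrightarrow> tape_within (- int (Suc B)) (int (Suc B)) (rel_tape (ws' ! i))"
proof -
  let ?as = "map (\<lambda>(i, w). w i) ws"
  let ?T = "block u K B B q (\<lambda>i. rel_tape (ws ! i)) U"
  let ?s = "scanned n ?T"
  obtain m acts where tr: "trans M q (oracle_cell y h) ?as = Some (q', m, acts)"
    and h': "h' = move_head m h"
    and ws': "ws' = map2 (\<lambda>(a, m') (i, w). (move_head m' i, w(i := a))) acts ws"
    using step by (auto split: option.splits)
  have as: "length ?as = K" "\<forall>a\<in>set ?as. a < num_symbols M"
    using ws sym by (auto simp: in_set_conv_nth split: prod.splits) (metis snd_conv)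
  from M(1) q as tr have v: "q' < num_states M" "length acts = K" "\<forall>(a, _) \<in> set acts. a < num_symbols M"
    unfolding valid_otm_def by blast+
  show "q' < num_states M" "length ws' = K" using v ws ws' by auto
  have nth: "ws' ! i = (case ws ! i of (p, w) \<Rightarrow> (move_head (snd (acts ! i)) p, w(p := fst (acts ! i))))"
    if "i < K" for i
    using that v ws by (simp add: ws' split: prod.splits)
  have a: "fst (acts ! i) < num_symbols M" if "i < K" for i
    using v that by (metis (mono_tags, lifting) case_prod_beta nth_mem)
  show "snd (ws' ! i) j < num_symbols M" if "i < K" for i j
    using a[OF that] sym[OF that, of j] by (auto simp: nth[OF that] split: prod.splits)
  have rt: "rel_tape (ws' ! i) = tape_act S (Some (fst (acts ! i)), snd (acts ! i)) (rel_tape (ws ! i))"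
    if "i < K" for i
    using a[OF that] M(3) by (simp add: nth[OF that] rel_tape_step tape_act_def written_def)
  show "tape_within (- int (Suc B)) (int (Suc B)) (rel_tape (ws' ! i))" if "i < K" for i
    unfolding rt[OF that] by (rule tape_within_act[OF B[OF that]])
  have "map (\<lambda>i. ?s (Suc u + i)) [0..<K] = ?as"
    using ws u k by (auto simp: scanned_def block_def rel_tape_def nth_equalityI intro!: nth_equalityI split: prod.splits)
  moreover have "?s u = q" using u k by (auto simp: scanned_def block_def)
  ultimately have st: "sim_trans M u \<phi> (oracle_cell x h) ?s = Some (q', m, acts)"
    using tr by (simp add: sim_trans_def \<phi>)
  then show "sim_trans M u \<phi> (oracle_cell x h) ?s \<noteq> None" by simp
  have q': "q' < S" using v M by linarith
  show "exec n S x (Act (sim_act M u \<phi>)) (h, ?T)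
     (h', block u K (Suc B) (Suc B) q' (\<lambda>i. rel_tape (ws' ! i)) U)"
  proof (rule exec_ActI)
    have sa: "sim_act M u \<phi> (oracle_cell x h) ?s = (m, \<lambda>i. if i = 1 \<or> i = 2 then (None, Move_Right)
       else if i = u then (Some q', Stay)
       else if u < i \<and> i \<le> u + K
         then (Some (fst (acts ! (i - Suc u))), snd (acts ! (i - Suc u)))
       else (None, Stay))"
      by (simp add: sim_act_def st)
    show "apply_act n S (sim_act M u \<phi> (oracle_cell x h) ?s) (h, ?T) =
      (h', block u K (Suc B) (Suc B) q' (\<lambda>i. rel_tape (ws' ! i)) U)"
      unfolding sa using u k S q'
      by (intro apply_act_eqI)
         (auto simp: h' block_def rt tape_act_counter_inc tape_act_sing tape_act_keep)
  qed
qed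

lemma exec_run_sim:
  assumes \<phi>: "\<And>h. oracle_cell y h = \<phi> (oracle_cell x h)"
    and run: "(\<lambda>c c'. otm_step M y c = Some c')\<^sup>*\<^sup>* c (q', h', ws')"
    and halt: "otm_step M y (q', h', ws') = None"
    and c: "c = (q, h, ws)" "q < num_states M" "length ws = K"
    and sym: "\<And>i j. i < K \<Longrightarrow> snd (ws ! i) j < num_symbols M"
    and B: "\<And>i. i < K \<Longrightarrow> tape_within (- int B) (int B) (rel_tape (ws ! i))"
  shows "\<exists>B'. exec n S x (run_sim M u \<phi>) (h, block u K B B q (\<lambda>i. rel_tape (ws ! i)) U)
     (h', block u K B' B' q' (\<lambda>i. rel_tape (ws' ! i)) U) \<and> length ws' = K \<and>
     (\<forall>i<K. tape_within (- int B') (int B') (rel_tape (ws' ! i)))"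
  using run c sym B
proof (induction arbitrary: q h ws B rule: converse_rtranclp_induct)
  case base
  let ?T = "block u K B B q (\<lambda>i. rel_tape (ws ! i)) U"
  let ?s = "scanned n ?T"
  let ?as = "map (\<lambda>(i, w). w i) ws"
  have "map (\<lambda>i. ?s (Suc u + i)) [0..<K] = ?as"
    using base(3) u k by (auto simp: scanned_def block_def rel_tape_def intro!: nth_equalityI split: prod.splits)
  moreover have "?s u = q" using u k by (auto simp: scanned_def block_def)
  ultimately have "sim_trans M u \<phi> (oracle_cell x h) ?s = None"
    using halt base(1) by (auto simp: sim_trans_def \<phi> split: option.splits)
  then have "exec n S x (run_sim M u \<phi>) (h, ?T) (h, ?T)"
    unfolding run_sim_def by (intro exec_While_False) simp
  then show ?case using base by auto
next
  case (step c c1)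
  obtain q1 h1 ws1 where c1: "c1 = (q1, h1, ws1)" by (cases c1)
  have st: "otm_step M y (q, h, ws) = Some (q1, h1, ws1)" using step.hyps(1) step.prems(1) c1 by simp
  have s: "q1 < num_states M" "length ws1 = K" "\<And>i j. i < K \<Longrightarrow> snd (ws1 ! i) j < num_symbols M"
      "\<And>i. i < K \<Longrightarrow> tape_within (- int (Suc B)) (int (Suc B)) (rel_tape (ws1 ! i))"
    and s1: "sim_trans M u \<phi> (oracle_cell x h)
      (scanned n (block u K B B q (\<lambda>i. rel_tape (ws ! i)) U)) \<noteq> None"
    and s2: "exec n S x (Act (sim_act M u \<phi>)) (h, block u K B B q (\<lambda>i. rel_tape (ws ! i)) U)
     (h1, block u K (Suc B) (Suc B) q1 (\<lambda>i. rel_tape (ws1 ! i)) U)"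
    by (rule exec_sim_step[OF \<phi> st step.prems(2,3)]; use step.prems(4,5) in blast)+
  from step.IH[OF c1 s]
  obtain B' where "exec n S x (run_sim M u \<phi>)
      (h1, block u K (Suc B) (Suc B) q1 (\<lambda>i. rel_tape (ws1 ! i)) U)
     (h', block u K B' B' q' (\<lambda>i. rel_tape (ws' ! i)) U)" "length ws' = K"
     "\<forall>i<K. tape_within (- int B') (int B') (rel_tape (ws' ! i))" by auto
  moreover have "exec n S x (run_sim M u \<phi>) (h, block u K B B q (\<lambda>i. rel_tape (ws ! i)) U)
     (h', block u K B' B' q' (\<lambda>i. rel_tape (ws' ! i)) U)"
    unfolding run_sim_def
    by (rule exec_While_True[OF _ s2]) (use s1 calculation(1) in \<open>simp_all add: run_sim_def\<close>)
  ultimately show ?case by blast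
qed

text \<open>Apart from the output in tape \<open>r\<close> and the cleared arguments everything is
  as before the call, so calls can be repeated inside loops. The length of the run is not known in
  advance; the counters have recorded a bound.\<close>

lemma exec_call:
  assumes \<phi>: "\<And>h. oracle_cell y h = \<phi> (oracle_cell x h)"
    and yields: "otm_yields M y as out"
    and r: "u + K < r" "r + length as \<le> n" "as \<noteq> []"
    and U: "U 1 = counter 0" "U 2 = counter 0" "\<And>i. u \<le> i \<Longrightarrow> i \<le> u + K \<Longrightarrow> U i = blank"
    and regs: "\<And>i. i < length as \<Longrightarrow> U (r + i) = counter (as ! i)"
  shows "exec n S x (call_prog M u \<phi> r (length as)) (0, U)
    (0, \<lambda>i. if i = r then counter out else if r < i \<and> i < r + length as then counter 0 else U i)"
proof -
  obtain q' h' ws' where run: "(\<lambda>c c'. otm_step M y c = Some c')\<^sup>*\<^sup>* (otm_init M as) (q', h', ws')"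
    and halt: "otm_step M y (q', h', ws') = None" and out: "otm_output (q', h', ws') = out"
    using yields by (auto simp: otm_yields_def)
  let ?ws = "(0, input_tape as) # replicate (K - 1) (0, \<lambda>_. 0)"
  let ?U = "\<lambda>i. if r \<le> i \<and> i < r + length as then counter 0 else U i"
  let ?B = "Suc (length (encoded as))"
  have blank_upd: "blank(0 := 0) = blank" by (auto simp: blank_def)
  have U0: "U = block u K 0 0 0 ((\<lambda>_. blank)(0 := pushed [])) U"
    using U by (auto simp: block_def pushed_Nil blank_upd fun_eq_iff)
  have 1: "exec n S x (write_args u r (length as)) (0, U)
     (0, block u K (length (encoded as)) (length (encoded as)) 0 ((\<lambda>_. blank)(0 := pushed (encoded as))) ?U)"
    using exec_write_args[OF r(1,2) regs, of x 0 0 0 "[]"] U0 by simp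
  have 2: "exec n S x (Act (\<lambda>b s. start_act u))
     (0, block u K (length (encoded as)) (length (encoded as)) 0 ((\<lambda>_. blank)(0 := pushed (encoded as))) ?U)
     (0, block u K ?B ?B 0 ((\<lambda>_. blank)(0 := input_tape as)) ?U)"
    by (intro exec_ActI apply_start)
  have V: "block u K ?B ?B 0 ((\<lambda>_. blank)(0 := input_tape as)) ?U =
     block u K ?B ?B 0 (\<lambda>i. rel_tape (?ws ! i)) ?U"
    by (auto simp: block_def fun_eq_iff rel_tape_def blank_def nth_Cons')
  have st: "1 \<le> num_states M" "2 \<le> num_symbols M" using M(1) by (auto simp: valid_otm_def)
  have sym: "snd (?ws ! i) j < num_symbols M" if "i < K" for i j
  proof -
    have "l ! m \<le> 1" if "m < length l" "l = concat (map (\<lambda>a. replicate (a + 1) 1 @ [0]) as)" for l :: "nat list" and m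
      using nth_mem[OF that(1)] by (auto simp: that(2) split: if_splits)
    then have "input_tape as j \<le> 1" by (auto simp: input_tape_def Let_def)
    then show ?thesis using that st by (auto simp: nth_Cons')
  qed
  have wi: "tape_within (- int ?B) (int ?B) (rel_tape (?ws ! i))" if "i < K" for i
    using that
    by (auto simp: rel_tape_def nth_Cons' tape_within_def input_tape_def encoded_def Let_def split: if_splits)
  obtain B where 3: "exec n S x (run_sim M u \<phi>) (0, block u K ?B ?B 0 (\<lambda>i. rel_tape (?ws ! i)) ?U)
     (h', block u K B B q' (\<lambda>i. rel_tape (ws' ! i)) ?U)" and ws': "length ws' = K"
     and B: "\<And>i. i<K \<Longrightarrow> tape_within (- int B) (int B) (rel_tape (ws' ! i))"
    using exec_run_sim[OF \<phi> run halt _ _ _ sym wi, of 0 0 ?U] st k(1) by (auto simp: otm_init_def)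
  let ?V = "\<lambda>i j. rel_tape (ws' ! i) (j + int B)"
  have 4: "exec n S x (Act (\<lambda>b s. (Stay, \<lambda>i. if i = u then (Some 0, Stay) else (None, Stay))))
     (h', block u K B B q' (\<lambda>i. rel_tape (ws' ! i)) ?U)
     (h', block u K B B 0 (\<lambda>i. rel_tape (ws' ! i)) ?U)"
    using u k S by (intro exec_ActI apply_act_eqI) (auto simp: block_def tape_act_keep tape_act_sing)
  have Vw: "tape_within (- int (2 * B)) 0 (?V i)" if "i < K" for i
    unfolding tape_within_def
  proof (intro allI impI)
    fix j assume "?V i j \<noteq> 0"
    then have "- int B \<le> j + int B \<and> j + int B \<le> int B"
      using B[OF that] unfolding tape_within_def by blast
    then show "- int (2 * B) \<le> j \<and> j \<le> 0" by auto
  qed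
  have Ur: "?U r = counter 0" using r by (auto simp: Suc_le_eq)
  have r': "r < n" using r by (cases as) auto
  obtain V' v' where 5: "exec n S x (sweep_prog u K r) (h', block u K 0 B 0 ?V ?U)
     (h', block u K 0 0 0 V' (?U(r := counter v')))"
     and V': "\<And>i. i < K \<Longrightarrow> tape_within 0 0 (V' i)" and v': "v' + card {j. V' 0 j = 1} = card {j. ?V 0 j = 1}"
    using exec_sweep_prog[where U = ?U and V = ?V and C = B and v = 0 and B = 0 and q = 0, OF r(1) r' Ur Vw]
    by (simp only: add_0) blast
  have 6: "exec n S x (Act (\<lambda>b s. sweep_act u K r None s)) (h', block u K 0 0 0 V' (?U(r := counter v')))
    (h', block u K 0 0 0 (\<lambda>i. swept (V' i)) (?U(r := counter (v' + of_bool (V' 0 0 = 1)))))"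
    using exec_sweep[OF r(1) r', of "?U(r := counter v')" v' x h' 0 0 0 V'] unfolding fun_upd_upd by simp
  \<comment> \<open>The bounds have shrunk to \<open>1\<close> and \<open>0\<close>, between which
    there is no cell.\<close>
  have sw: "swept (V' i) = blank" if "i < K" for i
    using tape_within_swept[OF V'[OF that]] by (fastforce simp: tape_within_def blank_def)
  have "v' + of_bool (V' 0 0 = 1) = card {j. ?V 0 j = 1}"
    using v' card_swept[OF V'[OF k(1)]] by (simp add: sw[OF k(1)] blank_def)
  also have "{j. ?V 0 j = 1} = (\<lambda>i. i - fst (hd ws') - int B) ` {i. snd (hd ws') i = 1}"
  proof (intro set_eqI iffI)
    fix j assume "j \<in> {j. ?V 0 j = 1}"
    then have "fst (hd ws') + (j + int B) \<in> {i. snd (hd ws') i = 1}"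
      "j = (fst (hd ws') + (j + int B)) - fst (hd ws') - int B"
      using ws' k(1) by (cases ws'; auto simp: rel_tape_def)+
    then show "j \<in> (\<lambda>i. i - fst (hd ws') - int B) ` {i. snd (hd ws') i = 1}" by blast
  qed (use ws' k(1) in \<open>cases ws'; auto simp: rel_tape_def\<close>)
  also have "card \<dots> = card {i. snd (hd ws') i = 1}" by (rule card_image) (simp add: inj_on_def)
  also have "\<dots> = out" using out by simp
  finally have out': "v' + of_bool (V' 0 0 = 1) = out" .
  have fin: "block u K 0 0 0 (\<lambda>i. swept (V' i)) (?U(r := counter out)) =
      (\<lambda>i. if i = r then counter out else if r < i \<and> i < r + length as then counter 0 else U i)"
    using u k r U sw by (auto simp: block_def fun_eq_iff blank_upd)
  show ?thesis
    unfolding call_prog_def fin[symmetric]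
    by (rule exec_Seq[OF 1 exec_Seq[OF 2[unfolded V] exec_Seq[OF 3 exec_Seq[OF 4 exec_Seq[OF exec_right
        exec_Seq[OF 5 exec_Seq[OF 6[unfolded out'] exec_reset_oracle]]]]]]])
qed

end

section \<open>Arithmetic expressions over a relation and a function\<close>

text \<open>Variables are de Bruijn levels. In \<open>For a b c\<close> the body \<open>c\<close> sees the accumulator at level \<open>d\<close>
  and the downward running index at level \<open>d + 1\<close>, where \<open>d\<close> is the current depth; in \<open>Find a b\<close>
  the body sees the index at level \<open>d\<close>.\<close>

datatype expr =
    Var nat
  | Zero
  | Succ expr
  | Pred expr
  | For expr expr expr
  | Find expr expr
  | Query "nat list"
  | Lookup nat

text \<open>Indices run downward because a loop consumes the register of its bound by decrements,
  and what remains in it serves as the index.\<close>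

fun down_loop :: "(nat \<Rightarrow> nat \<Rightarrow> nat) \<Rightarrow> nat \<Rightarrow> nat \<Rightarrow> nat" where
  "down_loop f 0 v = v"
| "down_loop f (Suc i) v = down_loop f i (f i v)"

text \<open>The result is the first nonzero value met, not its position. It is nonzero iff such a
  value exists, so this is a bounded existential quantifier that may stop early.\<close>

fun down_find :: "(nat \<Rightarrow> nat) \<Rightarrow> nat \<Rightarrow> nat" where
  "down_find f 0 = 0"
| "down_find f (Suc i) = (if f i = 0 then down_find f i else f i)"

fun eval :: "(nat list \<Rightarrow> nat) \<Rightarrow> (nat \<Rightarrow> nat) \<Rightarrow> nat \<Rightarrow> expr \<Rightarrow> (nat \<Rightarrow> nat) \<Rightarrow> nat" where
  "eval R g d (Var i) env = env i"
| "eval R g d Zero env = 0"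
| "eval R g d (Succ a) env = Suc (eval R g d a env)"
| "eval R g d (Pred a) env = eval R g d a env - 1"
| "eval R g d (For a b c) env =
     down_loop (\<lambda>i v. eval R g (d + 2) c (env(d := v, d + 1 := i)))
       (eval R g (d + 1) b (env(d := eval R g d a env))) (eval R g d a env)"
| "eval R g d (Find a b) env =
     down_find (\<lambda>i. eval R g (d + 1) b (env(d := i))) (eval R g d a env)"
| "eval R g d (Query is) env = R (map env is)"
| "eval R g d (Lookup i) env = g (env i)"

text \<open>Registers below \<open>d\<close> hold the variables, and the value is computed into
  register \<open>d\<close>. The bounds by \<open>N\<close> leave room for the scratch registers
  above, such as \<open>d + 1\<close> for copying.\<close>

fun fits :: "nat \<Rightarrow> nat \<Rightarrow> nat \<Rightarrow> expr \<Rightarrow> bool" where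
  "fits k N d (Var i) \<longleftrightarrow> i < d \<and> d + 1 < N"
| "fits k N d Zero \<longleftrightarrow> True"
| "fits k N d (Succ a) \<longleftrightarrow> d < N \<and> fits k N d a"
| "fits k N d (Pred a) \<longleftrightarrow> d < N \<and> fits k N d a"
| "fits k N d (For a b c) \<longleftrightarrow> d + 2 < N \<and> fits k N d a \<and> fits k N (d + 1) b \<and> fits k N (d + 2) c"
| "fits k N d (Find a b) \<longleftrightarrow> d + 1 < N \<and> fits k N d a \<and> fits k N (d + 1) b"
| "fits k N d (Query is) \<longleftrightarrow> length is = k \<and> is \<noteq> [] \<and> d + k < N \<and> (\<forall>i \<in> set is. i < d)"
| "fits k N d (Lookup i) \<longleftrightarrow> d + 1 < N \<and> i < d"

section \<open>Compilation of expressions for two given machines\<close>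

locale two_machines =
  fixes MR MG :: otm and N kR :: nat and R :: "(nat \<Rightarrow> bool) \<Rightarrow> nat list \<Rightarrow> nat" and g :: "nat \<Rightarrow> nat"
  assumes MR: "valid_otm MR" and MG: "valid_otm MG"
    and R: "\<And>x as. length as = kR \<Longrightarrow> otm_yields MR x as (R x as)"
    and g: "\<And>m. otm_yields MG (\<lambda>_. False) [m] (g m)"
    and N: "2 < N"
begin

text \<open>Tape layout: \<open>0\<close> is input and output, \<open>1\<close> and \<open>2\<close>
  are the counters of calls, \<open>3\<close> and the following tapes simulate \<open>MR\<close>,
  those from \<open>uG\<close> on simulate \<open>MG\<close>, and the \<open>N\<close> registers
  start at \<open>reg\<close>.\<close>

definition uG :: nat where "uG = 4 + num_tapes MR"
definition reg :: nat where "reg = 5 + num_tapes MR + num_tapes MG"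
definition nt :: nat where "nt = reg + N"
text \<open>A call stores the state of the simulated machine as one symbol, so the alphabet must
  accommodate the states of both machines.\<close>

definition sy :: nat where
  "sy = 3 + num_states MR + num_states MG + num_symbols MR + num_symbols MG"

definition store :: "(nat \<Rightarrow> nat) \<Rightarrow> rel_tapes" where
  "store env = (\<lambda>i. if i = 0 then blank else if i \<le> 2 then counter 0
     else if i < reg then blank else counter (env (i - reg)))"

text \<open>With \<open>I\<close> empty this clears register \<open>r\<close>, with a singleton it
  moves the register, with two elements it duplicates it.\<close>

definition move_loop :: "nat \<Rightarrow> nat set \<Rightarrow> prog" where
  "move_loop r I = While (\<lambda>b s. s (reg + r) \<noteq> 2)
     (Act (\<lambda>b s. (Stay, \<lambda>i. if i = reg + r then (None, Move_Left)
        else if reg \<le> i \<and> i - reg \<in> I then (None, Move_Right) else (None, Stay))))"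

definition inc_prog :: "nat \<Rightarrow> prog" where
  "inc_prog r = Act (\<lambda>b s. (Stay, \<lambda>i. if i = reg + r then (None, Move_Right) else (None, Stay)))"

definition dec_prog :: "nat \<Rightarrow> prog" where
  "dec_prog r = Act (\<lambda>b s. (Stay, \<lambda>i. if i = reg + r \<and> s i \<noteq> 2 then (None, Move_Left)
     else (None, Stay)))"

text \<open>Reading a register destroys it, so the value is duplicated and one of the copies is
  moved back.\<close>

definition copy_prog :: "nat \<Rightarrow> nat \<Rightarrow> prog" where
  "copy_prog i d = Seq (move_loop i {d, d + 1}) (move_loop (d + 1) {i})"

fun copies_prog :: "nat \<Rightarrow> nat list \<Rightarrow> prog" where
  "copies_prog d [] = Act (\<lambda>b s. idle)"
| "copies_prog d (i # is) = Seq (copy_prog i d) (copies_prog (Suc d) is)"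

fun expr_prog :: "nat \<Rightarrow> expr \<Rightarrow> prog" where
  "expr_prog d (Var i) = copy_prog i d"
| "expr_prog d Zero = Act (\<lambda>b s. idle)"
| "expr_prog d (Succ a) = Seq (expr_prog d a) (inc_prog d)"
| "expr_prog d (Pred a) = Seq (expr_prog d a) (dec_prog d)"
| "expr_prog d (For a b c) = Seq (expr_prog d a) (Seq (expr_prog (d + 1) b)
     (While (\<lambda>b s. s (reg + (d + 1)) \<noteq> 2) (Seq (dec_prog (d + 1)) (Seq (expr_prog (d + 2) c)
       (Seq (move_loop d {}) (move_loop (d + 2) {d}))))))"
| "expr_prog d (Find a b) = Seq (expr_prog d a)
     (Seq (While (\<lambda>b s. s (reg + d) \<noteq> 2 \<and> s (reg + (d + 1)) = 2)
       (Seq (dec_prog d) (expr_prog (d + 1) b)))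
     (Seq (move_loop d {}) (move_loop (d + 1) {d})))"
| "expr_prog d (Query is) = Seq (copies_prog d is) (call_prog MR 3 id (reg + d) kR)"
| "expr_prog d (Lookup i) = Seq (copy_prog i d)
     (call_prog MG uG (map_option (\<lambda>_. False)) (reg + d) 1)"

lemma scanned_store: "r < N \<Longrightarrow> scanned nt (store env) (reg + r) = (if env r = 0 then 2 else 0)"
  by (simp add: scanned_def store_def nt_def reg_def counter_0_eq)

lemma exec_move_loop:
  assumes r: "r < N" "r \<notin> I"
  shows "exec nt sy x (move_loop r I) (h, store env)
    (h, store (\<lambda>i. if i = r then 0 else if i \<in> I \<and> i < N then env i + env r else env i))"
proof (induction "env r" arbitrary: env)
  case 0
  then have "(\<lambda>i. if i = r then 0 else if i \<in> I \<and> i < N then env i + env r else env i) = env"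
    by auto
  then show ?case using 0 r unfolding move_loop_def
    by (simp add: exec_While_False scanned_store)
next
  case (Suc v)
  let ?env = "\<lambda>i. if i = r then v else if i \<in> I \<and> i < N then Suc (env i) else env i"
  have 1: "exec nt sy x (Act (\<lambda>b s. (Stay, \<lambda>i. if i = reg + r then (None, Move_Left)
        else if reg \<le> i \<and> i - reg \<in> I then (None, Move_Right) else (None, Stay)))) (h, store env)
     (h, store ?env)"
    using Suc(2)[symmetric] r
    by (intro exec_ActI apply_act_eqI)
       (auto simp: store_def nt_def tape_act_counter_dec tape_act_counter_inc tape_act_keep reg_def)
  have "(\<lambda>i. if i = r then 0 else if i \<in> I \<and> i < N then ?env i + ?env r else ?env i) =
     (\<lambda>i. if i = r then 0 else if i \<in> I \<and> i < N then env i + env r else env i)"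
    using Suc(2)[symmetric] r by auto
  then show ?case using Suc(1)[of ?env] 1 Suc(2)[symmetric] r unfolding move_loop_def
    by - (rule exec_While_True, simp_all add: scanned_store)
qed

lemma exec_clear:
  assumes "r < N"
  shows "exec nt sy x (move_loop r {}) (h, store env) (h, store (env(r := 0)))"
proof -
  have "(\<lambda>i. if i = r then 0 else if i \<in> {} \<and> i < N then env i + env r else env i) = env(r := 0)"
    by auto
  with exec_move_loop[OF assms, of "{}" x h env] show ?thesis by (simp only: empty_iff not_False_eq_True)
qed

lemma exec_move:
  assumes "r < N" "s < N" "r \<noteq> s" "env s = 0"
  shows "exec nt sy x (move_loop r {s}) (h, store env) (h, store (env(s := env r, r := 0)))"
proof -
  have "(\<lambda>i. if i = r then 0 else if i \<in> {s} \<and> i < N then env i + env r else env i) =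
      env(s := env r, r := 0)"
    using assms by auto
  moreover have "r \<notin> {s}" using assms by simp
  ultimately show ?thesis using exec_move_loop[OF assms(1), of "{s}" x h env] by (simp only: not_False_eq_True)
qed

lemma exec_inc: "exec nt sy x (inc_prog r) (h, store env) (h, store (env(r := Suc (env r))))"
  if "r < N"
  using that unfolding inc_prog_def
  by (intro exec_ActI apply_act_eqI)
     (auto simp: store_def nt_def tape_act_counter_inc tape_act_keep reg_def)

lemma exec_dec: "exec nt sy x (dec_prog r) (h, store env) (h, store (env(r := env r - 1)))"
  if "r < N"
proof (cases "env r")
  case 0
  then have "env(r := env r - 1) = env" by auto
  moreover have "exec nt sy x (dec_prog r) (h, store env) (h, store env)"
    using that 0 unfolding dec_prog_def
    by (intro exec_ActI apply_act_eqI) (auto simp: scanned_store tape_act_keep)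
  ultimately show ?thesis by simp
next
  case (Suc v)
  then have s: "scanned nt (store env) (reg + r) = 0" using that scanned_store[of r env] by simp
  have "2 < reg" by (simp add: reg_def)
  with Suc s show ?thesis using that unfolding dec_prog_def
    by (intro exec_ActI apply_act_eqI)
       (auto simp: store_def nt_def tape_act_counter_dec tape_act_keep)
qed

lemma exec_copy:
  assumes "i < d" "d + 1 < N" and z: "env d = 0" "env (d + 1) = 0"
  shows "exec nt sy x (copy_prog i d) (h, store env) (h, store (env(d := env i)))"
proof -
  let ?e1 = "\<lambda>j. if j = i then 0 else if j \<in> {d, d + 1} \<and> j < N then env j + env i else env j"
  have e: "(\<lambda>j. if j = d + 1 then 0 else if j \<in> {i} \<and> j < N then ?e1 j + ?e1 (d + 1) else ?e1 j) =
      env(d := env i)"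
    using assms by (auto simp: fun_eq_iff)
  have 1: "exec nt sy x (move_loop i {d, d + 1}) (h, store env) (h, store ?e1)"
    using assms by (intro exec_move_loop) auto
  have "exec nt sy x (move_loop (d + 1) {i}) (h, store ?e1) (h, store (env(d := env i)))"
    unfolding e[symmetric] using assms by (intro exec_move_loop) auto
  with 1 show ?thesis unfolding copy_prog_def by (rule exec_Seq)
qed

definition pushed_env :: "(nat \<Rightarrow> nat) \<Rightarrow> nat \<Rightarrow> nat list \<Rightarrow> nat \<Rightarrow> nat" where
  "pushed_env env d vs = (\<lambda>i. if d \<le> i \<and> i < d + length vs then vs ! (i - d) else env i)"

lemma exec_copies:
  assumes "\<forall>i\<in>set is. i < d0" "d0 \<le> d" "d + length is < N" "\<And>i. d \<le> i \<Longrightarrow> env i = 0"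
  shows "exec nt sy x (copies_prog d is) (h, store env) (h, store (pushed_env env d (map env is)))"
  using assms
proof (induction "is" arbitrary: d env)
  case Nil
  have "pushed_env env d [] = env" by (auto simp: pushed_env_def)
  then show ?case by (auto intro!: exec_ActI simp: apply_act_idle)
next
  case (Cons i "is")
  let ?env = "env(d := env i)"
  have 1: "exec nt sy x (copy_prog i d) (h, store env) (h, store ?env)"
    using Cons.prems by (intro exec_copy) auto
  have 2: "exec nt sy x (copies_prog (Suc d) is) (h, store ?env)
     (h, store (pushed_env ?env (Suc d) (map ?env is)))"
    using Cons.prems by (intro Cons.IH) auto
  have "map ?env is = map env is" using Cons.prems by auto
  then have "pushed_env ?env (Suc d) (map ?env is) = pushed_env env d (map env (i # is))"
    by (auto simp: pushed_env_def fun_eq_iff nth_Cons')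
  with exec_Seq[OF 1 2] show ?case by simp
qed

lemma tapes_pos: "0 < num_tapes MR" "0 < num_tapes MG"
  using MR MG by (auto simp: valid_otm_def)

interpretation simR: sim_machine nt sy 3 MR id
  using MR tapes_pos by unfold_locales (auto simp: sy_def nt_def reg_def)

interpretation simG: sim_machine nt sy uG MG "map_option (\<lambda>_. False)"
  using MG tapes_pos by unfold_locales (auto simp: sy_def nt_def reg_def uG_def)

lemma exec_query:
  assumes "vs \<noteq> []" "length vs = kR" "d + kR < N" "\<And>i. d \<le> i \<Longrightarrow> env i = 0"
  shows "exec nt sy x (call_prog MR 3 id (reg + d) kR) (0, store (pushed_env env d vs))
    (0, store (env(d := R x vs)))"
proof -
  let ?U = "store (pushed_env env d vs)"
  have "exec nt sy x (call_prog MR 3 id (reg + d) (length vs)) (0, ?U)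
    (0, \<lambda>i. if i = reg + d then counter (R x vs)
       else if reg + d < i \<and> i < reg + d + length vs then counter 0 else ?U i)"
    using assms R[of vs x]
    by (intro simR.exec_call[where y = x])
       (auto simp: reg_def nt_def store_def pushed_env_def)
  moreover have "(\<lambda>i. if i = reg + d then counter (R x vs)
       else if reg + d < i \<and> i < reg + d + length vs then counter 0 else ?U i) =
     store (env(d := R x vs))"
    using assms by (auto simp: store_def pushed_env_def reg_def fun_eq_iff)
  ultimately show ?thesis using assms(2) by simp
qed

lemma exec_lookup:
  assumes "d + 1 < N" "\<And>i. d \<le> i \<Longrightarrow> env i = 0"
  shows "exec nt sy x (call_prog MG uG (map_option (\<lambda>_. False)) (reg + d) 1) (0, store (env(d := v)))
    (0, store (env(d := g v)))"
proof -
  let ?U = "store (env(d := v))"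
  have "exec nt sy x (call_prog MG uG (map_option (\<lambda>_. False)) (reg + d) (length [v])) (0, ?U)
    (0, \<lambda>i. if i = reg + d then counter (g v)
       else if reg + d < i \<and> i < reg + d + length [v] then counter 0 else ?U i)"
    using assms g[of v]
    by (intro simG.exec_call[where y = "\<lambda>_. False"])
       (auto simp: reg_def nt_def store_def uG_def oracle_cell_def)
  moreover have "(\<lambda>i. if i = reg + d then counter (g v)
       else if reg + d < i \<and> i < reg + d + length [v] then counter 0 else ?U i) =
     store (env(d := g v))"
    using assms by (auto simp: store_def reg_def fun_eq_iff)
  ultimately show ?thesis by simp
qed

text \<open>Calling convention: the registers from \<open>d\<close> on are zero at the start, and
  only register \<open>d\<close> has changed at the end. The scratch registers are thus zero again,
  and subexpressions can be run one after the other at increasing depths.\<close>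

lemma exec_expr:
  assumes "fits kR N d e" "\<And>i. d \<le> i \<Longrightarrow> env i = 0"
  shows "exec nt sy x (expr_prog d e) (0, store env) (0, store (env(d := eval (R x) g d e env)))"
  using assms
proof (induction e arbitrary: d env)
  case (Var i)
  then show ?case unfolding expr_prog.simps eval.simps by (intro exec_copy) auto
next
  case Zero
  then have "env(d := 0) = env" by auto
  then show ?case by (auto intro!: exec_ActI simp: apply_act_idle)
next
  case (Succ e)
  let ?env = "env(d := eval (R x) g d e env)"
  have "exec nt sy x (expr_prog d e) (0, store env) (0, store ?env)"
    using Succ.prems by (intro Succ.IH) auto
  moreover have "exec nt sy x (inc_prog d) (0, store ?env) (0, store (env(d := Suc (eval (R x) g d e env))))"
    using exec_inc[of d x 0 ?env] Succ.prems(1) unfolding fun_upd_upd fun_upd_same by auto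
  ultimately show ?case unfolding expr_prog.simps eval.simps by (rule exec_Seq)
next
  case (Pred e)
  let ?env = "env(d := eval (R x) g d e env)"
  have "exec nt sy x (expr_prog d e) (0, store env) (0, store ?env)"
    using Pred.prems by (intro Pred.IH) auto
  moreover have "exec nt sy x (dec_prog d) (0, store ?env) (0, store (env(d := eval (R x) g d e env - 1)))"
    using exec_dec[of d x 0 ?env] Pred.prems(1) unfolding fun_upd_upd fun_upd_same by auto
  ultimately show ?case unfolding expr_prog.simps eval.simps by (rule exec_Seq)
next
  case (For a b c)
  let ?a = "eval (R x) g d a env" and ?b = "eval (R x) g (d + 1) b (env(d := eval (R x) g d a env))"
  let ?c = "\<lambda>i v. eval (R x) g (d + 2) c (env(d := v, d + 1 := i))"
  let ?W = "While (\<lambda>b s. s (reg + (d + 1)) \<noteq> 2) (Seq (dec_prog (d + 1)) (Seq (expr_prog (d + 2) c)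
       (Seq (move_loop d {}) (move_loop (d + 2) {d}))))"
  have loop: "exec nt sy x ?W (0, store (env(d := v, d + 1 := m))) (0, store (env(d := down_loop ?c m v)))"
    for v m
  proof (induction m arbitrary: v)
    case 0
    have "env(d := v, d + 1 := 0) = env(d := v)" using For.prems by auto
    moreover have "exec nt sy x ?W (0, store (env(d := v))) (0, store (env(d := v)))"
      by (rule exec_While_False) (use For.prems scanned_store[of "d + 1" "env(d := v)"] in auto)
    ultimately show ?case by (simp only: down_loop.simps)
  next
    case (Suc m)
    let ?e = "env(d := v, d + 1 := m)"
    have 1: "exec nt sy x (dec_prog (d + 1)) (0, store (env(d := v, d + 1 := Suc m))) (0, store ?e)"
      using exec_dec[of "d + 1" x 0 "env(d := v, d + 1 := Suc m)"] For.prems(1) by simp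
    have 2: "exec nt sy x (expr_prog (d + 2) c) (0, store ?e) (0, store (?e(d + 2 := ?c m v)))"
      using For.prems by (intro For.IH(3)) auto
    have 3: "exec nt sy x (move_loop d {}) (0, store (?e(d + 2 := ?c m v)))
       (0, store (?e(d + 2 := ?c m v, d := 0)))"
      using For.prems(1) by (intro exec_clear) auto
    have 4: "exec nt sy x (move_loop (d + 2) {d}) (0, store (?e(d + 2 := ?c m v, d := 0)))
       (0, store (env(d := ?c m v, d + 1 := m)))"
    proof -
      let ?f = "?e(d + 2 := ?c m v, d := 0)"
      have "?f(d := ?f (d + 2), d + 2 := 0) = env(d := ?c m v, d + 1 := m)"
        using For.prems(2) by (auto simp: fun_eq_iff)
      moreover have "exec nt sy x (move_loop (d + 2) {d}) (0, store ?f)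
          (0, store (?f(d := ?f (d + 2), d + 2 := 0)))"
        using For.prems(1) by (intro exec_move) auto
      ultimately show ?thesis by (simp only:)
    qed
    show ?case
    proof (rule exec_While_True[OF _ exec_Seq[OF 1 exec_Seq[OF 2 exec_Seq[OF 3 4]]]])
      show "scanned nt (store (env(d := v, d + 1 := Suc m))) (reg + (d + 1)) \<noteq> 2"
        using For.prems(1) scanned_store[of "d + 1" "env(d := v, d + 1 := Suc m)"] by auto
    qed (use Suc.IH[of "?c m v"] in \<open>simp only: down_loop.simps\<close>)
  qed
  have "exec nt sy x (expr_prog d a) (0, store env) (0, store (env(d := ?a)))"
    using For.prems by (intro For.IH(1)) auto
  moreover have "exec nt sy x (expr_prog (d + 1) b) (0, store (env(d := ?a)))
      (0, store (env(d := ?a, d + 1 := ?b)))"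
    using For.prems by (intro For.IH(2)) auto
  ultimately show ?case
    using loop[of ?a ?b] unfolding expr_prog.simps eval.simps by (blast intro: exec_Seq)
next
  case (Find a b)
  let ?a = "eval (R x) g d a env" and ?b = "\<lambda>i. eval (R x) g (d + 1) b (env(d := i))"
  let ?W = "While (\<lambda>b s. s (reg + d) \<noteq> 2 \<and> s (reg + (d + 1)) = 2) (Seq (dec_prog d) (expr_prog (d + 1) b))"
  \<comment> \<open>The search may end early, so the final index \<open>m'\<close> is unspecified;
    it is cleared afterwards.\<close>
  have loop: "\<exists>m'. exec nt sy x ?W (0, store (env(d := m)))
     (0, store (env(d := m', d + 1 := down_find ?b m)))" for m
  proof (induction m)
    case 0
    have "env(d := 0, d + 1 := 0) = env(d := 0)" using Find.prems by auto
    moreover have "exec nt sy x ?W (0, store (env(d := 0))) (0, store (env(d := 0)))"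
      by (rule exec_While_False) (use Find.prems scanned_store[of d "env(d := 0)"] in auto)
    ultimately show ?case by (intro exI[of _ 0]) (simp only: down_find.simps)
  next
    case (Suc m)
    have 1: "exec nt sy x (dec_prog d) (0, store (env(d := Suc m))) (0, store (env(d := m)))"
      using exec_dec[of d x 0 "env(d := Suc m)"] Find.prems(1) by simp
    have 2: "exec nt sy x (expr_prog (d + 1) b) (0, store (env(d := m))) (0, store (env(d := m, d + 1 := ?b m)))"
      using Find.prems by (intro Find.IH(2)) auto
    have c: "scanned nt (store (env(d := Suc m))) (reg + d) \<noteq> 2 \<and>
        scanned nt (store (env(d := Suc m))) (reg + (d + 1)) = 2"
      using Find.prems scanned_store[of d] scanned_store[of "d + 1"] by auto
    have "\<exists>m'. exec nt sy x ?W (0, store (env(d := m, d + 1 := ?b m)))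
       (0, store (env(d := m', d + 1 := down_find ?b (Suc m))))"
    proof (cases "?b m = 0")
      case True
      have "env(d := m, d + 1 := 0) = env(d := m)" using Find.prems by auto
      with True Suc.IH show ?thesis by (simp only: down_find.simps simp_thms if_True)
    next
      case False
      then have "exec nt sy x ?W (0, store (env(d := m, d + 1 := ?b m))) (0, store (env(d := m, d + 1 := ?b m)))"
        using Find.prems scanned_store[of "d + 1" "env(d := m, d + 1 := ?b m)"]
        by (intro exec_While_False) auto
      with False show ?thesis by auto
    qed
    then obtain m' where 3: "exec nt sy x ?W (0, store (env(d := m, d + 1 := ?b m)))
       (0, store (env(d := m', d + 1 := down_find ?b (Suc m))))" by blast
    show ?case
      by (rule exI[of _ m'], rule exec_While_True[OF _ exec_Seq[OF 1 2] 3]) (rule c)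
  qed
  obtain m' where m': "exec nt sy x ?W (0, store (env(d := ?a)))
     (0, store (env(d := m', d + 1 := down_find ?b ?a)))" using loop by blast
  let ?f = "env(d := m', d + 1 := down_find ?b ?a)"
  have 1: "exec nt sy x (expr_prog d a) (0, store env) (0, store (env(d := ?a)))"
    using Find.prems by (intro Find.IH(1)) auto
  have 3: "exec nt sy x (move_loop d {}) (0, store ?f) (0, store (?f(d := 0)))"
    using Find.prems(1) by (intro exec_clear) auto
  have 4: "exec nt sy x (move_loop (d + 1) {d}) (0, store (?f(d := 0)))
      (0, store (env(d := down_find ?b ?a)))"
  proof -
    let ?h = "?f(d := 0)"
    have "?h(d := ?h (d + 1), d + 1 := 0) = env(d := down_find ?b ?a)"
      using Find.prems(2) by (auto simp: fun_eq_iff)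
    moreover have "exec nt sy x (move_loop (d + 1) {d}) (0, store ?h)
        (0, store (?h(d := ?h (d + 1), d + 1 := 0)))"
      using Find.prems(1) by (intro exec_move) auto
    ultimately show ?thesis by (simp only:)
  qed
  show ?case unfolding expr_prog.simps eval.simps
    by (rule exec_Seq[OF 1 exec_Seq[OF m' exec_Seq[OF 3 4]]])
next
  case (Query "is")
  have "exec nt sy x (copies_prog d is) (0, store env) (0, store (pushed_env env d (map env is)))"
    using Query.prems by (intro exec_copies[where d0 = d]) auto
  moreover have "exec nt sy x (call_prog MR 3 id (reg + d) kR) (0, store (pushed_env env d (map env is)))
    (0, store (env(d := R x (map env is))))"
    using Query.prems by (intro exec_query) auto
  ultimately show ?case unfolding expr_prog.simps eval.simps by (rule exec_Seq)
next
  case (Lookup i)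
  have "exec nt sy x (copy_prog i d) (0, store env) (0, store (env(d := env i)))"
    using Lookup.prems by (intro exec_copy) auto
  moreover have "exec nt sy x (call_prog MG uG (map_option (\<lambda>_. False)) (reg + d) 1) (0, store (env(d := env i)))
    (0, store (env(d := g (env i))))"
    using Lookup.prems by (intro exec_lookup) auto
  ultimately show ?case unfolding expr_prog.simps eval.simps by (rule exec_Seq)
qed

section \<open>Input and output of the compiled machine\<close>

definition init_act :: action where
  "init_act = (Stay, \<lambda>i. if i = 1 \<or> i = 2 \<or> reg \<le> i then (Some 2, Stay) else (None, Stay))"

definition read_input :: prog where
  "read_input = While (\<lambda>b s. s 0 = 1) (Act (\<lambda>b s. (Stay, \<lambda>i. if i = 0 then (Some 0, Move_Right)
     else if i = reg then (None, Move_Right) else (None, Stay))))"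

definition output_act :: "(nat \<Rightarrow> nat) \<Rightarrow> action" where
  "output_act s = (Stay, \<lambda>i. if i = 0 \<and> s (reg + 1) \<noteq> 2 then (Some 1, Stay) else (None, Stay))"

text \<open>The input \<open>m\<close> consists of \<open>m + 1\<close> strokes, which are erased
  and counted into register \<open>0\<close>; hence the decrement. The tape \<open>0\<close> is
  blank when it receives the output, which is at most one stroke.\<close>

definition main_prog :: "expr \<Rightarrow> prog" where
  "main_prog e = Seq (Act (\<lambda>b s. init_act)) (Seq read_input (Seq (dec_prog 0)
     (Seq (expr_prog 1 e) (Act (\<lambda>b s. output_act s)))))"

definition strokes :: "nat \<Rightarrow> int \<Rightarrow> nat" where
  "strokes m = (\<lambda>j. if 0 \<le> j \<and> j < int m then 1 else 0)"

lemma exec_read_input: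
  "exec nt sy x read_input (0, (store ((\<lambda>_. 0)(0 := v)))(0 := strokes m))
     (0, store ((\<lambda>_. 0)(0 := v + m)))"
proof (induction m arbitrary: v)
  case 0
  have "strokes 0 = blank" by (auto simp: strokes_def blank_def)
  then have "(store ((\<lambda>_. 0)(0 := v)))(0 := strokes 0) = store ((\<lambda>_. 0)(0 := v))"
    by (auto simp: store_def)
  moreover have "scanned nt (store ((\<lambda>_. 0)(0 := v))) 0 \<noteq> 1"
    by (simp add: scanned_def store_def blank_def)
  then have "exec nt sy x read_input (0, store ((\<lambda>_. 0)(0 := v))) (0, store ((\<lambda>_. 0)(0 := v)))"
    unfolding read_input_def by (rule exec_While_False)
  ultimately show ?case by (simp only: add_0_right)
next
  case (Suc m)
  have t: "tape_act sy (Some 0, Move_Right) (strokes (Suc m)) = strokes m"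
    by (auto simp: tape_act_def written_def strokes_def fun_eq_iff sy_def)
  have 1: "exec nt sy x (Act (\<lambda>b s. (Stay, \<lambda>i. if i = 0 then (Some 0, Move_Right)
     else if i = reg then (None, Move_Right) else (None, Stay))))
     (0, (store ((\<lambda>_. 0)(0 := v)))(0 := strokes (Suc m)))
     (0, (store ((\<lambda>_. 0)(0 := Suc v)))(0 := strokes m))"
    using t N by (intro exec_ActI apply_act_eqI)
      (auto simp: store_def nt_def reg_def tape_act_keep tape_act_counter_inc)
  show ?case unfolding read_input_def
  proof (rule exec_While_True[OF _ 1])
    show "scanned nt ((store ((\<lambda>_. 0)(0 := v)))(0 := strokes (Suc m))) 0 = 1"
      by (simp add: scanned_def strokes_def nt_def reg_def)
  qed (use Suc.IH[of "Suc v"] in \<open>simp only: read_input_def add_Suc add_Suc_right\<close>)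
qed

lemma compiled_main_yields:
  assumes e: "fits kR N 1 e"
  shows "otm_yields (compiled nt sy (main_prog e)) x [m]
    (of_bool (eval (R x) g 1 e ((\<lambda>_. 0)(0 := m)) \<noteq> 0))"
proof -
  let ?v = "eval (R x) g 1 e ((\<lambda>_. 0)(0 := m))"
  \<comment> \<open>Tapes from \<open>nt\<close> on do not exist in the machine; they get the value
    that \<open>store\<close> assigns to empty registers.\<close>
  let ?T = "\<lambda>i. if i = 0 then input_tape [m] else if i < nt then blank else counter 0"
  have str: "input_tape [m] = strokes (Suc m)"
    by (auto simp: input_tape_def strokes_def Let_def fun_eq_iff nth_append simp del: replicate_Suc)
  have z: "(\<lambda>_. 0)(0 := 0) = (\<lambda>_. 0 :: nat)" by auto
  have bc: "tape_act sy (Some 2, Stay) blank = counter 0"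
    by (auto simp: tape_act_def written_def blank_def counter_def sy_def fun_eq_iff)
  have 1: "exec nt sy x (Act (\<lambda>b s. init_act)) (0, ?T) (0, (store ((\<lambda>_. 0)(0 := 0)))(0 := strokes (Suc m)))"
    using bc by (intro exec_ActI apply_act_eqI)
       (auto simp: init_act_def store_def tape_act_keep nt_def reg_def str)
  have 2: "exec nt sy x read_input (0, (store ((\<lambda>_. 0)(0 := 0)))(0 := strokes (Suc m)))
      (0, store ((\<lambda>_. 0)(0 := Suc m)))"
    using exec_read_input[of x 0 "Suc m"] by simp
  have 3: "exec nt sy x (dec_prog 0) (0, store ((\<lambda>_. 0)(0 := Suc m))) (0, store ((\<lambda>_. 0)(0 := m)))"
    using exec_dec[of 0 x 0 "(\<lambda>_. 0)(0 := Suc m)"] N by simp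
  have 4: "exec nt sy x (expr_prog 1 e) (0, store ((\<lambda>_. 0)(0 := m)))
     (0, store ((\<lambda>_. 0)(0 := m, 1 := ?v)))"
    using e by (intro exec_expr) auto
  let ?T' = "(store ((\<lambda>_. 0)(0 := m, 1 := ?v)))(0 := (if ?v = 0 then blank else blank(0 := 1)))"
  have bo: "tape_act sy (Some (Suc 0), Stay) blank = blank(0 := Suc 0)"
    by (auto simp: tape_act_def written_def blank_def sy_def fun_eq_iff)
  have 5: "exec nt sy x (Act (\<lambda>b s. output_act s)) (0, store ((\<lambda>_. 0)(0 := m, 1 := ?v))) (0, ?T')"
  proof (rule exec_ActI)
    have s: "scanned nt (store ((\<lambda>_. 0)(0 := m, 1 := ?v))) (reg + 1) = (if ?v = 0 then 2 else 0)"
      using N scanned_store[of 1 "(\<lambda>_. 0)(0 := m, 1 := ?v)"] by simp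
    have oa: "output_act (scanned nt (store ((\<lambda>_. 0)(0 := m, 1 := ?v)))) =
       (Stay, \<lambda>i. if i = 0 \<and> ?v \<noteq> 0 then (Some 1, Stay) else (None, Stay))"
      unfolding output_act_def s by auto
    show "apply_act nt sy (output_act (scanned nt (store ((\<lambda>_. 0)(0 := m, 1 := ?v)))))
       (0, store ((\<lambda>_. 0)(0 := m, 1 := ?v))) = (0, ?T')"
      unfolding oa using N bo
      by (intro apply_act_eqI) (auto simp: tape_act_keep store_def nt_def)
  qed
  have "exec nt sy x (main_prog e) (0, ?T) (0, ?T')"
    unfolding main_prog_def by (rule exec_Seq[OF 1 exec_Seq[OF 2 exec_Seq[OF 3 exec_Seq[OF 4 5]]]])
  from compiled_yields[OF this, of "[m]"] N
  have "otm_yields (compiled nt sy (main_prog e)) x [m] (card {j. ?T' 0 j = 1})"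
    by (auto simp: nt_def blank_def)
  moreover have "card {j. ?T' 0 j = 1} = of_bool (?v \<noteq> 0)"
    by (auto simp: blank_def)
  ultimately show ?thesis by simp
qed

lemma computable_main:
  assumes "fits kR N 1 e"
  shows "computable_functional (\<lambda>x m. eval (R x) g 1 e ((\<lambda>_. 0)(0 := m)) \<noteq> 0)"
  unfolding computable_functional_def
  using compiled_main_yields[OF assms] valid_compiled[of nt sy "main_prog e"]
  by (intro exI[of _ "compiled nt sy (main_prog e)"]) (auto simp: nt_def sy_def reg_def)

end

section \<open>Lanes\<close>

type_synonym matrix = "nat \<Rightarrow> nat \<Rightarrow> nat \<Rightarrow> nat \<Rightarrow> bool"

text \<open>Finite approximation to the failure of all \<open>k \<le> K\<close>: stage
  \<open>l\<close> bounds the search for \<open>j\<close>, and \<open>c\<close> bounds the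
  candidates \<open>i\<close> that have been ruled out so far.\<close>

definition refuted :: "matrix \<Rightarrow> nat \<Rightarrow> nat \<Rightarrow> nat \<Rightarrow> nat \<Rightarrow> bool" where
  "refuted R K h c l \<longleftrightarrow> (\<forall>k\<le>K. \<exists>m\<le>h. \<forall>i\<le>c. \<exists>j\<le>l. \<not> R k m i j)"

text \<open>The stage \<open>l\<close> is the least one from \<open>c\<close> on; the disjunct
  \<open>c = l\<close> covers refutations available earlier. Starting at \<open>c\<close> makes the
  stages unbounded when every \<open>c\<close> gets refuted.\<close>

definition dip :: "matrix \<Rightarrow> nat \<Rightarrow> nat \<Rightarrow> nat \<Rightarrow> bool" where
  "dip R K h l \<longleftrightarrow> (\<exists>K'\<le>h. K \<le> K' \<and>
     (\<exists>c\<le>l. refuted R K' h c l \<and> (c = l \<or> \<not> refuted R K' h c (l - 1))))"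

text \<open>A dip \<open>(h, l)\<close> contributes the minimum of \<open>l - h\<close> and
  \<open>t - h - l\<close> to the depth: nothing up to column \<open>h + l\<close>, then one more in
  each column up to \<open>2 * l\<close>, and the constant \<open>l - h\<close> from there
  on.\<close>

definition depth_ge :: "matrix \<Rightarrow> nat \<Rightarrow> nat \<Rightarrow> nat \<Rightarrow> bool" where
  "depth_ge R K t s \<longleftrightarrow> (\<exists>h\<le>t. \<exists>l\<le>t. dip R K h l \<and> s + h \<le> l \<and> s + h + l \<le> t)"

text \<open>Bounded formula for the graph of \<open>depth\<close>, the form that expressions can
  evaluate; it relies on \<open>depth_ge\<close> being downward closed in \<open>s\<close>.\<close>

definition depth_is :: "matrix \<Rightarrow> nat \<Rightarrow> nat \<Rightarrow> nat \<Rightarrow> bool" where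
  "depth_is R K t s \<longleftrightarrow> (s = 0 \<or> depth_ge R K t s) \<and> \<not> depth_ge R K t (Suc s)"

definition depth :: "matrix \<Rightarrow> nat \<Rightarrow> nat \<Rightarrow> nat" where
  "depth R K t = (GREATEST s. s = 0 \<or> depth_ge R K t s)"

lemma refuted_mono:
  "refuted R K h c l \<Longrightarrow> l \<le> l' \<Longrightarrow> refuted R K h c l'"
  unfolding refuted_def by (meson le_trans)

text \<open>If \<open>i\<close> works for \<open>m\<close>, then no \<open>c \<ge> i\<close> is
  refuted through \<open>m\<close>. For fixed \<open>h\<close> only finitely many \<open>m\<close>
  are involved, so \<open>c\<close> is bounded; \<open>K'\<close> is bounded by \<open>h\<close>,
  and each pair yields at most one stage.\<close>

lemma finite_dips:
  assumes "\<And>m. \<exists>i. \<forall>j. R K m i j"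
  shows "finite {l. dip R K h l}"
proof -
  from assms obtain I where I: "\<And>m j. R K m (I m) j" by metis
  define C where "C = Max (I ` {..h})"
  have C: "I m \<le> C" if "m \<le> h" for m using that by (simp add: C_def)
  have small: "c < C" if ref: "refuted R K' h c l" and "K \<le> K'" for K' c l
  proof (rule ccontr)
    assume "\<not> c < C"
    from ref \<open>K \<le> K'\<close> obtain m where "m \<le> h" "\<forall>i\<le>c. \<exists>j\<le>l. \<not> R K m i j"
      unfolding refuted_def by blast
    moreover have "I m \<le> c" using C[OF \<open>m \<le> h\<close>] \<open>\<not> c < C\<close> by simp
    ultimately show False using I by blast
  qed
  let ?E = "\<lambda>K' c. {l. c \<le> l \<and> refuted R K' h c l \<and> (c = l \<or> \<not> refuted R K' h c (l - 1))}"
  \<comment> \<open>A refutation persists at later stages, so the same pair cannot have two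
    different least stages.\<close>
  have fin: "finite (?E K' c)" for K' c
  proof -
    have less: False if l: "l \<in> ?E K' c" "l' \<in> ?E K' c" "l < l'" for l l'
    proof -
      from l have "refuted R K' h c l" "\<not> refuted R K' h c (l' - 1)" by auto
      with refuted_mono[of R K' h c l "l' - 1"] l(3) show False by simp
    qed
    have eq: "l = l'" if "l \<in> ?E K' c" "l' \<in> ?E K' c" for l l'
      using less[OF that] less[OF that(2,1)] by (cases l l' rule: linorder_cases) auto
    show ?thesis
    proof (cases "?E K' c = {}")
      case False
      then obtain l where "l \<in> ?E K' c" by blast
      then have "?E K' c \<subseteq> {l}" using eq by blast
      then show ?thesis using finite_subset by blast
    qed (metis finite.emptyI)
  qed
  have "{l. dip R K h l} \<subseteq> (\<Union>K'\<in>{..h}. \<Union>c\<in>{..<C}. ?E K' c)"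
    using small unfolding dip_def by fastforce
  then show ?thesis by (rule finite_subset) (intro finite_UN_I finite_atMost finite_lessThan fin)
qed

text \<open>Choose a failing \<open>m\<close> for each \<open>k \<le> K\<close> and \<open>h\<close>
  above all of them. For each \<open>c\<close> only finitely many pairs \<open>(k, i)\<close> have
  to be refuted, so a common stage exists, and the least one from \<open>c\<close> on is a
  dip.\<close>

lemma infinite_dips:
  assumes "\<And>k. k \<le> K \<Longrightarrow> \<exists>m. \<forall>i. \<exists>j. \<not> R k m i j"
  shows "\<exists>h. infinite {l. dip R K h l}"
proof -
  from assms obtain M where M: "\<And>k i. k \<le> K \<Longrightarrow> \<exists>j. \<not> R k (M k) i j" by metis
  from M obtain J where J: "\<And>k i. k \<le> K \<Longrightarrow> \<not> R k (M k) i (J k i)" by metis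
  \<comment> \<open>The value \<open>K\<close> is included because the dips are obtained with
    \<open>K' = K\<close>, which must not exceed \<open>h\<close>.\<close>
  define h where "h = max K (Max (M ` {..K}))"
  have h: "M k \<le> h" if "k \<le> K" for k
    using that unfolding h_def by (intro max.coboundedI2) simp
  have ev: "\<exists>l\<ge>c. refuted R K h c l" for c
  proof -
    define L where "L = max c (Max ((\<lambda>(k, i). J k i) ` ({..K} \<times> {..c})))"
    have "J k i \<le> L" if "k \<le> K" "i \<le> c" for k i
      using that unfolding L_def by (intro max.coboundedI2 Max_ge) auto
    then have "refuted R K h c L" unfolding refuted_def using h J by blast
    then show ?thesis unfolding L_def by (metis max.cobounded1)
  qed
  have "\<exists>l\<ge>c. dip R K h l" for c
  proof -
    define l where "l = (LEAST l. c \<le> l \<and> refuted R K h c l)"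
    have l: "c \<le> l" "refuted R K h c l"
      using LeastI_ex[of "\<lambda>l. c \<le> l \<and> refuted R K h c l"] ev unfolding l_def by auto
    have "c = l \<or> \<not> refuted R K h c (l - 1)"
    proof (rule ccontr)
      assume "\<not> (c = l \<or> \<not> refuted R K h c (l - 1))"
      then have "c \<le> l - 1" "refuted R K h c (l - 1)" "l - 1 < l" using l by auto
      then show False using not_less_Least[of "l - 1" "\<lambda>l. c \<le> l \<and> refuted R K h c l"]
        unfolding l_def by blast
    qed
    then have "dip R K h l" unfolding dip_def using l by (intro exI[of _ K]) (auto simp: h_def)
    then show ?thesis using l by blast
  qed
  then show ?thesis unfolding infinite_nat_iff_unbounded_le by blast
qed

section \<open>The depth as a function of lane and column\<close>

lemma dip_antimono: "dip R K' h l \<Longrightarrow> K \<le> K' \<Longrightarrow> dip R K h l"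
  unfolding dip_def using le_trans by blast

lemma depth_ge_bound: "depth_ge R K t s \<Longrightarrow> 2 * s \<le> t"
  unfolding depth_ge_def by auto

lemma depth_ge_depth: "depth R K t = 0 \<or> depth_ge R K t (depth R K t)"
  unfolding depth_def
  by (rule GreatestI_nat[of "\<lambda>s. s = 0 \<or> depth_ge R K t s" 0 t]) (auto dest: depth_ge_bound)

lemma depth_greatest: "depth_ge R K t s \<Longrightarrow> s \<le> depth R K t"
  unfolding depth_def
  by (rule Greatest_le_nat[of "\<lambda>s. s = 0 \<or> depth_ge R K t s" s t]) (auto dest: depth_ge_bound)

lemma depth_ge_le: "depth_ge R K t s \<Longrightarrow> s' \<le> s \<Longrightarrow> depth_ge R K t s'"
  unfolding depth_ge_def by (meson add_le_mono1 le_trans)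

lemma depth_is_iff: "depth_is R K t s \<longleftrightarrow> depth R K t = s"
proof
  assume "depth_is R K t s"
  then show "depth R K t = s"
    using depth_ge_depth[of R K t] depth_greatest[of R K t s] depth_ge_le[of R K t "depth R K t" "Suc s"]
    unfolding depth_is_def by (metis le0 le_antisym not_less_eq_eq)
next
  assume "depth R K t = s"
  then show "depth_is R K t s"
    using depth_ge_depth[of R K t] depth_greatest[of R K t "Suc s"] unfolding depth_is_def by auto
qed

lemma depth_le: "2 * depth R K t \<le> t"
  using depth_ge_depth[of R K t] depth_ge_bound by fastforce

lemma depth_0 [simp]: "depth R K 0 = 0"
  using depth_le[of R K 0] by simp

lemma depth_antimono: "K \<le> K' \<Longrightarrow> depth R K' t \<le> depth R K t"
proof -
  assume K: "K \<le> K'"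
  have "depth_ge R K t s" if "depth_ge R K' t s" for s
    using that K dip_antimono unfolding depth_ge_def by blast
  then show ?thesis using depth_ge_depth[of R K' t] depth_greatest by fastforce
qed

text \<open>The next column relaxes \<open>s + h + l \<le> t\<close> by one, so the depth stays or
  grows by one: the lane goes on to the northeast or to the southeast neighbour.\<close>

lemma depth_Suc: "depth R K t \<le> depth R K (Suc t)" "depth R K (Suc t) \<le> Suc (depth R K t)"
proof -
  have "depth_ge R K (Suc t) s" if "depth_ge R K t s" for s
    using that unfolding depth_ge_def by (meson le_SucI)
  then show "depth R K t \<le> depth R K (Suc t)"
    using depth_ge_depth[of R K t] depth_greatest by fastforce
  have "depth_ge R K t s" if s: "depth_ge R K (Suc t) (Suc s)" for s
  proof -
    obtain h l where "dip R K h l" "Suc s + h \<le> l" "Suc s + h + l \<le> Suc t"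
      using s unfolding depth_ge_def by blast
    then show ?thesis unfolding depth_ge_def by (intro exI[of _ h] conjI exI[of _ l]) auto
  qed
  then show "depth R K (Suc t) \<le> Suc (depth R K t)"
    using depth_ge_depth[of R K "Suc t"] depth_greatest[of R K t] by (metis Suc_le_mono not0_implies_Suc zero_le)
qed

text \<open>The factor \<open>2\<close> keeps consecutive lanes at least two rows apart in each
  column. Through \<open>nat\<close> the depth is zero in negative columns, where the lane is a
  straight diagonal.\<close>

definition lane :: "matrix \<Rightarrow> nat \<Rightarrow> int \<Rightarrow> int" where
  "lane R K t = 2 * int K - int (depth R K (nat t))"

definition black :: "matrix \<Rightarrow> int \<times> int \<Rightarrow> bool" where
  "black R = (\<lambda>(t, b). \<exists>K. b = lane R K t)"

section \<open>Paths of black tiles\<close>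

definition neighbours :: "int \<times> int \<Rightarrow> int \<times> int \<Rightarrow> bool" where
  "neighbours s t \<longleftrightarrow> (fst t - fst s, snd t - snd s) \<in> {(1, 0), (0, 1), (-1, 1), (-1, 0), (0, -1), (1, -1)}"

lemma lane_Suc: "lane R K (t + 1) = lane R K t \<or> lane R K (t + 1) = lane R K t - 1"
proof (cases "0 \<le> t")
  case True
  then have "nat (t + 1) = Suc (nat t)" by simp
  then show ?thesis using depth_Suc[of R K "nat t"] unfolding lane_def by auto
next
  case False
  then show ?thesis unfolding lane_def by simp
qed

lemma lane_gap: "K < K' \<Longrightarrow> lane R K t + 2 \<le> lane R K' t"
  using depth_antimono[of K K' R "nat t"] unfolding lane_def by simp

text \<open>Within a column lanes are two rows apart. To the next column a lane keeps its row or
  goes down by one, and these are exactly the two rows of the neighbours there; any other lane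
  passes above or below both of them.\<close>

lemma lane_neighbours:
  assumes "neighbours (t, lane R K t) (t', lane R K' t')"
  shows "K' = K" and "\<bar>t' - t\<bar> = 1"
proof -
  have d: "t' = t + 1 \<and> (lane R K' t' = lane R K t \<or> lane R K' t' = lane R K t - 1) \<or>
     t' = t \<and> \<bar>lane R K' t' - lane R K t\<bar> = 1 \<or>
     t = t' + 1 \<and> (lane R K t = lane R K' t' \<or> lane R K t = lane R K' t' - 1)"
    using assms unfolding neighbours_def by auto
  show "K' = K"
  proof (rule ccontr)
    assume "K' \<noteq> K"
    then consider "K < K'" | "K' < K" by linarith
    then show False
    proof cases
      case 1
      show False using d lane_gap[OF 1, of R t] lane_gap[OF 1, of R t'] lane_Suc[of R K t] lane_Suc[of R K' t']
          lane_Suc[of R K t'] lane_Suc[of R K' t]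
        by (smt (verit))
    next
      case 2
      show False using d lane_gap[OF 2, of R t] lane_gap[OF 2, of R t'] lane_Suc[of R K t] lane_Suc[of R K' t']
          lane_Suc[of R K t'] lane_Suc[of R K' t]
        by (smt (verit))
    qed
  qed
  then show "\<bar>t' - t\<bar> = 1" using d by auto
qed

lemma neighbours_lane_Suc:
  "neighbours (t, lane R K t) (t + 1, lane R K (t + 1))"
  "neighbours (t + 1, lane R K (t + 1)) (t, lane R K t)"
  using lane_Suc[of R K t] unfolding neighbours_def by auto

text \<open>A discrete intermediate value theorem, which forces a path along a lane to enter the
  column where a dip reaches its bottom.\<close>

lemma visits_every_value:
  fixes u :: "nat \<Rightarrow> int"
  assumes step: "\<And>i. \<bar>u (Suc i) - u i\<bar> = 1" and le: "u i0 \<le> v" and lim: "\<exists>i\<ge>i0. v \<le> u i"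
  shows "\<exists>i\<ge>i0. u i = v"
proof -
  obtain i where i: "i0 \<le> i" "v \<le> u i" using lim by blast
  from i show ?thesis
  proof (induction i rule: dec_induct)
    case base
    then show ?case using le by (intro exI[of _ i0]) auto
  next
    case (step i)
    then show ?case using assms(1)[of i] by (cases "v \<le> u i") (auto intro!: exI[of _ "Suc i"])
  qed
qed

definition lattice_win :: "(int \<times> int \<Rightarrow> bool) \<Rightarrow> bool" where
  "lattice_win B \<longleftrightarrow> (\<exists>t s. (\<forall>i. B (t i) \<and> neighbours (t i) (t (Suc i))) \<and>
     (\<forall>i. B (s i) \<and> neighbours (s i) (s (Suc i))) \<and> t 0 = s 0 \<and>
     (\<forall>n. \<exists>i. \<forall>j\<ge>i. n \<le> fst (t j) \<and> n \<le> fst (t j) + 2 * snd (t j)) \<and>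
     (\<forall>n. \<exists>i. \<forall>j\<ge>i. fst (s j) \<le> n \<and> fst (s j) + 2 * snd (s j) \<le> n))"

lemma lattice_win_black:
  "lattice_win (black R) \<longleftrightarrow> (\<exists>k. \<forall>m. \<exists>i. \<forall>j. R k m i j)"
proof
  assume "lattice_win (black R)"
  then obtain t where t: "\<And>i. black R (t i)" "\<And>i. neighbours (t i) (t (Suc i))"
     and lim: "\<And>n. \<exists>i. \<forall>j\<ge>i. n \<le> fst (t j) \<and> n \<le> fst (t j) + 2 * snd (t j)"
    unfolding lattice_win_def by blast
  from t(1)[of 0] obtain K where K: "snd (t 0) = lane R K (fst (t 0))"
    by (auto simp: black_def split: prod.splits)
  have on: "snd (t i) = lane R K (fst (t i))" for i
  proof (induction i)
    case (Suc i)
    obtain K' where K': "snd (t (Suc i)) = lane R K' (fst (t (Suc i)))"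
      using t(1)[of "Suc i"] by (auto simp: black_def split: prod.splits)
    have "neighbours (fst (t i), lane R K (fst (t i))) (fst (t (Suc i)), lane R K' (fst (t (Suc i))))"
      using t(2)[of i] Suc.IH K' by (metis prod.collapse)
    from lane_neighbours(1)[OF this] K' show ?case by simp
  qed (rule K)
  have step: "\<bar>fst (t (Suc i)) - fst (t i)\<bar> = 1" for i
    using lane_neighbours(2)[of "fst (t i)" R K "fst (t (Suc i))" K] t(2)[of i] on[of i] on[of "Suc i"]
    by (metis prod.collapse)
  show "\<exists>k. \<forall>m. \<exists>i. \<forall>j. R k m i j"
  proof (rule ccontr)
    assume "\<nexists>k. \<forall>m. \<exists>i. \<forall>j. R k m i j"
    then obtain h where inf: "infinite {l. dip R K h l}" using infinite_dips[of K R] by blast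
    \<comment> \<open>The summand \<open>4 * int K\<close> is the height of the lane at column
      \<open>0\<close>; from \<open>i0\<close> on the path is above the bottom of every dip with
      this \<open>h\<close>.\<close>
    obtain i0 where i0: "\<And>j. i0 \<le> j \<Longrightarrow> 2 * int h + 4 * int K + 1 \<le> fst (t j) + 2 * snd (t j)"
      using lim[of "2 * int h + 4 * int K + 1"] by blast
    \<comment> \<open>The dip is taken so late that its column \<open>2 * l\<close> is not left of
      the path at time \<open>i0\<close>, so the path still has to visit it.\<close>
    obtain l where l: "dip R K h l" "max h (nat (fst (t i0))) \<le> l"
      using inf unfolding infinite_nat_iff_unbounded_le by blast
    have "\<exists>i\<ge>i0. 2 * int l \<le> fst (t i)"
      using lim[of "2 * int l"] by (meson nat_le_linear)
    moreover have "fst (t i0) \<le> 2 * int l" using l by linarith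
    ultimately obtain i where i: "i0 \<le> i" "fst (t i) = 2 * int l"
      using visits_every_value[of "\<lambda>i. fst (t i)", OF step] by blast
    have "depth_ge R K (2 * l) (l - h)"
      unfolding depth_ge_def using l by (intro exI[of _ h] conjI exI[of _ l]) auto
    then have "l - h \<le> depth R K (2 * l)" by (rule depth_greatest)
    moreover have "nat (2 * int l) = 2 * l" by simp
    ultimately have "lane R K (2 * int l) \<le> 2 * int K - (int l - int h)"
      unfolding lane_def by simp
    then show False using i0[OF i(1)] on[of i] i(2) by simp
  qed
next
  assume "\<exists>k. \<forall>m. \<exists>i. \<forall>j. R k m i j"
  then obtain K where K: "\<And>m. \<exists>i. \<forall>j. R K m i j" by blast
  define t where "t i = (int i, lane R K (int i))" for i
  define s where "s i = (- int i, lane R K (- int i))" for i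
  have "neighbours (t i) (t (Suc i))" for i
    using neighbours_lane_Suc(1)[of "int i"] unfolding t_def by (simp add: add.commute)
  moreover have "neighbours (s i) (s (Suc i))" for i
    using neighbours_lane_Suc(2)[of "- int (Suc i)"] unfolding s_def by simp
  moreover have "\<exists>i. \<forall>j\<ge>i. n \<le> fst (t j) \<and> n \<le> fst (t j) + 2 * snd (t j)" for n
  proof -
    have "finite (\<Union>h\<in>{..nat n}. {l. dip R K h l})" using finite_dips[of R K] K by auto
    then obtain L where L: "\<And>h l. h \<le> nat n \<Longrightarrow> dip R K h l \<Longrightarrow> l < L"
      unfolding finite_nat_set_iff_bounded by auto
    \<comment> \<open>A dip with \<open>h \<le> nat n\<close> has depth less than \<open>L\<close>,
      which the column outweighs. For the other dips the two bounds on the depth add up to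
      \<open>2 * depth R K j + 2 * h \<le> int j\<close>, leaving a height of at least
      \<open>2 * h\<close>.\<close>
    have "n \<le> int j - 2 * int (depth R K j)" if j: "nat n + 2 * L \<le> j" for j
    proof (cases "depth R K j = 0")
      case False
      then obtain h l where hl: "dip R K h l" "depth R K j + h \<le> l" "depth R K j + h + l \<le> j"
        using depth_ge_depth[of R K j] unfolding depth_ge_def by auto
      show ?thesis
      proof (cases "h \<le> nat n")
        case True
        then have "l < L" using L hl by blast
        then show ?thesis using hl j by linarith
      next
        case False
        then show ?thesis using hl by linarith
      qed
    qed (use j in auto)
    then have "n \<le> int j \<and> n \<le> int j + 2 * lane R K (int j)" if "nat n + 2 * L \<le> j" for j
      using that by (fastforce simp: lane_def)
    then show ?thesis by (intro exI[of _ "nat n + 2 * L"]) (simp add: t_def)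
  qed
  \<comment> \<open>On these columns the depth is zero and the height is the column plus
    \<open>4 * int K\<close>.\<close>
  moreover have "\<exists>i. \<forall>j\<ge>i. fst (s j) \<le> n \<and> fst (s j) + 2 * snd (s j) \<le> n" for n
    by (intro exI[of _ "nat (4 * int K - n)"]) (auto simp: s_def lane_def)
  ultimately show "lattice_win (black R)"
    unfolding lattice_win_def
    by (intro exI[of _ t] exI[of _ s]) (auto simp: black_def t_def s_def)
qed

section \<open>The coloring as an expression\<close>

text \<open>Expressions are built in higher-order abstract syntax as functions of the depth at which they are
  placed; a world is a depth together with an environment, and its extensions keep the variables below
  the depth.\<close>

type_synonym world = "nat \<times> (nat \<Rightarrow> nat)"

definition extends :: "world \<Rightarrow> world \<Rightarrow> bool" where
  "extends w w' \<longleftrightarrow> fst w \<le> fst w' \<and> (\<forall>v<fst w. snd w' v = snd w v)"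

lemma extends_refl: "extends w w"
  by (simp add: extends_def)

lemma extends_trans: "extends w w' \<Longrightarrow> extends w' w'' \<Longrightarrow> extends w w''"
  by (auto simp: extends_def)

lemma extends_upd: "extends w w' \<Longrightarrow> extends w (Suc (fst w'), (snd w')(fst w' := x))"
  by (auto simp: extends_def)

lemma extends_upd2: "extends w w' \<Longrightarrow>
  extends w (Suc (Suc (fst w')), (snd w')(fst w' := x, Suc (fst w') := y))"
  by (auto simp: extends_def)

abbreviation "VarE v \<equiv> (\<lambda>d::nat. Var v)"
abbreviation "ZeroE \<equiv> (\<lambda>d::nat. Zero)"
abbreviation "SuccE a \<equiv> (\<lambda>d::nat. Succ (a d))"
abbreviation "PredE a \<equiv> (\<lambda>d::nat. Pred (a d))"

definition PlusE :: "(nat \<Rightarrow> expr) \<Rightarrow> (nat \<Rightarrow> expr) \<Rightarrow> nat \<Rightarrow> expr" where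
  "PlusE a b = (\<lambda>d. For (a d) (b (Suc d)) (Succ (Var d)))"

definition MinusE :: "(nat \<Rightarrow> expr) \<Rightarrow> (nat \<Rightarrow> expr) \<Rightarrow> nat \<Rightarrow> expr" where
  "MinusE a b = (\<lambda>d. For (a d) (b (Suc d)) (Pred (Var d)))"

definition TriangleE :: "(nat \<Rightarrow> expr) \<Rightarrow> nat \<Rightarrow> expr" where
  "TriangleE a = (\<lambda>d. For Zero (a (Suc d)) (PlusE (VarE d) (SuccE (VarE (Suc d))) (Suc (Suc d))))"

text \<open>Loops serve as conditionals: the initial \<open>1\<close> is overwritten by
  \<open>0\<close> if the body is run at all. In \<open>AndE\<close> the initial \<open>0\<close> is
  likewise replaced by a value of \<open>b\<close> if \<open>a\<close> is nonzero.\<close>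

definition NotE :: "(nat \<Rightarrow> expr) \<Rightarrow> nat \<Rightarrow> expr" where
  "NotE a = (\<lambda>d. For (Succ Zero) (a (Suc d)) Zero)"

definition AndE :: "(nat \<Rightarrow> expr) \<Rightarrow> (nat \<Rightarrow> expr) \<Rightarrow> nat \<Rightarrow> expr" where
  "AndE a b = (\<lambda>d. For Zero (a (Suc d)) (b (Suc (Suc d))))"

definition OrE :: "(nat \<Rightarrow> expr) \<Rightarrow> (nat \<Rightarrow> expr) \<Rightarrow> nat \<Rightarrow> expr" where
  "OrE a b = NotE (AndE (NotE a) (NotE b))"

definition LeE :: "(nat \<Rightarrow> expr) \<Rightarrow> (nat \<Rightarrow> expr) \<Rightarrow> nat \<Rightarrow> expr" where
  "LeE a b = NotE (MinusE a b)"

definition EqE :: "(nat \<Rightarrow> expr) \<Rightarrow> (nat \<Rightarrow> expr) \<Rightarrow> nat \<Rightarrow> expr" where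
  "EqE a b = AndE (LeE a b) (LeE b a)"

definition ExE :: "(nat \<Rightarrow> expr) \<Rightarrow> (nat \<Rightarrow> nat \<Rightarrow> expr) \<Rightarrow> nat \<Rightarrow> expr" where
  "ExE a \<phi> = (\<lambda>d. Find (Succ (a d)) (\<phi> d (Suc d)))"

definition AllE :: "(nat \<Rightarrow> expr) \<Rightarrow> (nat \<Rightarrow> nat \<Rightarrow> expr) \<Rightarrow> nat \<Rightarrow> expr" where
  "AllE a \<phi> = NotE (ExE a (\<lambda>v. NotE (\<phi> v)))"

definition refutedE ::
    "(nat \<Rightarrow> expr) \<Rightarrow> (nat \<Rightarrow> expr) \<Rightarrow> (nat \<Rightarrow> expr) \<Rightarrow> (nat \<Rightarrow> expr) \<Rightarrow> nat \<Rightarrow> expr" where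
  "refutedE K h c l = AllE K (\<lambda>k. ExE h (\<lambda>m. AllE c (\<lambda>i. ExE l (\<lambda>j.
     NotE (\<lambda>d. Query [k, m, i, j])))))"

definition dipE :: "(nat \<Rightarrow> expr) \<Rightarrow> (nat \<Rightarrow> expr) \<Rightarrow> (nat \<Rightarrow> expr) \<Rightarrow> nat \<Rightarrow> expr" where
  "dipE K h l = ExE h (\<lambda>K'. AndE (LeE K (VarE K')) (ExE l (\<lambda>c.
     AndE (refutedE (VarE K') h (VarE c) l)
       (OrE (EqE (VarE c) l) (NotE (refutedE (VarE K') h (VarE c) (PredE l)))))))"

definition depth_geE :: "(nat \<Rightarrow> expr) \<Rightarrow> (nat \<Rightarrow> expr) \<Rightarrow> (nat \<Rightarrow> expr) \<Rightarrow> nat \<Rightarrow> expr" where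
  "depth_geE K t s = ExE t (\<lambda>h. ExE t (\<lambda>l. AndE (dipE K (VarE h) (VarE l))
     (AndE (LeE (PlusE s (VarE h)) (VarE l)) (LeE (PlusE (PlusE s (VarE h)) (VarE l)) t))))"

definition depth_isE :: "(nat \<Rightarrow> expr) \<Rightarrow> (nat \<Rightarrow> expr) \<Rightarrow> (nat \<Rightarrow> expr) \<Rightarrow> nat \<Rightarrow> expr" where
  "depth_isE K t s = AndE (OrE (EqE s ZeroE) (depth_geE K t s)) (NotE (depth_geE K t (SuccE s)))"

text \<open>The equation with the triangle number decodes the pair \<open>(a, b)\<close> from
  \<open>G\<close>, and the case distinctions on parity decode integers: an odd \<open>a\<close> is
  a negative column, treated like column \<open>0\<close>, and \<open>u\<close> gives the two forms
  of the row \<open>2 * K - s\<close> according to its sign.\<close>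

definition blackE :: "(nat \<Rightarrow> expr) \<Rightarrow> nat \<Rightarrow> expr" where
  "blackE G = ExE G (\<lambda>a. ExE G (\<lambda>b. AndE (EqE (PlusE (TriangleE (PlusE (VarE a) (VarE b))) (VarE a)) G)
     (ExE G (\<lambda>t. AndE (OrE (EqE (VarE a) (PlusE (VarE t) (VarE t)))
         (AndE (EqE (VarE t) ZeroE) (ExE G (\<lambda>u. EqE (VarE a) (SuccE (PlusE (VarE u) (VarE u)))))))
       (ExE G (\<lambda>K. ExE G (\<lambda>s. AndE (depth_isE (VarE K) (VarE t) (VarE s))
         (ExE G (\<lambda>u. OrE
           (AndE (EqE (VarE b) (PlusE (VarE u) (VarE u)))
             (EqE (PlusE (VarE s) (VarE u)) (PlusE (VarE K) (VarE K))))
           (AndE (EqE (VarE b) (SuccE (PlusE (VarE u) (VarE u))))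
             (EqE (VarE s) (SuccE (PlusE (PlusE (VarE K) (VarE K)) (VarE u))))))))))))))"

section \<open>Semantics of the expressions\<close>

lemma down_loop_Suc: "down_loop (\<lambda>i. Suc) n v = v + n"
  by (induction n arbitrary: v) auto

lemma down_loop_pred: "down_loop (\<lambda>i v. v - Suc 0) n v = v - n"
  by (induction n arbitrary: v) auto

lemma down_loop_triangle: "down_loop (\<lambda>i v. Suc (v + i)) n v = v + triangle n"
  by (induction n arbitrary: v) auto

lemma down_loop_const: "down_loop (\<lambda>i v. f i) n v = (if n = 0 then v else f 0)"
  by (induction n arbitrary: v) (auto split: if_splits)

lemma down_find_iff: "down_find f n \<noteq> 0 \<longleftrightarrow> (\<exists>i<n. f i \<noteq> 0)"
  by (induction n) (auto simp: less_Suc_eq)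

context
  fixes R :: "nat list \<Rightarrow> nat" and g :: "nat \<Rightarrow> nat"
begin

text \<open>Quantifying over all extensions of the world makes a fact about a subexpression usable
  below further binders, where depth and environment have grown; this replaces weakening lemmas for
  de Bruijn levels.\<close>

definition val :: "world \<Rightarrow> (nat \<Rightarrow> expr) \<Rightarrow> nat \<Rightarrow> bool" where
  "val w e x \<longleftrightarrow> (\<forall>w'. extends w w' \<longrightarrow> eval R g (fst w') (e (fst w')) (snd w') = x)"

definition truth :: "world \<Rightarrow> (nat \<Rightarrow> expr) \<Rightarrow> bool \<Rightarrow> bool" where
  "truth w e P \<longleftrightarrow> (\<forall>w'. extends w w' \<longrightarrow> (eval R g (fst w') (e (fst w')) (snd w') \<noteq> 0 \<longleftrightarrow> P))"

lemma valI: "(\<And>d env. extends w (d, env) \<Longrightarrow> eval R g d (e d) env = x) \<Longrightarrow> val w e x"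
  by (auto simp: val_def)

lemma truthI: "(\<And>d env. extends w (d, env) \<Longrightarrow> eval R g d (e d) env \<noteq> 0 \<longleftrightarrow> P) \<Longrightarrow> truth w e P"
  unfolding truth_def by (metis prod.collapse)

lemma valD: "val w e x \<Longrightarrow> extends w (d, env) \<Longrightarrow> eval R g d (e d) env = x"
  by (auto simp: val_def)

lemma truthD: "truth w e P \<Longrightarrow> extends w (d, env) \<Longrightarrow> eval R g d (e d) env \<noteq> 0 \<longleftrightarrow> P"
  unfolding truth_def by (metis fst_conv snd_conv)

lemma val_mono: "val w e x \<Longrightarrow> extends w w' \<Longrightarrow> val w' e x"
  unfolding val_def using extends_trans by blast

lemma val_Zero: "val w ZeroE 0"
  by (rule valI) simp

lemma val_Succ: "val w a x \<Longrightarrow> val w (SuccE a) (Suc x)"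
  by (rule valI) (simp add: valD)

lemma val_Pred: "val w a x \<Longrightarrow> val w (PredE a) (x - 1)"
  by (rule valI) (simp add: valD)

lemma val_Lookup: "val w (VarE v) x \<Longrightarrow> val w (\<lambda>d. Lookup v) (g x)"
  by (rule valI, drule (1) valD) simp

lemma val_Plus: "val w a x \<Longrightarrow> val w b y \<Longrightarrow> val w (PlusE a b) (x + y)"
  by (rule valI) (simp add: PlusE_def valD extends_upd[of w "(_, _)", simplified] down_loop_Suc)

lemma val_Minus: "val w a x \<Longrightarrow> val w b y \<Longrightarrow> val w (MinusE a b) (x - y)"
  by (rule valI) (simp add: MinusE_def valD extends_upd[of w "(_, _)", simplified] down_loop_pred)

lemma val_Triangle: "val w a x \<Longrightarrow> val w (TriangleE a) (triangle x)"
  by (rule valI) (simp add: TriangleE_def PlusE_def valD extends_upd[of w "(_, _)", simplified]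
      down_loop_Suc down_loop_triangle)

lemma truth_Not:
  assumes "truth w a P"
  shows "truth w (NotE a) (\<not> P)"
proof (rule truthI)
  fix d env assume "extends w (d, env)"
  then show "(eval R g d (NotE a d) env \<noteq> 0) = (\<not> P)"
    using truthD[OF assms extends_upd[of w "(d, env)" "Suc 0"]] by (auto simp: NotE_def down_loop_const)
qed

lemma truth_And:
  assumes "truth w a P" "truth w b Q"
  shows "truth w (AndE a b) (P \<and> Q)"
proof (rule truthI)
  fix d env assume e: "extends w (d, env)"
  let ?n = "eval R g (Suc d) (a (Suc d)) (env(d := 0))"
  let ?f = "\<lambda>v i. eval R g (Suc (Suc d)) (b (Suc (Suc d))) (env(d := v, Suc d := i))"
  have a: "?n \<noteq> 0 \<longleftrightarrow> P" using truthD[OF assms(1) extends_upd[of w "(d, env)" 0]] e by simp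
  have b: "?f v i \<noteq> 0 \<longleftrightarrow> Q" for v i
    using truthD[OF assms(2) extends_upd2[of w "(d, env)" v i]] e by simp
  \<comment> \<open>The accumulator changes between the runs of \<open>b\<close>, hence the
    induction over all initial values \<open>v\<close>.\<close>
  have "down_loop (\<lambda>i v. ?f v i) n v \<noteq> 0 \<longleftrightarrow> (if n = 0 then v \<noteq> 0 else Q)" for n v
    by (induction n arbitrary: v) (auto simp: b simp del: neq0_conv)
  then show "(eval R g d (AndE a b d) env \<noteq> 0) = (P \<and> Q)"
    using a by (auto simp: AndE_def)
qed

lemma truth_Or: "truth w a P \<Longrightarrow> truth w b Q \<Longrightarrow> truth w (OrE a b) (P \<or> Q)"
  unfolding OrE_def using truth_Not[OF truth_And[OF truth_Not[of w a P] truth_Not[of w b Q]]] by simp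

lemma truth_val: "val w a x \<Longrightarrow> truth w a (x \<noteq> 0)"
  by (rule truthI) (simp add: valD)

lemma truth_Le: "val w a x \<Longrightarrow> val w b y \<Longrightarrow> truth w (LeE a b) (x \<le> y)"
  unfolding LeE_def using truth_Not[OF truth_val[OF val_Minus[of w a x b y]]] by simp

lemma truth_Eq: "val w a x \<Longrightarrow> val w b y \<Longrightarrow> truth w (EqE a b) (x = y)"
  unfolding EqE_def using truth_And[OF truth_Le[of w a x b y] truth_Le[of w b y a x]]
  by (simp add: order_eq_iff)

lemma truth_Ex:
  assumes a: "val w a n"
    and \<phi>: "\<And>w' v i. extends w w' \<Longrightarrow> val w' (VarE v) i \<Longrightarrow> truth w' (\<phi> v) (P i)"
  shows "truth w (ExE a \<phi>) (\<exists>i\<le>n. P i)"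
proof (rule truthI)
  fix d env assume e: "extends w (d, env)"
  have "eval R g (Suc d) (\<phi> d (Suc d)) (env(d := i)) \<noteq> 0 \<longleftrightarrow> P i" for i
  proof (rule truthD[OF \<phi> extends_refl])
    show "extends w (Suc d, env(d := i))" using extends_upd[OF e] by simp
    show "val (Suc d, env(d := i)) (VarE d) i" by (rule valI) (simp add: extends_def)
  qed
  then show "(eval R g d (ExE a \<phi> d) env \<noteq> 0) = (\<exists>i\<le>n. P i)"
    using valD[OF a e] by (simp add: ExE_def down_find_iff less_Suc_eq_le del: down_find.simps neq0_conv)
qed

lemma truth_All:
  assumes "val w a n"
    and "\<And>w' v i. extends w w' \<Longrightarrow> val w' (VarE v) i \<Longrightarrow> truth w' (\<phi> v) (P i)"
  shows "truth w (AllE a \<phi>) (\<forall>i\<le>n. P i)"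
  unfolding AllE_def using truth_Not[OF truth_Ex[OF assms(1) truth_Not[OF assms(2)]]] by simp

lemma truth_Query:
  assumes "val w (VarE a) x" "val w (VarE b) y" "val w (VarE c) z" "val w (VarE e) u"
  shows "truth w (\<lambda>d. Query [a, b, c, e]) (R [x, y, z, u] \<noteq> 0)"
proof (rule truthI)
  fix d env assume w: "extends w (d, env)"
  show "(eval R g d (Query [a, b, c, e]) env \<noteq> 0) = (R [x, y, z, u] \<noteq> 0)"
    using assms[THEN valD, OF w] by simp
qed

abbreviation "Rm \<equiv> (\<lambda>k m i j. R [k, m, i, j] \<noteq> 0)"

lemma truth_refuted:
  assumes "val w K k" "val w h k1" "val w c k2" "val w l k3"
  shows "truth w (refutedE K h c l) (refuted Rm k k1 k2 k3)"
  unfolding refutedE_def refuted_def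
  by (assumption | rule assms truth_Ex truth_All truth_Not truth_Query |
      (rule val_mono[rotated], assumption))+

lemma truth_dip:
  assumes "val w K k" "val w h k1" "val w l k2"
  shows "truth w (dipE K h l) (dip Rm k k1 k2)"
  unfolding dipE_def dip_def
  by (assumption | rule assms truth_Ex truth_And truth_Or truth_Not truth_Eq truth_Le
      truth_refuted val_Pred |
      (rule val_mono[rotated], assumption))+

lemma truth_depth_ge:
  assumes "val w K k" "val w t k1" "val w s k2"
  shows "truth w (depth_geE K t s) (depth_ge Rm k k1 k2)"
  unfolding depth_geE_def depth_ge_def
  by (assumption | rule assms truth_Ex truth_And truth_Le truth_dip val_Plus |
      (rule val_mono[rotated], assumption))+

lemma truth_depth_is:
  assumes "val w K k" "val w t k1" "val w s k2"
  shows "truth w (depth_isE K t s) (depth_is Rm k k1 k2)"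
  unfolding depth_isE_def depth_is_def
  by (intro truth_And truth_Or truth_Not truth_Eq truth_depth_ge val_Succ val_Zero assms)

definition black_code :: "nat \<Rightarrow> bool" where
  "black_code G \<longleftrightarrow> (\<exists>a\<le>G. \<exists>b\<le>G. triangle (a + b) + a = G \<and>
     (\<exists>t\<le>G. (a = t + t \<or> t = 0 \<and> (\<exists>u\<le>G. a = Suc (u + u))) \<and>
       (\<exists>K\<le>G. \<exists>s\<le>G. depth_is Rm K t s \<and>
         (\<exists>u\<le>G. b = u + u \<and> s + u = K + K \<or> b = Suc (u + u) \<and> s = Suc (K + K + u)))))"

lemma truth_black:
  assumes "val w G x"
  shows "truth w (blackE G) (black_code x)"
  unfolding blackE_def black_code_def
  by (assumption | rule assms truth_Ex truth_And truth_Or truth_Eq truth_depth_is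
      val_Plus val_Triangle val_Succ val_Zero |
      (rule val_mono[rotated], assumption))+

lemma int_decode_eq: "int_decode n = (if even n then int (n div 2) else - int (n div 2) - 1)"
  by (simp add: int_decode_def sum_decode_def)

lemma black_code_iff:
  "black_code G \<longleftrightarrow> black Rm (map_prod int_decode int_decode (prod_decode G))"
proof -
  obtain a b where ab: "prod_decode G = (a, b)" by (cases "prod_decode G")
  then have G: "prod_encode (a, b) = G" by (metis prod_decode_inverse)
  have aG: "a \<le> G" "b \<le> G" using le_prod_encode_1[of a b] le_prod_encode_2[of b a] G by auto
  define t where "t = nat (int_decode a)"
  have t: "a = t' + t' \<or> t' = 0 \<and> (\<exists>u\<le>G. a = Suc (u + u)) \<longleftrightarrow> t' = t" for t'
  proof (cases "even a")
    case True
    then obtain c where "a = 2 * c" by blast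
    then show ?thesis by (auto simp: t_def int_decode_eq) presburger
  next
    case False
    then obtain c where c: "a = 2 * c + 1" by (meson oddE)
    then have "c \<le> G" using aG by simp
    have "\<not> 0 < int_decode a" using False by (auto simp: int_decode_eq)
    then have "t = 0" by (simp add: t_def)
    moreover have "a \<noteq> t' + t'" using c by presburger
    moreover have "\<exists>u\<le>G. a = Suc (u + u)" using c \<open>c \<le> G\<close> by (intro exI[of _ c]) auto
    ultimately show ?thesis by auto
  qed
  have tG: "t \<le> G" using aG by (auto simp: t_def int_decode_eq)
  have u: "(\<exists>u\<le>G. b = u + u \<and> s + u = K + K \<or> b = Suc (u + u) \<and> s = Suc (K + K + u)) \<longleftrightarrow>
      int_decode b = 2 * int K - int s" for s K
  proof (cases "even b")
    case True
    then obtain c where "b = 2 * c" by blast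
    then show ?thesis using aG by (auto simp: int_decode_eq intro!: exI[of _ c]) presburger+
  next
    case False
    then obtain c where "b = 2 * c + 1" by (meson oddE)
    then show ?thesis using aG by (auto simp: int_decode_eq intro!: exI[of _ c]) presburger+
  qed
  have "black_code G \<longleftrightarrow> (\<exists>a'\<le>G. \<exists>b'\<le>G. prod_encode (a', b') = prod_encode (a, b) \<and>
     (\<exists>t\<le>G. (a' = t + t \<or> t = 0 \<and> (\<exists>u\<le>G. a' = Suc (u + u))) \<and>
       (\<exists>K\<le>G. \<exists>s\<le>G. depth Rm K t = s \<and>
         (\<exists>u\<le>G. b' = u + u \<and> s + u = K + K \<or> b' = Suc (u + u) \<and> s = Suc (K + K + u)))))"
    unfolding black_code_def depth_is_iff G by (simp add: prod_encode_def)
  also have "\<dots> \<longleftrightarrow> (\<exists>t\<le>G. (a = t + t \<or> t = 0 \<and> (\<exists>u\<le>G. a = Suc (u + u))) \<and>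
       (\<exists>K\<le>G. \<exists>s\<le>G. depth Rm K t = s \<and>
         (\<exists>u\<le>G. b = u + u \<and> s + u = K + K \<or> b = Suc (u + u) \<and> s = Suc (K + K + u))))"
    using aG by auto
  also have "\<dots> \<longleftrightarrow> (\<exists>K\<le>G. \<exists>s\<le>G. depth Rm K t = s \<and> int_decode b = 2 * int K - int s)"
    unfolding t u using tG by blast
  also have "\<dots> \<longleftrightarrow> (\<exists>K. int_decode b = 2 * int K - int (depth Rm K t))"
  proof -
    have s: "depth Rm K t \<le> G" for K using depth_le[of Rm K t] tG by linarith
    \<comment> \<open>Both the decoded row and the depth are at most \<open>G\<close>, so
      \<open>2 * K \<le> 2 * G\<close>.\<close>
    have "K \<le> G" if "int_decode b = 2 * int K - int (depth Rm K t)" for K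
    proof -
      have "int_decode b \<le> int b" by (auto simp: int_decode_eq)
      then show ?thesis using that s[of K] aG by linarith
    qed
    then show ?thesis using s by blast
  qed
  also have "\<dots> \<longleftrightarrow> black Rm (map_prod int_decode int_decode (prod_decode G))"
    by (simp add: ab black_def lane_def t_def)
  finally show ?thesis .
qed

lemma eval_black:
  "eval R g 1 (blackE (\<lambda>d. Lookup 0) 1) ((\<lambda>_. 0)(0 := m)) \<noteq> 0 \<longleftrightarrow>
     black Rm (map_prod int_decode int_decode (prod_decode (g m)))"
proof -
  let ?w = "(1, (\<lambda>_. 0)(0 := m))"
  have "val ?w (VarE 0) m" by (rule valI) (simp add: extends_def)
  from truthD[OF truth_black[OF val_Lookup[OF this]] extends_refl] show ?thesis
    by (simp only: black_code_iff)
qed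

end

text \<open>Here \<open>4\<close> is the arity of \<open>R\<close>, the depth is \<open>1\<close>
  because register \<open>0\<close> holds the input, and \<open>60\<close> registers accommodate the
  nesting of binders and the scratch registers.\<close>

lemma fits_black: "fits 4 60 1 (blackE (\<lambda>d. Lookup 0) 1)"
  by (simp add: blackE_def depth_isE_def depth_geE_def dipE_def refutedE_def AllE_def ExE_def EqE_def LeE_def
      OrE_def AndE_def NotE_def TriangleE_def MinusE_def PlusE_def)

lemma computable_black:
  assumes R: "computable_rel 4 R" and g: "computable_fun g"
  shows "computable_functional (\<lambda>x n. black (\<lambda>k m i j. R x [k, m, i, j])
    (map_prod int_decode int_decode (prod_decode (g n))))"
proof -
  obtain MR where MR: "valid_otm MR" "\<And>x as. length as = 4 \<Longrightarrow> otm_yields MR x as (of_bool (R x as))"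
    using R unfolding computable_rel_def by blast
  obtain MG where MG: "valid_otm MG" "\<And>n. otm_yields MG (\<lambda>_. False) [n] (g n)"
    using g unfolding computable_fun_def by blast
  interpret two_machines MR MG 60 4 "\<lambda>x as. of_bool (R x as)" g
    using MR MG by unfold_locales auto
  show ?thesis
    using computable_main[OF fits_black] unfolding eval_black by simp
qed

section \<open>Geometry of the tiling\<close>

definition hex_vertex :: "real \<Rightarrow> real \<times> real \<Rightarrow> nat \<Rightarrow> real \<times> real" where
  "hex_vertex r c k = c + (r * cos (real k * pi / 3), r * sin (real k * pi / 3))"

lemma trig_sixths:
  "cos (2 * pi / 3) = - 1 / 2" "sin (2 * pi / 3) = sqrt 3 / 2"
  "cos (4 * pi / 3) = - 1 / 2" "sin (4 * pi / 3) = - sqrt 3 / 2"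
  "cos (5 * pi / 3) = 1 / 2" "sin (5 * pi / 3) = - sqrt 3 / 2"
proof -
  have e: "2 * pi / 3 = pi - pi / 3" "4 * pi / 3 = pi / 3 + pi" "5 * pi / 3 = 2 * pi - pi / 3" by simp_all
  show "cos (2 * pi / 3) = - 1 / 2" "sin (2 * pi / 3) = sqrt 3 / 2"
    unfolding e(1) by (simp_all only: cos_diff sin_diff cos_60 sin_60 cos_pi sin_pi, simp_all?)
  show "cos (4 * pi / 3) = - 1 / 2" "sin (4 * pi / 3) = - sqrt 3 / 2"
    unfolding e(2) by (simp_all only: cos_add sin_add cos_60 sin_60 cos_pi sin_pi, simp_all?)
  show "cos (5 * pi / 3) = 1 / 2" "sin (5 * pi / 3) = - sqrt 3 / 2"
    unfolding e(3) by (simp_all only: cos_2pi_minus sin_2pi_minus cos_60 sin_60, simp_all?)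
qed

lemma hex_vertex_simps:
  "hex_vertex r c 0 = c + (r, 0)"
  "hex_vertex r c 1 = c + (r / 2, sqrt 3 / 2 * r)"
  "hex_vertex r c 2 = c + (- r / 2, sqrt 3 / 2 * r)"
  "hex_vertex r c 3 = c + (- r, 0)"
  "hex_vertex r c 4 = c + (- r / 2, - (sqrt 3 / 2 * r))"
  "hex_vertex r c 5 = c + (r / 2, - (sqrt 3 / 2 * r))"
  by (simp_all add: hex_vertex_def trig_sixths cos_60 sin_60)

lemma hexagon_eq: "hexagon r c = convex hull (hex_vertex r c ` {0, 1, 2, 3, 4, 5})"
proof -
  have "{..<6::nat} = {0, 1, 2, 3, 4, 5}" by auto
  then show ?thesis unfolding hexagon_def hex_vertex_def by simp
qed

lemma hexagon_le:
  assumes "\<And>k. k \<in> {0, 1, 2, 3, 4, 5} \<Longrightarrow> n \<bullet> hex_vertex r c k \<le> m" "z \<in> hexagon r c"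
  shows "n \<bullet> z \<le> m"
proof -
  have "hexagon r c \<subseteq> {z. n \<bullet> z \<le> m}"
    unfolding hexagon_eq using assms(1) by (intro hull_minimal convex_halfspace_le) auto
  then show ?thesis using assms(2) by auto
qed

text \<open>The normals of the three pairs of parallel edges, scaled to length \<open>2\<close>: the
  hexagon lies in the three strips of half-width \<open>sqrt 3 * r\<close> about its center.\<close>

definition strip_normals :: "(real \<times> real) set" where
  "strip_normals = {(0, 2), (sqrt 3, 1), (- sqrt 3, 1)}"

lemma hexagon_strip:
  assumes "r > 0" "z \<in> hexagon r c" "n \<in> strip_normals"
  shows "n \<bullet> z \<le> n \<bullet> c + sqrt 3 * r" "n \<bullet> c - sqrt 3 * r \<le> n \<bullet> z"
proof -
  show "n \<bullet> z \<le> n \<bullet> c + sqrt 3 * r"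
    by (rule hexagon_le[OF _ assms(2)])
      (use assms(1,3) in \<open>auto simp: strip_normals_def hex_vertex_simps inner_add_right field_simps
        simp flip: One_nat_def\<close>)
  have "(- n) \<bullet> z \<le> - (n \<bullet> c) + sqrt 3 * r"
    by (rule hexagon_le[OF _ assms(2)])
      (use assms(1,3) in \<open>auto simp: strip_normals_def hex_vertex_simps inner_add_right field_simps
        simp flip: One_nat_def\<close>)
  then show "n \<bullet> c - sqrt 3 * r \<le> n \<bullet> z" by simp
qed

lemma strip_attained:
  assumes "r > 0" "n \<in> strip_normals"
  shows "\<exists>z \<in> hexagon r c. n \<bullet> z = n \<bullet> c + sqrt 3 * r"
proof -
  have v: "hex_vertex r c k \<in> hexagon r c" if "k \<in> {0, 1, 2, 3, 4, 5}" for k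
    unfolding hexagon_eq using that by (intro hull_inc) auto
  have "n \<bullet> hex_vertex r c 1 = n \<bullet> c + sqrt 3 * r \<or> n \<bullet> hex_vertex r c 2 = n \<bullet> c + sqrt 3 * r"
    using assms by (auto simp: strip_normals_def hex_vertex_simps inner_add_right field_simps simp flip: One_nat_def)
  then show ?thesis using v[of 1] v[of 2] by auto
qed

text \<open>The maxima of a linear functional over equal hexagons agree, and two independent normals
  determine the center.\<close>

lemma hexagon_center_inj:
  assumes r: "r > 0" and eq: "hexagon r c = hexagon r c'"
  shows "c = c'"
proof -
  have le: "n \<bullet> c \<le> n \<bullet> c'" if "n \<in> strip_normals" "hexagon r c = hexagon r c'" for n c c'
    using strip_attained[OF r that(1), of c] hexagon_strip(1)[OF r _ that(1), of _ c'] that(2) by fastforce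
  have "n \<bullet> c = n \<bullet> c'" if "n \<in> strip_normals" for n
    using le[OF that eq] le[OF that eq[symmetric]] by simp
  from this[of "(0, 2)"] this[of "(sqrt 3, 1)"] show ?thesis
    by (cases c; cases c') (auto simp: strip_normals_def)
qed

lemma hexagon_translate: "(+) w ` hexagon r c = hexagon r (w + c)"
proof -
  have "(+) w ` hex_vertex r c ` {0, 1, 2, 3, 4, 5} = hex_vertex r (w + c) ` {0, 1, 2, 3, 4, 5}"
    unfolding image_image by (simp add: hex_vertex_def add.assoc)
  then show ?thesis unfolding hexagon_eq by (simp only: convex_hull_translation[symmetric])
qed

section \<open>Lattice coordinates and adjacency\<close>

definition center :: "real \<Rightarrow> real \<times> real \<Rightarrow> int \<times> int \<Rightarrow> real \<times> real" where
  "center r p s = (fst p + 3 / 2 * r * of_int (fst s), snd p + sqrt 3 / 2 * r * of_int (fst s + 2 * snd s))"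

lemma hex_tile_eq: "hex_tile r p s = hexagon r (center r p s)"
  unfolding hex_tile_def center_def
  by (cases s; cases p) (auto simp: algebra_simps intro!: arg_cong[where f = "hexagon r"])

lemma center_inj: "r > 0 \<Longrightarrow> center r p s = center r p t \<Longrightarrow> s = t"
  by (cases s; cases t) (auto simp: center_def)

lemma hex_tile_inj: "r > 0 \<Longrightarrow> hex_tile r p s = hex_tile r p t \<longleftrightarrow> s = t"
  unfolding hex_tile_eq using hexagon_center_inj center_inj by blast

lemma hex_tile_translate:
  "r > 0 \<Longrightarrow> hex_tile r p t = (+) w ` hex_tile r p s \<longleftrightarrow> center r p t = w + center r p s"
  unfolding hex_tile_eq hexagon_translate using hexagon_center_inj by metis

text \<open>Centers of tiles that meet differ by at most two half-widths in each normal direction.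
  These differences are \<open>sqrt 3 * r\<close> times the integers \<open>da + 2 * db\<close>,
  \<open>2 * da + db\<close> and \<open>db - da\<close>, and bounding all three by \<open>2\<close>
  leaves the tile itself and six others.\<close>

lemma meeting_tiles:
  assumes r: "r > 0" and z: "z \<in> hex_tile r p s" "z \<in> hex_tile r p t"
  shows "s = t \<or> neighbours s t"
proof -
  define da where "da = fst t - fst s"
  define db where "db = snd t - snd s"
  have q: "\<bar>n \<bullet> center r p t - n \<bullet> center r p s\<bar> \<le> 2 * sqrt 3 * r" if "n \<in> strip_normals" for n
    using hexagon_strip[OF r z(1)[unfolded hex_tile_eq] that] hexagon_strip[OF r z(2)[unfolded hex_tile_eq] that]
    by (simp add: abs_le_iff)
  have sr: "0 < sqrt 3 * r" using r by simp
  have bound: "\<bar>v\<bar> \<le> 2" if "\<bar>sqrt 3 * r * of_int v\<bar> \<le> 2 * sqrt 3 * r" for v :: int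
  proof -
    have "\<bar>sqrt 3 * r * of_int v\<bar> = sqrt 3 * r * \<bar>of_int v\<bar>"
      using sr by (simp only: abs_mult[of "sqrt 3 * r"] abs_of_pos)
    then have "sqrt 3 * r * \<bar>of_int v\<bar> \<le> sqrt 3 * r * 2" using that by simp
    then have "\<bar>of_int v :: real\<bar> \<le> 2" using sr by (simp only: mult_le_cancel_left_pos)
    then show ?thesis by linarith
  qed
  have "(0, 2) \<bullet> center r p t - (0, 2) \<bullet> center r p s = sqrt 3 * r * of_int (da + 2 * db)"
    by (simp add: center_def da_def db_def algebra_simps)
  with q[of "(0, 2)"] bound have 1: "\<bar>da + 2 * db\<bar> \<le> 2" by (simp add: strip_normals_def)
  have "(sqrt 3, 1) \<bullet> center r p t - (sqrt 3, 1) \<bullet> center r p s = sqrt 3 * r * of_int (2 * da + db)"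
    by (simp add: center_def da_def db_def algebra_simps)
  with q[of "(sqrt 3, 1)"] bound have 2: "\<bar>2 * da + db\<bar> \<le> 2" by (simp add: strip_normals_def)
  have "(- sqrt 3, 1) \<bullet> center r p t - (- sqrt 3, 1) \<bullet> center r p s = sqrt 3 * r * of_int (db - da)"
    by (simp add: center_def da_def db_def algebra_simps)
  with q[of "(- sqrt 3, 1)"] bound have 3: "\<bar>db - da\<bar> \<le> 2" by (simp add: strip_normals_def)
  from 1 2 3 have "da = -1 \<or> da = 0 \<or> da = 1" "db = -1 \<or> db = 0 \<or> db = 1" by arith+
  then have "(da, db) \<in> {(0, 0), (1, 0), (0, 1), (-1, 1), (-1, 0), (0, -1), (1, -1)}"
    using 1 3 by (elim disjE) simp_all
  then show ?thesis by (auto simp: neighbours_def da_def db_def prod_eq_iff)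
qed

text \<open>The supporting line \<open>n \<bullet> z = m\<close> contains the two vertices and
  strictly separates them from the others, which is what the criterion for faces of convex hulls
  asks for.\<close>

lemma edge_of_hexagon:
  assumes ij: "{i, j} \<subseteq> {0, 1, 2, 3, 4, 5}" "hex_vertex r c i \<noteq> hex_vertex r c j"
    and on: "n \<bullet> hex_vertex r c i = m" "n \<bullet> hex_vertex r c j = m"
    and off: "\<And>k. k \<in> {0, 1, 2, 3, 4, 5} - {i, j} \<Longrightarrow> n \<bullet> hex_vertex r c k < m"
  shows "closed_segment (hex_vertex r c i) (hex_vertex r c j) edge_of hexagon r c"
proof -
  let ?S = "hex_vertex r c ` {0, 1, 2, 3, 4, 5}" and ?T = "{hex_vertex r c i, hex_vertex r c j}"
  have "affine hull ?T \<subseteq> {z. n \<bullet> z = m}"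
    using on by (intro hull_minimal affine_hyperplane) auto
  moreover have "convex hull (?S - ?T) \<subseteq> {z. n \<bullet> z < m}"
  proof (rule hull_minimal)
    show "?S - ?T \<subseteq> {z. n \<bullet> z < m}" using off by blast
  qed (rule convex_halfspace_lt)
  ultimately have "affine hull ?T \<inter> convex hull (?S - ?T) = {}" by fastforce
  then have "(convex hull ?T) face_of (convex hull ?S)"
    using ij by (intro face_of_convex_hulls) auto
  then show ?thesis
    using ij(2) unfolding edge_of_def hexagon_eq segment_convex_hull by (simp add: aff_dim_convex_hull aff_dim_2)
qed

lemma adjacent_commute: "adjacent s t \<longleftrightarrow> adjacent t s"
  unfolding adjacent_def by metis

text \<open>Only the three upward steps are treated, the downward ones being their inverses. In each
  case an edge of one hexagon and an edge of the other have the same endpoints.\<close>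

lemma adjacent_of_step:
  assumes r: "r > 0" and st: "(fst t - fst s, snd t - snd s) \<in> {(1, 0), (0, 1), (-1, 1)}"
  shows "adjacent (hex_tile r p s) (hex_tile r p t)"
proof -
  let ?c = "center r p s" and ?c' = "center r p t"
  note simps = hex_vertex_simps inner_add_right field_simps
  have ne: "hex_tile r p s \<noteq> hex_tile r p t" using st by (auto simp: hex_tile_inj[OF r])
  consider "?c' = ?c + (3 / 2 * r, sqrt 3 / 2 * r)" | "?c' = ?c + (0, sqrt 3 * r)"
    | "?c' = ?c + (- (3 / 2 * r), sqrt 3 / 2 * r)"
  proof -
    have "(fst t = fst s + 1 \<and> snd t = snd s) \<or> (fst t = fst s \<and> snd t = snd s + 1)
      \<or> (fst t = fst s - 1 \<and> snd t = snd s + 1)" using st by auto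
    then show ?thesis
    proof (elim disjE)
      assume "fst t = fst s + 1 \<and> snd t = snd s"
      then show ?thesis by (intro that(1)) (auto simp: center_def prod_eq_iff algebra_simps)
    next
      assume "fst t = fst s \<and> snd t = snd s + 1"
      then show ?thesis by (intro that(2)) (auto simp: center_def prod_eq_iff algebra_simps)
    next
      assume "fst t = fst s - 1 \<and> snd t = snd s + 1"
      then have f: "fst t = fst s - 1" "snd t = snd s + 1" by auto
      show ?thesis by (intro that(3)) (simp add: center_def f field_simps)
    qed
  qed
  then have "\<exists>F. F edge_of hexagon r ?c \<and> F edge_of hexagon r ?c'"
  proof cases
    case 1
    have e: "hex_vertex r ?c' 4 = hex_vertex r ?c 0" "hex_vertex r ?c' 3 = hex_vertex r ?c 1"
      unfolding 1 hex_vertex_simps by (simp_all add: prod_eq_iff)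
    have "closed_segment (hex_vertex r ?c 0) (hex_vertex r ?c 1) edge_of hexagon r ?c"
      by (rule edge_of_hexagon[where n = "(sqrt 3, 1)" and m = "(sqrt 3, 1) \<bullet> ?c + sqrt 3 * r"])
        (use r in \<open>auto simp: simps simp flip: One_nat_def\<close>)
    moreover have "closed_segment (hex_vertex r ?c' 4) (hex_vertex r ?c' 3) edge_of hexagon r ?c'"
      by (rule edge_of_hexagon[where n = "(- sqrt 3, - 1)" and m = "(- sqrt 3, - 1) \<bullet> ?c' + sqrt 3 * r"])
        (use r in \<open>auto simp: simps simp flip: One_nat_def\<close>)
    ultimately show ?thesis unfolding e by blast
  next
    case 2
    have e: "hex_vertex r ?c' 5 = hex_vertex r ?c 1" "hex_vertex r ?c' 4 = hex_vertex r ?c 2"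
      unfolding 2 hex_vertex_simps by (simp_all add: prod_eq_iff)
    have "closed_segment (hex_vertex r ?c 1) (hex_vertex r ?c 2) edge_of hexagon r ?c"
      by (rule edge_of_hexagon[where n = "(0, 2)" and m = "(0, 2) \<bullet> ?c + sqrt 3 * r"])
        (use r in \<open>auto simp: simps simp flip: One_nat_def\<close>)
    moreover have "closed_segment (hex_vertex r ?c' 5) (hex_vertex r ?c' 4) edge_of hexagon r ?c'"
      by (rule edge_of_hexagon[where n = "(0, - 2)" and m = "(0, - 2) \<bullet> ?c' + sqrt 3 * r"])
        (use r in \<open>auto simp: simps simp flip: One_nat_def\<close>)
    ultimately show ?thesis unfolding e by blast
  next
    case 3
    have e: "hex_vertex r ?c' 0 = hex_vertex r ?c 2" "hex_vertex r ?c' 5 = hex_vertex r ?c 3"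
      unfolding 3 hex_vertex_simps by (simp_all add: prod_eq_iff)
    have "closed_segment (hex_vertex r ?c 2) (hex_vertex r ?c 3) edge_of hexagon r ?c"
      by (rule edge_of_hexagon[where n = "(- sqrt 3, 1)" and m = "(- sqrt 3, 1) \<bullet> ?c + sqrt 3 * r"])
        (use r in \<open>auto simp: simps simp flip: One_nat_def\<close>)
    moreover have "closed_segment (hex_vertex r ?c' 0) (hex_vertex r ?c' 5) edge_of hexagon r ?c'"
      by (rule edge_of_hexagon[where n = "(sqrt 3, - 1)" and m = "(sqrt 3, - 1) \<bullet> ?c' + sqrt 3 * r"])
        (use r in \<open>auto simp: simps simp flip: One_nat_def\<close>)
    ultimately show ?thesis unfolding e by blast
  qed
  then show ?thesis using ne unfolding adjacent_def hex_tile_eq by blast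
qed

lemma adjacent_iff:
  assumes r: "r > 0"
  shows "adjacent (hex_tile r p s) (hex_tile r p t) \<longleftrightarrow> neighbours s t"
proof
  assume adj: "adjacent (hex_tile r p s) (hex_tile r p t)"
  then obtain F where F: "F edge_of hex_tile r p s" "F edge_of hex_tile r p t"
    unfolding adjacent_def by blast
  then have "F \<noteq> {}" "F \<subseteq> hex_tile r p s" "F \<subseteq> hex_tile r p t"
    by (auto simp: edge_of_def dest: face_of_imp_subset)
  then show "neighbours s t" using meeting_tiles[OF r] adj unfolding adjacent_def by blast
next
  assume "neighbours s t"
  then have "(fst t - fst s, snd t - snd s) \<in> {(1, 0), (0, 1), (-1, 1)} \<or>
     (fst s - fst t, snd s - snd t) \<in> {(1, 0), (0, 1), (-1, 1)}"
    unfolding neighbours_def minus_diff_eq[symmetric, of "fst s"] minus_diff_eq[symmetric, of "snd s"]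
    by (simp only: insert_iff empty_iff prod.inject simp_thms) (elim disjE conjE; simp)
  then show "adjacent (hex_tile r p s) (hex_tile r p t)"
    using adjacent_of_step[OF r] adjacent_commute by metis
qed

text \<open>Of the six neighbours only \<open>(1, 0)\<close> and \<open>(1, -1)\<close> lie further
  right, and the latter lies lower.\<close>

lemma northeast_neighbour_step:
  assumes r: "r > 0" and ne: "northeast_neighbour (hex_tile r p s) (hex_tile r p t)"
  shows "t = (fst s + 1, snd s)"
proof -
  obtain u v where uv: "u > 0" "v > 0" and t: "hex_tile r p t = (+) (u, v) ` hex_tile r p s"
    using ne unfolding northeast_neighbour_def by blast
  have n: "neighbours s t" using ne adjacent_iff[OF r] unfolding northeast_neighbour_def by blast
  have c: "center r p t = (u, v) + center r p s" using t hex_tile_translate[OF r] by blast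
  have "3 / 2 * r * of_int (fst t - fst s) = u"
    "sqrt 3 / 2 * r * of_int ((fst t + 2 * snd t) - (fst s + 2 * snd s)) = v"
    using c by (auto simp: center_def prod_eq_iff algebra_simps)
  then have "fst t - fst s > 0" "(fst t + 2 * snd t) - (fst s + 2 * snd s) > 0"
    using uv r zero_less_mult_pos[of "3 / 2 * r" "of_int (fst t - fst s)"]
      zero_less_mult_pos[of "sqrt 3 / 2 * r" "of_int ((fst t + 2 * snd t) - (fst s + 2 * snd s))"]
    by (simp_all only: of_int_0_less_iff) simp_all
  then show ?thesis using n by (auto simp: neighbours_def prod_eq_iff)
qed

text \<open>The tiles \<open>d n\<close> sit at \<open>(a + n, b)\<close>. Translation vectors are
  positive multiples of differences of columns and of heights, so the quadrants become integer
  inequalities, and shifting \<open>n\<close> absorbs \<open>a\<close> and \<open>b\<close>.\<close>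

lemma winning_iff_lattice_win:
  assumes r: "r > 0" and d: "\<forall>n. d n \<in> hex_tiling r p"
    and ne: "\<forall>n. northeast_neighbour (d (n - 1)) (d n)"
  shows "winning_for_black (hex_tiling r p) d x \<longleftrightarrow> lattice_win (\<lambda>s. x (hex_tile r p s))"
proof -
  obtain \<delta> where \<delta>: "\<And>n. d n = hex_tile r p (\<delta> n)"
  proof -
    have "\<forall>n. \<exists>s. d n = hex_tile r p s" using d unfolding hex_tiling_def by blast
    then show thesis using that by metis
  qed
  have step: "\<delta> n = (fst (\<delta> (n - 1)) + 1, snd (\<delta> (n - 1)))" for n
    using ne by (intro northeast_neighbour_step[OF r, of p]) (simp add: \<delta>[symmetric])
  obtain a b where ab: "\<delta> 0 = (a, b)" by (cases "\<delta> 0")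
  have "\<delta> n = (a + n, b)" for n
  proof (induction n rule: int_induct[where k = 0])
    case base show ?case by (simp add: ab)
  next
    case (step1 i) then show ?case using step[of "i + 1"] by simp
  next
    case (step2 i) then show ?case using step[of i] by (auto simp: prod_eq_iff)
  qed
  then have dn: "d n = hex_tile r p (a + n, b)" for n by (simp add: \<delta>)
  have le: "center r p s = (u, v) + center r p s' \<longleftrightarrow>
      u = 3 / 2 * r * of_int (fst s - fst s') \<and>
      v = sqrt 3 / 2 * r * of_int ((fst s + 2 * snd s) - (fst s' + 2 * snd s'))" for s s' u v
    by (auto simp: center_def prod_eq_iff algebra_simps)
  have ex: "(\<exists>u\<ge>0. \<exists>v\<ge>0. u = y \<and> v = z) \<longleftrightarrow> 0 \<le> y \<and> 0 \<le> z"
    "(\<exists>u\<le>0. \<exists>v\<le>0. u = y \<and> v = z) \<longleftrightarrow> y \<le> 0 \<and> z \<le> 0" for y z :: real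
    by blast+
  have sgn: "0 \<le> 3 / 2 * r * of_int z \<longleftrightarrow> 0 \<le> z" "0 \<le> sqrt 3 / 2 * r * of_int z \<longleftrightarrow> 0 \<le> z"
    "3 / 2 * r * of_int z \<le> 0 \<longleftrightarrow> z \<le> 0" "sqrt 3 / 2 * r * of_int z \<le> 0 \<longleftrightarrow> z \<le> 0" for z :: int
    using r by (auto simp: zero_le_mult_iff mult_le_0_iff)
  have Qp: "hex_tile r p s \<in> Q_plus (hex_tiling r p) d n \<longleftrightarrow>
      a + n \<le> fst s \<and> a + n + 2 * b \<le> fst s + 2 * snd s" for s n
    unfolding Q_plus_def mem_Collect_eq dn hex_tile_translate[OF r] le ex sgn
    by (auto simp: hex_tiling_def)
  have Qm: "hex_tile r p s \<in> Q_minus (hex_tiling r p) d n \<longleftrightarrow>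
      fst s \<le> a + n \<and> fst s + 2 * snd s \<le> a + n + 2 * b" for s n
    unfolding Q_minus_def mem_Collect_eq dn hex_tile_translate[OF r] le ex sgn
    by (auto simp: hex_tiling_def)
  have rp: "reaches (Q_plus (hex_tiling r p) d) (\<lambda>i. hex_tile r p (t i)) \<longleftrightarrow>
     (\<forall>n. \<exists>i. \<forall>j\<ge>i. n \<le> fst (t j) \<and> n \<le> fst (t j) + 2 * snd (t j))" for t
    unfolding reaches_def Qp
  proof safe
    fix n assume *: "\<forall>n. \<exists>i. \<forall>j\<ge>i. a + n \<le> fst (t j) \<and> a + n + 2 * b \<le> fst (t j) + 2 * snd (t j)"
    from spec[OF *, of "max (n - a) (n - a - 2 * b)"]
    show "\<exists>i. \<forall>j\<ge>i. n \<le> fst (t j) \<and> n \<le> fst (t j) + 2 * snd (t j)" by fastforce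
  next
    fix n assume *: "\<forall>n. \<exists>i. \<forall>j\<ge>i. n \<le> fst (t j) \<and> n \<le> fst (t j) + 2 * snd (t j)"
    from spec[OF *, of "max (a + n) (a + n + 2 * b)"]
    show "\<exists>i. \<forall>j\<ge>i. a + n \<le> fst (t j) \<and> a + n + 2 * b \<le> fst (t j) + 2 * snd (t j)" by fastforce
  qed
  have rm: "reaches (Q_minus (hex_tiling r p) d) (\<lambda>i. hex_tile r p (t i)) \<longleftrightarrow>
     (\<forall>n. \<exists>i. \<forall>j\<ge>i. fst (t j) \<le> n \<and> fst (t j) + 2 * snd (t j) \<le> n)" for t
    unfolding reaches_def Qm
  proof safe
    fix n assume *: "\<forall>n. \<exists>i. \<forall>j\<ge>i. fst (t j) \<le> a + n \<and> fst (t j) + 2 * snd (t j) \<le> a + n + 2 * b"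
    from spec[OF *, of "min (n - a) (n - a - 2 * b)"]
    show "\<exists>i. \<forall>j\<ge>i. fst (t j) \<le> n \<and> fst (t j) + 2 * snd (t j) \<le> n" by fastforce
  next
    fix n assume *: "\<forall>n. \<exists>i. \<forall>j\<ge>i. fst (t j) \<le> n \<and> fst (t j) + 2 * snd (t j) \<le> n"
    from spec[OF *, of "min (a + n) (a + n + 2 * b)"]
    show "\<exists>i. \<forall>j\<ge>i. fst (t j) \<le> a + n \<and> fst (t j) + 2 * snd (t j) \<le> a + n + 2 * b" by fastforce
  qed
  have bp: "black_path (hex_tiling r p) x (\<lambda>i. hex_tile r p (t i)) \<longleftrightarrow>
     (\<forall>i. x (hex_tile r p (t i)) \<and> neighbours (t i) (t (Suc i)))" for t
    unfolding black_path_def adjacent_iff[OF r] by (auto simp: hex_tiling_def)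
  have lift: "\<exists>t'. t = (\<lambda>i. hex_tile r p (t' i))" if "black_path (hex_tiling r p) x t" for t
  proof -
    have "\<forall>i. \<exists>s. t i = hex_tile r p s" using that unfolding black_path_def hex_tiling_def by blast
    then show ?thesis by (metis ext)
  qed
  show ?thesis
  proof
    assume "winning_for_black (hex_tiling r p) d x"
    then obtain t s where *: "black_path (hex_tiling r p) x t" "black_path (hex_tiling r p) x s" "t 0 = s 0"
      "reaches (Q_plus (hex_tiling r p) d) t" "reaches (Q_minus (hex_tiling r p) d) s"
      unfolding winning_for_black_def by blast
    obtain t' s' where t': "t = (\<lambda>i. hex_tile r p (t' i))" and s': "s = (\<lambda>i. hex_tile r p (s' i))"
      using lift[OF *(1)] lift[OF *(2)] by blast
    have "t' 0 = s' 0" using *(3) by (simp add: t' s' hex_tile_inj[OF r])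
    with * show "lattice_win (\<lambda>s. x (hex_tile r p s))"
      unfolding t' s' bp rp rm lattice_win_def by blast
  next
    assume "lattice_win (\<lambda>s. x (hex_tile r p s))"
    then obtain t s where "black_path (hex_tiling r p) x (\<lambda>i. hex_tile r p (t i))"
      "black_path (hex_tiling r p) x (\<lambda>i. hex_tile r p (s i))" "t 0 = s 0"
      "reaches (Q_plus (hex_tiling r p) d) (\<lambda>i. hex_tile r p (t i))"
      "reaches (Q_minus (hex_tiling r p) d) (\<lambda>i. hex_tile r p (s i))"
      unfolding bp rp rm lattice_win_def by blast
    then show "winning_for_black (hex_tiling r p) d x"
      unfolding winning_for_black_def by (metis (no_types, lifting))
  qed
qed

section \<open>Hardness\<close>

text \<open>All indices in the definition are bounded by the column: \<open>h\<close> and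
  \<open>l\<close> are at most \<open>t\<close>, and \<open>K' \<le> h\<close>,
  \<open>c \<le> l\<close>.\<close>

lemma depth_cong:
  assumes "\<And>k m i j. k \<le> t \<Longrightarrow> m \<le> t \<Longrightarrow> i \<le> t \<Longrightarrow> j \<le> t \<Longrightarrow> R k m i j = R' k m i j"
  shows "depth R K t = depth R' K t"
proof -
  have ref: "refuted R K' h c l = refuted R' K' h c l" if "K' \<le> t" "h \<le> t" "c \<le> t" "l \<le> t" for K' h c l
    unfolding refuted_def using assms that by (meson le_trans)
  have dip: "dip R K h l = dip R' K h l" if "h \<le> t" "l \<le> t" for h l
    unfolding dip_def using that
    by (intro ex_cong1 conj_cong refl disj_cong arg_cong[where f = Not] ref) auto
  have "depth_ge R K t s = depth_ge R' K t s" for s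
    unfolding depth_ge_def using dip by auto
  then show ?thesis unfolding depth_def by simp
qed

lemma black_cong:
  assumes "\<And>k m i j. k \<le> nat t \<Longrightarrow> m \<le> nat t \<Longrightarrow> i \<le> nat t \<Longrightarrow> j \<le> nat t \<Longrightarrow> R k m i j = R' k m i j"
  shows "black R (t, b) = black R' (t, b)"
  using depth_cong[of "nat t" R R'] assms by (simp add: black_def lane_def)

section \<open>Finitely determined maps on the Cantor space\<close>

definition agree :: "nat \<Rightarrow> (nat \<Rightarrow> bool) \<Rightarrow> (nat \<Rightarrow> bool) \<Rightarrow> bool" where
  "agree N x y \<longleftrightarrow> (\<forall>i<N. x i = y i)"

lemma open_finitely_determined:
  assumes "\<And>x y. x \<in> A \<Longrightarrow> agree N x y \<Longrightarrow> y \<in> A"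
  shows "open A"
proof -
  have "open {y. agree N x y}" for x
  proof -
    have "{y. agree N x y} = (\<Inter>i\<in>{..<N}. (\<lambda>y. y i) -` {x i})" by (auto simp: agree_def)
    moreover have "open ((\<lambda>y::nat \<Rightarrow> bool. y i) -` {x i})" for i
      by (intro open_vimage continuous_on_product_coordinates open_discrete)
    ultimately show ?thesis by auto
  qed
  then have "open (\<Union>x\<in>A. {y. agree N x y})" by blast
  moreover have "(\<Union>x\<in>A. {y. agree N x y}) = A" using assms by (auto simp: agree_def)
  ultimately show ?thesis by simp
qed

lemma open_contains_cylinder:
  fixes A :: "(nat \<Rightarrow> bool) set"
  assumes "open A" "x \<in> A"
  shows "\<exists>N. {y. agree N x y} \<subseteq> A"
proof -
  have "openin (product_topology (\<lambda>_. euclidean) UNIV) A" using assms(1) by (simp add: open_fun_def)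
  from product_topology_open_contains_basis[OF this assms(2)]
  obtain X where X: "x \<in> (\<Pi>\<^sub>E i\<in>UNIV. X i)" "finite {i. X i \<noteq> UNIV}" "(\<Pi>\<^sub>E i\<in>UNIV. X i) \<subseteq> A"
    by auto
  obtain N where N: "\<And>i. X i \<noteq> UNIV \<Longrightarrow> i < N"
    using X(2) unfolding finite_nat_set_iff_bounded by auto
  have "y \<in> A" if "agree N x y" for y
  proof -
    have "y i \<in> X i" for i
    proof (cases "X i = UNIV")
      case False
      then have "y i = x i" using N[of i] that by (simp add: agree_def)
      then show ?thesis using X(1) by (simp add: PiE_iff)
    qed simp
    then show ?thesis using X(3) by (auto simp: PiE_iff)
  qed
  then show ?thesis by blast
qed

lemma continuous_on_finitely_determined:
  fixes f :: "(nat \<Rightarrow> bool) \<Rightarrow> nat \<Rightarrow> bool"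
  assumes "\<And>n. \<exists>N. \<forall>x y. agree N x y \<longrightarrow> f x n = f y n"
  shows "continuous_on UNIV f"
proof (rule continuous_on_coordinatewise_then_product)
  fix n
  obtain N where "\<And>x y. agree N x y \<Longrightarrow> f x n = f y n" using assms by blast
  then have "open ((\<lambda>x. f x n) -` B)" for B
    by (intro open_finitely_determined[where N = N]) auto
  then show "continuous_on UNIV (\<lambda>x. f x n)"
    by (simp add: continuous_on_open_vimage)
qed

text \<open>The three alternations of union and complement give the quantifiers over
  \<open>k\<close>, \<open>m\<close> and \<open>i\<close>; the quantifier over \<open>j\<close>
  comes from the innermost open sets.\<close>

lemma boldface_Sigma_4_normal_form:
  fixes A :: "(nat \<Rightarrow> bool) set"
  assumes "A \<in> boldface_Sigma 4"
  obtains R :: "(nat \<Rightarrow> bool) \<Rightarrow> matrix" where "A = {x. \<exists>k. \<forall>m. \<exists>i. \<forall>j. R x k m i j}"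
    and "\<And>x y k m i j. agree j x y \<Longrightarrow> R x k m i j = R y k m i j"
proof -
  have *: "(A \<in> boldface_Sigma (Suc (Suc n))) = (\<exists>B. (\<forall>i. B i \<in> boldface_Sigma (Suc n)) \<and> A = (\<Union>i::nat. - B i))"
    for A :: "(nat \<Rightarrow> bool) set" and n by auto
  have "A \<in> boldface_Sigma (Suc (Suc (Suc (Suc 0))))" using assms by (simp add: numeral_eq_Suc)
  then obtain B where B: "\<And>k. B k \<in> boldface_Sigma (Suc (Suc (Suc 0)))" "A = (\<Union>k::nat. - B k)"
    unfolding * by blast
  from B(1) have "\<forall>k. \<exists>C. (\<forall>m. C m \<in> boldface_Sigma (Suc (Suc 0))) \<and> B k = (\<Union>m::nat. - C m)"
    unfolding * by blast
  then obtain C where C: "\<And>k m. C k m \<in> boldface_Sigma (Suc (Suc 0))" "\<And>k. B k = (\<Union>m::nat. - C k m)"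
    by metis
  from C(1) have "\<forall>k m. \<exists>D. (\<forall>i. D i \<in> boldface_Sigma (Suc 0)) \<and> C k m = (\<Union>i::nat. - D i)"
    unfolding * by blast
  then obtain D where D: "\<And>k m i. D k m i \<in> boldface_Sigma (Suc 0)" "\<And>k m. C k m = (\<Union>i::nat. - D k m i)"
    by metis
  have D': "open (D k m i)" for k m i using D(1) by simp
  \<comment> \<open>A point is outside an open set iff none of its cylinders is contained in the
    set. The cylinder of length \<open>j\<close> depends only on the first \<open>j\<close>
    bits.\<close>
  define R :: "(nat \<Rightarrow> bool) \<Rightarrow> matrix" where "R x k m i j \<longleftrightarrow> \<not> {y. agree j x y} \<subseteq> D k m i" for x k m i j
  have "x \<notin> D k m i \<longleftrightarrow> (\<forall>j. R x k m i j)" for x k m i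
  proof
    show "\<forall>j. R x k m i j" if "x \<notin> D k m i" using that by (auto simp: R_def agree_def)
    show "x \<notin> D k m i" if "\<forall>j. R x k m i j" using that open_contains_cylinder[OF D', of x k m i] unfolding R_def by blast
  qed
  moreover have "A = {x. \<exists>k. \<forall>m. \<exists>i. x \<notin> D k m i}"
    unfolding B(2) C(2) D(2) by (simp add: set_eq_iff)
  ultimately have "A = {x. \<exists>k. \<forall>m. \<exists>i. \<forall>j. R x k m i j}" by (simp only:)
  moreover have "R x k m i j = R y k m i j" if "agree j x y" for x y k m i j
  proof -
    have "{z. agree j x z} = {z. agree j y z}" using that by (auto simp: agree_def)
    then show ?thesis by (simp add: R_def)
  qed
  ultimately show ?thesis using that by blast
qed

text \<open>Correctness of the reduction for an arbitrary matrix depending on \<open>x\<close>,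
  shared by both hierarchies; they differ only in the regularity of the map.\<close>

lemma vimage_winning_set:
  assumes r: "r > 0" and d: "\<forall>n. d n \<in> hex_tiling r p"
    and ne: "\<forall>n. northeast_neighbour (d (n - 1)) (d n)"
    and e: "bij_betw e UNIV (hex_tiling r p)" "\<And>n. e n = hex_tile r p (c n)"
  shows "(\<lambda>x n. black (R x) (c n)) -` winning_set (hex_tiling r p) d e =
    {x. \<exists>k. \<forall>m. \<exists>i. \<forall>j. R x k m i j}"
proof -
  have inj: "inj e" using e(1) by (simp add: bij_betw_def)
  have "coloring_of e (\<lambda>n. black (R x) (c n)) (hex_tile r p s) = black (R x) s" for x s
  proof -
    have "hex_tile r p s \<in> range e" using e(1) by (auto simp: bij_betw_def hex_tiling_def)
    then obtain n where n: "hex_tile r p s = e n" by blast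
    then have "c n = s" using e(2)[of n] hex_tile_inj[OF r] by metis
    then show ?thesis unfolding coloring_of_def n by (simp add: the_inv_f_f[OF inj])
  qed
  then show ?thesis
    unfolding winning_set_def winning_iff_lattice_win[OF r d ne]
    by (auto simp: lattice_win_black[symmetric])
qed

theorem theorem2:
  fixes r :: real and p :: "real \<times> real"
    and d :: "int \<Rightarrow> tile" and e :: "nat \<Rightarrow> tile"
  assumes "r > 0"
    and "\<forall>n. d n \<in> hex_tiling r p"
    and "\<forall>n. northeast_neighbour (d (n - 1)) (d n)"
    and "computable_enumeration r p e"
  shows "(\<forall>A \<in> boldface_Sigma 4. \<exists>f :: (nat \<Rightarrow> bool) \<Rightarrow> (nat \<Rightarrow> bool).
            continuous_on UNIV f \<and> f -` winning_set (hex_tiling r p) d e = A) \<and>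
         (\<forall>A \<in> lightface_Sigma 4. \<exists>f :: (nat \<Rightarrow> bool) \<Rightarrow> (nat \<Rightarrow> bool).
            computable_functional f \<and> f -` winning_set (hex_tiling r p) d e = A)"
proof -
  obtain g where bij: "bij_betw e UNIV (hex_tiling r p)" and g: "computable_fun g"
    and e: "\<And>n. e n = hex_tile r p (map_prod int_decode int_decode (prod_decode (g n)))"
    using assms(4) unfolding computable_enumeration_def by blast
  let ?c = "\<lambda>n. map_prod int_decode int_decode (prod_decode (g n))"
  note win = vimage_winning_set[OF assms(1-3) bij e]
  show ?thesis
  proof (intro conjI ballI)
    fix A :: "(nat \<Rightarrow> bool) set"
    assume "A \<in> boldface_Sigma 4"
    then obtain R :: "(nat \<Rightarrow> bool) \<Rightarrow> matrix" where A: "A = {x. \<exists>k. \<forall>m. \<exists>i. \<forall>j. R x k m i j}"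
      and R: "\<And>x y k m i j. agree j x y \<Longrightarrow> R x k m i j = R y k m i j"
      by (rule boldface_Sigma_4_normal_form) (rule that)
    have "continuous_on UNIV (\<lambda>x n. black (R x) (?c n))"
    proof (rule continuous_on_finitely_determined)
      fix n
      obtain t b where tb: "?c n = (t, b)" by (cases "?c n")
      have "black (R x) (t, b) = black (R y) (t, b)" if "agree (nat t) x y" for x y
        using that by (intro black_cong R) (auto simp: agree_def)
      then show "\<exists>N. \<forall>x y. agree N x y \<longrightarrow> black (R x) (?c n) = black (R y) (?c n)"
        unfolding tb by blast
    qed
    with win[of R] A show "\<exists>f :: (nat \<Rightarrow> bool) \<Rightarrow> nat \<Rightarrow> bool. continuous_on UNIV f \<and>
        f -` winning_set (hex_tiling r p) d e = A"
      by (intro exI[of _ "\<lambda>x n. black (R x) (?c n)"]) simp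
  next
    fix A assume "A \<in> lightface_Sigma 4"
    then obtain R where A: "A = {x. exists_prefix 4 (R x)}" and R: "computable_rel 4 R"
      unfolding lightface_Sigma_def by blast
    have "A = {x. \<exists>k. \<forall>m. \<exists>i. \<forall>j. R x [k, m, i, j]}"
      unfolding A by (simp add: numeral_eq_Suc)
    with win[of "\<lambda>x k m i j. R x [k, m, i, j]"] computable_black[OF R g]
    show "\<exists>f. computable_functional f \<and> f -` winning_set (hex_tiling r p) d e = A"
      by blast
  qed
qed

end
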